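(* Let $k$ be an algebraically closed field of characteristic two and let $h\in k[x_1,x_2,x_3,x_4]$ be a non-degenerate cubic form. Then the hypersurface in $\mathbb P^3$ defined by $h$ fails to be Frobenius split if and only if, up to linear change of coordinates, $h$ is exactly one of the following: (1) $x_1^3+x_2^3+x_3^3+x_4^3$; (2) $x_1^2x_4 + x_2^3 + x_1 x_3^2$; (3) $x_1^2x_4 + x_2^2x_3+ x_1 x_3^2$; (4) $x_1^2x_4 + x_2^3 + x_3^3$; (5) $x_1^2x_3 + x_2^2 x_4$. The first of these defines the unique (up to projective equivalence) smooth non-Frobenius split cubic surface. The surfaces defined by the second, third and fourth are normal, with an isolated singularity at $[0:0:0:1]$. The surface defined by the fifth is a non-normal cubic surface whose singular locus is the line $x_1=x_2=0$.
   Context: A form in $n$ variables is non-degenerate if it cannot be written as a form in fewer than $n$ variables after a linear change of coordinates (equivalently, the hypersurface it defines is not a cone over a hypersurface in a smaller-dimensional projective space). A scheme $X$ over a field of characteristic $p>0$ is Frobenius split if the map of sheaves $\mathcal O_X\to F_*\mathcal O_X$ induced by the Frobenius morphism $F:X\to X$ (the identity on the underlying space, the $p$-th power map on functions) splits as a map of $\mathcal O_X$-modules. A ring $R$ of characteristic $p$ is $F$-pure if its Frobenius map $R\to R$, $r\mapsto r^p$, is pure (it stays injective after tensoring with any $R$-module). The hypersurface in $\mathbb P^3$ defined by a cubic form $h$ is Frobenius split if and only if $k[x_1,x_2,x_3,x_4]/\langle h\rangle$ is $F$-pure. *)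

theory Defs
  imports
    "HOL-Analysis.Determinants"
    "HOL-Library.Poly_Mapping"
    "HOL-Library.Numeral_Type"
    "HOL-Library.FuncSet"
    "HOL-Computational_Algebra.Polynomial"
    "HOL-Algebra.Algebraic_Closure_Type"
begin

section \<open>Polynomials and forms\<close>

type_synonym ('v, 'k) mpoly = "('v \<Rightarrow>\<^sub>0 nat) \<Rightarrow>\<^sub>0 'k"

definition Const :: "'k \<Rightarrow> ('v, 'k::zero) mpoly" where
  "Const c = Poly_Mapping.single 0 c"

definition Var :: "'v \<Rightarrow> ('v, 'k::zero_neq_one) mpoly" where
  "Var i = Poly_Mapping.single (Poly_Mapping.single i 1) 1"

definition mdeg :: "('v::finite \<Rightarrow>\<^sub>0 nat) \<Rightarrow> nat" where
  "mdeg m = (\<Sum>i\<in>UNIV. Poly_Mapping.lookup m i)"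

text \<open>The zero polynomial is homogeneous of every degree.\<close>

definition homogeneous :: "nat \<Rightarrow> ('v::finite, 'k::zero) mpoly \<Rightarrow> bool" where
  "homogeneous d f \<longleftrightarrow> (\<forall>m\<in>Poly_Mapping.keys f. mdeg m = d)"

definition hom_part :: "nat \<Rightarrow> ('v::finite, 'k::comm_monoid_add) mpoly \<Rightarrow> ('v, 'k) mpoly" where
  "hom_part d f =
     (\<Sum>m | m \<in> Poly_Mapping.keys f \<and> mdeg m = d. Poly_Mapping.single m (Poly_Mapping.lookup f m))"

definition vars :: "('v, 'k::zero) mpoly \<Rightarrow> 'v set" where
  "vars f = (\<Union>m\<in>Poly_Mapping.keys f. Poly_Mapping.keys m)"

definition subst :: "('v::finite \<Rightarrow> ('w, 'k::comm_semiring_1) mpoly) \<Rightarrow> ('v, 'k) mpoly \<Rightarrow> ('w, 'k) mpoly" where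
  "subst \<sigma> f =
     (\<Sum>m\<in>Poly_Mapping.keys f.
        Const (Poly_Mapping.lookup f m) * (\<Prod>i\<in>UNIV. \<sigma> i ^ Poly_Mapping.lookup m i))"

text \<open>The subtraction of exponents below is truncated, but whenever the exponent of \<open>i\<close> in \<open>m\<close>
  is zero the coefficient vanishes.\<close>

definition partial_deriv :: "'v \<Rightarrow> ('v, 'k::comm_semiring_1) mpoly \<Rightarrow> ('v, 'k) mpoly" where
  "partial_deriv i f =
     (\<Sum>m\<in>Poly_Mapping.keys f.
        Poly_Mapping.single (m - Poly_Mapping.single i 1)
          (of_nat (Poly_Mapping.lookup m i) * Poly_Mapping.lookup f m))"

definition lin_change :: "'k^'v^'v \<Rightarrow> ('v::finite, 'k::comm_semiring_1) mpoly \<Rightarrow> ('v, 'k) mpoly" where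
  "lin_change g = subst (\<lambda>i. \<Sum>j\<in>UNIV. Const (g $ i $ j) * Var j)"

definition lin_equiv :: "('v::finite, 'k::comm_semiring_1) mpoly \<Rightarrow> ('v, 'k) mpoly \<Rightarrow> bool" where
  "lin_equiv f f' \<longleftrightarrow> (\<exists>g :: 'k^'v^'v. invertible g \<and> lin_change g f = f')"

text \<open>Projective equivalence of the hypersurfaces \<open>f = 0\<close> and \<open>f' = 0\<close>: a projective linear
  automorphism carries one to the other, so that the equations agree up to a nonzero scalar.\<close>

definition proj_equiv :: "('v::finite, 'k::field) mpoly \<Rightarrow> ('v, 'k) mpoly \<Rightarrow> bool" where
  "proj_equiv f f' \<longleftrightarrow>
     (\<exists>(g :: 'k^'v^'v) c. invertible g \<and> c \<noteq> 0 \<and> lin_change g f = Const c * f')"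

definition nondegenerate :: "('v::finite, 'k::comm_semiring_1) mpoly \<Rightarrow> bool" where
  "nondegenerate f \<longleftrightarrow> \<not> (\<exists>g :: 'k^'v^'v. invertible g \<and> card (vars (lin_change g f)) < CARD('v))"

section \<open>Closed subschemes of projective space\<close>

abbreviation poly_ring :: "('v, 'k::field) mpoly ring" where
  "poly_ring \<equiv> ring_of_type_algebra"

definition homogeneous_ideal :: "('v::finite, 'k::field) mpoly set \<Rightarrow> bool" where
  "homogeneous_ideal I \<longleftrightarrow> ideal I poly_ring \<and> (\<forall>f\<in>I. \<forall>d. hom_part d f \<in> I)"

text \<open>For a homogeneous ideal \<open>I\<close> of the polynomial ring \<open>S\<close>, we describe the scheme \<open>Proj (S/I)\<close>
  and its structure sheaf in the usual way, except that homogeneous primes of \<open>S/I\<close> are represented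
  by their preimages in \<open>S\<close> and elements of \<open>S/I\<close> by representatives in \<open>S\<close>.
  A prime contains the irrelevant ideal iff it contains all variables.\<close>

definition proj_points :: "('v::finite, 'k::field) mpoly set \<Rightarrow> ('v, 'k) mpoly set set" where
  "proj_points I =
     {P. primeideal P poly_ring \<and> homogeneous_ideal P \<and> I \<subseteq> P \<and> (\<exists>i. Var i \<notin> P)}"

definition zero_locus :: "('v::finite, 'k::field) mpoly set \<Rightarrow> ('v, 'k) mpoly set \<Rightarrow> ('v, 'k) mpoly set set" where
  "zero_locus I J = {P \<in> proj_points I. J \<subseteq> P}"

definition proj_open :: "('v::finite, 'k::field) mpoly set \<Rightarrow> ('v, 'k) mpoly set set \<Rightarrow> bool" where
  "proj_open I U \<longleftrightarrow> (\<exists>J. homogeneous_ideal J \<and> U = proj_points I - zero_locus I J)"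

text \<open>The local ring at \<open>P\<close>: degree-zero fractions \<open>a / f\<close> with \<open>f \<notin> P\<close>, where \<open>a / f = b / g\<close> iff
  \<open>s (a g - b f) \<in> I\<close> for some homogeneous \<open>s \<notin> P\<close>; this is the homogeneous localization \<open>(S/I)\<^sub>(\<^sub>P\<^sub>)\<close>.\<close>

definition fractions :: "('v::finite, 'k::field) mpoly set \<Rightarrow> (('v, 'k) mpoly \<times> ('v, 'k) mpoly) set" where
  "fractions P = {(a, f). f \<notin> P \<and> (\<exists>d. homogeneous d a \<and> homogeneous d f)}"

definition frac_rel :: "('v::finite, 'k::field) mpoly set \<Rightarrow> ('v, 'k) mpoly set \<Rightarrow>
    ((('v, 'k) mpoly \<times> ('v, 'k) mpoly) \<times> (('v, 'k) mpoly \<times> ('v, 'k) mpoly)) set" where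
  "frac_rel I P =
     {((a, f), (b, g)). (a, f) \<in> fractions P \<and> (b, g) \<in> fractions P \<and>
        (\<exists>s e. homogeneous e s \<and> s \<notin> P \<and> s * (a * g - b * f) \<in> I)}"

type_synonym ('v, 'k) germ = "(('v, 'k) mpoly \<times> ('v, 'k) mpoly) set"

definition frac :: "('v::finite, 'k::field) mpoly set \<Rightarrow> ('v, 'k) mpoly set \<Rightarrow>
    ('v, 'k) mpoly \<Rightarrow> ('v, 'k) mpoly \<Rightarrow> ('v, 'k) germ" where
  "frac I P a f = frac_rel I P `` {(a, f)}"

definition local_ring :: "('v::finite, 'k::field) mpoly set \<Rightarrow> ('v, 'k) mpoly set \<Rightarrow> ('v, 'k) germ ring" where
  "local_ring I P =
     \<lparr>carrier = fractions P // frac_rel I P,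
      mult = (\<lambda>x y. \<Union>(a, f)\<in>x. \<Union>(b, g)\<in>y. frac I P (a * b) (f * g)),
      one = frac I P 1 1,
      zero = frac I P 0 1,
      add = (\<lambda>x y. \<Union>(a, f)\<in>x. \<Union>(b, g)\<in>y. frac I P (a * g + b * f) (f * g))\<rparr>"

text \<open>Sections of the structure sheaf: families of germs that are locally given by one fraction.\<close>

definition sections :: "('v::finite, 'k::field) mpoly set \<Rightarrow> ('v, 'k) mpoly set set \<Rightarrow>
    (('v, 'k) mpoly set \<Rightarrow> ('v, 'k) germ) set" where
  "sections I U =
     {s \<in> (\<Pi>\<^sub>E P\<in>U. carrier (local_ring I P)).
        \<forall>P\<in>U. \<exists>V a f d. proj_open I V \<and> P \<in> V \<and> V \<subseteq> U \<and> homogeneous d a \<and> homogeneous d f \<and>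
          (\<forall>Q\<in>V. f \<notin> Q \<and> s Q = frac I Q a f)}"

definition section_ring :: "('v::finite, 'k::field) mpoly set \<Rightarrow> ('v, 'k) mpoly set set \<Rightarrow>
    (('v, 'k) mpoly set \<Rightarrow> ('v, 'k) germ) ring" where
  "section_ring I U =
     \<lparr>carrier = sections I U,
      mult = (\<lambda>s t. \<lambda>P\<in>U. s P \<otimes>\<^bsub>local_ring I P\<^esub> t P),
      one = (\<lambda>P\<in>U. \<one>\<^bsub>local_ring I P\<^esub>),
      zero = (\<lambda>P\<in>U. \<zero>\<^bsub>local_ring I P\<^esub>),
      add = (\<lambda>s t. \<lambda>P\<in>U. s P \<oplus>\<^bsub>local_ring I P\<^esub> t P)\<rparr>"

text \<open>Since \<open>F\<close> is the identity on points, \<open>F\<^sub>*\<O>\<close> has the same sections as \<open>\<O>\<close>, with \<open>r\<close> acting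
  as multiplication by \<open>r\<^sup>p\<close>. A splitting is an \<open>\<O>\<close>-linear sheaf map \<open>\<phi> : F\<^sub>*\<O> \<rightarrow> \<O>\<close> with
  \<open>\<phi> (s\<^sup>p) = s\<close>.\<close>

definition frobenius_split :: "('v::finite, 'k::field) mpoly set \<Rightarrow> bool" where
  "frobenius_split I \<longleftrightarrow>
     (\<exists>\<phi>. \<forall>U. proj_open I U \<longrightarrow>
        \<phi> U \<in> sections I U \<rightarrow> sections I U \<and>
        (\<forall>s\<in>sections I U. \<forall>t\<in>sections I U.
           \<phi> U (s \<oplus>\<^bsub>section_ring I U\<^esub> t) = \<phi> U s \<oplus>\<^bsub>section_ring I U\<^esub> \<phi> U t) \<and>
        (\<forall>r\<in>sections I U. \<forall>s\<in>sections I U.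
           \<phi> U ((r [^]\<^bsub>section_ring I U\<^esub> CHAR('k)) \<otimes>\<^bsub>section_ring I U\<^esub> s)
             = r \<otimes>\<^bsub>section_ring I U\<^esub> \<phi> U s) \<and>
        (\<forall>V. proj_open I V \<and> V \<subseteq> U \<longrightarrow>
           (\<forall>s\<in>sections I U. \<phi> V (restrict s V) = restrict (\<phi> U s) V)) \<and>
        (\<forall>s\<in>sections I U. \<phi> U (s [^]\<^bsub>section_ring I U\<^esub> CHAR('k)) = s))"

text \<open>The condition below is the integral equation of \<open>a / b\<close>, multiplied by \<open>b\<^sup>n\<close>.\<close>

definition integrally_closed_domain :: "('a, 'm) ring_scheme \<Rightarrow> bool" where
  "integrally_closed_domain R \<longleftrightarrow> domain R \<and>
     (\<forall>a\<in>carrier R. \<forall>b\<in>carrier R. \<forall>n::nat. \<forall>c\<in>{..<n} \<rightarrow> carrier R.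
        b \<noteq> \<zero>\<^bsub>R\<^esub> \<and>
        (a [^]\<^bsub>R\<^esub> n) \<oplus>\<^bsub>R\<^esub>
          (\<Oplus>\<^bsub>R\<^esub>i\<in>{..<n}. c i \<otimes>\<^bsub>R\<^esub> (a [^]\<^bsub>R\<^esub> i) \<otimes>\<^bsub>R\<^esub> (b [^]\<^bsub>R\<^esub> (n - i))) = \<zero>\<^bsub>R\<^esub>
        \<longrightarrow> (\<exists>q\<in>carrier R. a = q \<otimes>\<^bsub>R\<^esub> b))"

definition normal_scheme :: "('v::finite, 'k::field) mpoly set \<Rightarrow> bool" where
  "normal_scheme I \<longleftrightarrow> (\<forall>P\<in>proj_points I. integrally_closed_domain (local_ring I P))"

text \<open>The \<open>k\<close>-rational point with homogeneous coordinates \<open>a \<noteq> 0\<close>, as a homogeneous prime.\<close>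

definition rational_point :: "'k^'v \<Rightarrow> ('v::finite, 'k::field) mpoly set" where
  "rational_point a = Idl\<^bsub>poly_ring\<^esub> {Const (a $ i) * Var j - Const (a $ j) * Var i | i j. True}"

section \<open>Hypersurfaces\<close>

definition hypersurface :: "('v::finite, 'k::field) mpoly \<Rightarrow> ('v, 'k) mpoly set" where
  "hypersurface h = Idl\<^bsub>poly_ring\<^esub> {h}"

text \<open>Smoothness over the ground field: the Jacobian matrix of the (homogeneous) equation
  has rank one over the residue field at \<open>P\<close>.\<close>

definition smooth_at :: "('v::finite, 'k::field) mpoly \<Rightarrow> ('v, 'k) mpoly set \<Rightarrow> bool" where
  "smooth_at h P \<longleftrightarrow> (\<exists>i. partial_deriv i h \<notin> P)"

definition singular_locus :: "('v::finite, 'k::field) mpoly \<Rightarrow> ('v, 'k) mpoly set set" where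
  "singular_locus h = {P \<in> proj_points (hypersurface h). \<not> smooth_at h P}"

definition smooth_hypersurface :: "('v::finite, 'k::field) mpoly \<Rightarrow> bool" where
  "smooth_hypersurface h \<longleftrightarrow> (\<forall>P\<in>proj_points (hypersurface h). smooth_at h P)"

section \<open>The five cubic forms\<close>

text \<open>The four variables are indexed by the four-element type \<open>4\<close>, whose elements are
  \<open>1, 2, 3, 4\<close> (where \<open>4 = 0\<close>).\<close>

abbreviation x1 :: "(4, 'k::field) mpoly" where "x1 \<equiv> Var 1"
abbreviation x2 :: "(4, 'k::field) mpoly" where "x2 \<equiv> Var 2"
abbreviation x3 :: "(4, 'k::field) mpoly" where "x3 \<equiv> Var 3"
abbreviation x4 :: "(4, 'k::field) mpoly" where "x4 \<equiv> Var 4"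

definition cubic1 :: "(4, 'k::field) mpoly" where "cubic1 = x1^3 + x2^3 + x3^3 + x4^3"
definition cubic2 :: "(4, 'k::field) mpoly" where "cubic2 = x1^2 * x4 + x2^3 + x1 * x3^2"
definition cubic3 :: "(4, 'k::field) mpoly" where "cubic3 = x1^2 * x4 + x2^2 * x3 + x1 * x3^2"
definition cubic4 :: "(4, 'k::field) mpoly" where "cubic4 = x1^2 * x4 + x2^3 + x3^3"
definition cubic5 :: "(4, 'k::field) mpoly" where "cubic5 = x1^2 * x3 + x2^2 * x4"

end

theory Submission
  imports Defs
begin

text \<open>Fedder's criterion: if \<open>h\<close> contains a squarefree cubic monomial, then multiplying the trace
  \<open>F\<^sub>* S \<rightarrow> S\<close>, which extracts the coefficients of the monomials with all exponents odd, by \<open>h\<close> and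
  the missing variable splits the Frobenius of the surface. Otherwise \<open>h = \<Sum> L\<^sub>i x\<^sub>i\<^sup>2\<close> with linear forms
  \<open>L\<^sub>i\<close>. A splitting would then produce, near the generic point and after clearing denominators,
  linear forms from the products \<open>L\<^sub>i L\<^sub>j\<close>; they are symmetric in \<open>i, j\<close> and satisfy Koszul relations in
  each row, which forces the diagonal to vanish, although the splitting sends \<open>L\<^sub>i\<^sup>2\<close> to \<open>L\<^sub>i\<close>.

  The forms \<open>\<Sum> A\<^sub>i\<^sub>j x\<^sub>i\<^sup>2 x\<^sub>j\<close> are classified by the associated bilinear form twisted by Frobenius. If
  it is nondegenerate, Lang's theorem makes \<open>A\<close> the identity matrix, which is the smooth case. If it
  is degenerate, its left and right kernels meet trivially, and their relative position distinguishes
  the other four normal forms.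

  The normality of the three isolated singularities is proved by eliminating a variable that occurs
  linearly: the coordinate ring embeds into a localized polynomial ring, which is integrally closed,
  and the denominators are removed one step at a time.\<close>

text \<open>A sheaf splitting is only a family of maps on local sections, so the non-splitting
  argument has to recover global information by itself. This needs an integral surface, one reason
  for proving the five ideals prime: germs can then be compared at the generic point, and a section
  off the plane y1 = 0 has only powers of y1 in its denominator. A second linear form y2, forming a
  regular sequence with y1 modulo h, removes that denominator and leaves an honest linear form. Such
  y1 and y2 exist because a nonzero Frobenius form has an anisotropic vector, which makes the cubic
  monic in one of the coordinates.

  The exponent 4 in the semilinear algebra comes from using the form twice: an invertible Frobenius
  form \<beta> determines a map \<phi> with \<beta>(w, \<phi> v) = \<beta>(v, w)^2, and \<phi>
  raises scalars to the fourth power. Its fixed vectors are a structure over the field F_4 on which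
  \<beta> is Hermitian, and a nondegenerate Hermitian form over F_4 has an orthonormal
  basis.\<close>

abbreviation cf :: "('v, 'k::zero) mpoly \<Rightarrow> ('v \<Rightarrow>\<^sub>0 nat) \<Rightarrow> 'k" where
  "cf \<equiv> Poly_Mapping.lookup"

abbreviation mon :: "('v \<Rightarrow>\<^sub>0 nat) \<Rightarrow> 'k::zero \<Rightarrow> ('v, 'k) mpoly" where
  "mon \<equiv> Poly_Mapping.single"

lemma mpoly_sum_monos: "f = (\<Sum>m\<in>Poly_Mapping.keys f. mon m (cf f m))"
  for f :: "('v, 'k::comm_monoid_add) mpoly"
  by (rule poly_mapping_eqI) (auto simp: lookup_sum lookup_single when_def in_keys_iff)

lemma mpoly_induct_mono [case_names mon add]:
  fixes f :: "('v, 'k::comm_monoid_add) mpoly"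
  assumes "\<And>m c. P (mon m c)" "\<And>f g. P f \<Longrightarrow> P g \<Longrightarrow> P (f + g)"
  shows "P f"
proof -
  have "P (\<Sum>m\<in>A. mon m (cf f m))" if "finite A" for A
    using that
  proof induction
    case empty
    have "P (mon 0 0)" by (rule assms)
    then show ?case by simp
  qed (simp add: assms)
  then show ?thesis
    by (subst mpoly_sum_monos) simp
qed

lemma Const_simps [simp]: "Const 0 = 0" "Const 1 = 1"
  by (simp_all add: Const_def)

lemma Const_add: "Const (a + b) = Const a + Const b"
  by (simp add: Const_def single_add)

lemma Const_mult: "Const (a * b) = Const a * Const b"
  by (simp add: Const_def mult_single)

lemma Const_power: "Const (a ^ n) = Const a ^ n"
  by (induction n) (simp_all add: Const_mult)

lemma Const_sum: "Const (sum f A) = (\<Sum>i\<in>A. Const (f i))"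
  by (induction A rule: infinite_finite_induct) (simp_all add: Const_add)

lemma Const_inject [simp]: "Const a = Const b \<longleftrightarrow> a = b"
  by (metis Const_def lookup_single_eq)

lemma Const_eq_0 [simp]: "Const a = 0 \<longleftrightarrow> a = 0"
  by (metis Const_inject Const_simps(1))

lemma mono_power: "mon m c ^ n = mon (\<Sum>i<n. m) (c ^ n)"
  by (induction n) (simp_all add: mult_single add.commute)

lemma Var_power: "Var i ^ n = (mon (Poly_Mapping.single i n) 1 :: ('v, 'k::comm_semiring_1) mpoly)"
proof -
  have "(\<Sum>k<n. Poly_Mapping.single i (1::nat)) = Poly_Mapping.single i n"
    by (induction n) (simp_all flip: single_add)
  then show ?thesis
    by (simp add: Var_def mono_power)
qed

lemma prod_mono: "finite A \<Longrightarrow> (\<Prod>i\<in>A. mon (m i) 1) = (mon (\<Sum>i\<in>A. m i) 1 :: ('v, 'k::comm_semiring_1) mpoly)"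
  by (induction A rule: finite_induct) (simp_all add: mult_single)

lemma mono_conv: "mon m c = Const c * (\<Prod>i\<in>UNIV. Var i ^ Poly_Mapping.lookup m i)"
  for m :: "'v::finite \<Rightarrow>\<^sub>0 nat" and c :: "'k::comm_semiring_1"
proof -
  have "(\<Sum>i\<in>UNIV. Poly_Mapping.single i (Poly_Mapping.lookup m i)) = m"
    by (rule poly_mapping_eqI) (simp add: lookup_sum lookup_single when_def)
  then show ?thesis
    by (simp add: Var_power prod_mono Const_def mult_single)
qed

lemma mpoly_induct [case_names Const Var add mult]:
  fixes f :: "('v::finite, 'k::comm_semiring_1) mpoly"
  assumes C: "\<And>c. P (Const c)" and V: "\<And>i. P (Var i)"
    and A: "\<And>f g. P f \<Longrightarrow> P g \<Longrightarrow> P (f + g)" and M: "\<And>f g. P f \<Longrightarrow> P g \<Longrightarrow> P (f * g)"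
  shows "P f"
proof (induction f rule: mpoly_induct_mono)
  case (mon m c)
  have 1: "P 1" using C[of 1] by simp
  have 2: "P (Var i ^ n)" for i n by (induction n) (simp_all add: 1 V M)
  have "P (\<Prod>i\<in>B. Var i ^ Poly_Mapping.lookup m i)" if "finite B" for B
    using that by (induction rule: finite_induct) (simp_all add: 1 2 M)
  then show ?case unfolding mono_conv by (intro M C) simp
qed (rule A)

lemma lookup_mono_mult: "cf (mon t c * f) (t + m) = c * cf f m"
  for f :: "('v, 'k::comm_semiring_1) mpoly"
  by (induction f rule: mpoly_induct_mono)
    (auto simp: mult_single lookup_single when_def distrib_left lookup_add)

lemma lookup_mono_mult_eq_0: "(\<And>m'. m \<noteq> t + m') \<Longrightarrow> cf (mon t c * f) m = 0"
  for f :: "('v, 'k::comm_semiring_1) mpoly"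
  by (induction f rule: mpoly_induct_mono)
    (auto simp: mult_single lookup_single when_def distrib_left lookup_add)

lemma lookup_mult_eq: "cf (f * g) m = (\<Sum>a\<in>Poly_Mapping.keys f. \<Sum>b\<in>Poly_Mapping.keys g. (cf f a * cf g b when a + b = m))"
  for f :: "('v, 'k::comm_semiring_1) mpoly"
proof -
  have "f * g = (\<Sum>a\<in>Poly_Mapping.keys f. mon a (cf f a)) * (\<Sum>b\<in>Poly_Mapping.keys g. mon b (cf g b))"
    using mpoly_sum_monos by metis
  also have "\<dots> = (\<Sum>a\<in>Poly_Mapping.keys f. \<Sum>b\<in>Poly_Mapping.keys g. mon (a + b) (cf f a * cf g b))"
    by (simp add: sum_product mult_single)
  finally show ?thesis by (simp add: lookup_sum lookup_single)
qed

subsection \<open>Substitution\<close>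

context
  fixes \<sigma> :: "'v::finite \<Rightarrow> ('w, 'k::comm_semiring_1) mpoly"
begin

lemma subst_add: "subst \<sigma> (f + g) = subst \<sigma> f + subst \<sigma> g"
  unfolding subst_def
  by (rule setsum_keys_plus_distrib) (simp_all add: Const_add distrib_right)

lemma subst_mono: "subst \<sigma> (mon m c) = Const c * (\<Prod>i\<in>UNIV. \<sigma> i ^ Poly_Mapping.lookup m i)"
  by (cases "c = 0") (simp_all add: subst_def)

lemma subst_0 [simp]: "subst \<sigma> 0 = 0"
  by (simp add: subst_def)

lemma subst_Const [simp]: "subst \<sigma> (Const c) = Const c"
  using subst_mono[of 0 c] by (simp add: Const_def)

lemma subst_1 [simp]: "subst \<sigma> 1 = 1"
  using subst_Const[of 1] by simp

lemma subst_Var [simp]: "subst \<sigma> (Var i) = \<sigma> i"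
proof -
  have "(\<Prod>j\<in>UNIV. \<sigma> j ^ Poly_Mapping.lookup (Poly_Mapping.single i 1) j) = (\<Prod>j\<in>UNIV. if j = i then \<sigma> i else 1)"
    by (rule prod.cong) (auto simp: lookup_single when_def)
  then show ?thesis by (simp add: Var_def subst_mono)
qed

lemma subst_mult: "subst \<sigma> (f * g) = subst \<sigma> f * subst \<sigma> g"
proof (induction f rule: mpoly_induct_mono)
  case (mon m c)
  show ?case
  proof (induction g rule: mpoly_induct_mono)
    case (mon m' c')
    show ?case
      by (simp add: mult_single subst_mono lookup_add power_add prod.distrib Const_mult mult_ac)
  qed (simp add: distrib_left subst_add)
qed (simp add: distrib_right subst_add)

lemma subst_power: "subst \<sigma> (f ^ n) = subst \<sigma> f ^ n"
  by (induction n) (simp_all add: subst_mult)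

lemma subst_sum: "subst \<sigma> (sum f A) = (\<Sum>i\<in>A. subst \<sigma> (f i))"
  by (induction A rule: infinite_finite_induct) (simp_all add: subst_add)

end

lemma subst_uminus: "subst \<sigma> (- f) = - subst \<sigma> f" for \<sigma> :: "'v::finite \<Rightarrow> ('w, 'k::comm_ring_1) mpoly"
proof -
  have "subst \<sigma> (- f) + subst \<sigma> f = 0"
    by (simp flip: subst_add)
  then show ?thesis by (simp add: eq_neg_iff_add_eq_0)
qed

lemma subst_diff: "subst \<sigma> (f - g) = subst \<sigma> f - subst \<sigma> g" for \<sigma> :: "'v::finite \<Rightarrow> ('w, 'k::comm_ring_1) mpoly"
  using subst_add[of \<sigma> f "- g"] by (simp add: subst_uminus)

lemmas subst_simps = subst_add subst_mult subst_power subst_sum subst_diff subst_uminus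

lemma subst_subst: "subst \<tau> (subst \<sigma> f) = subst (\<lambda>i. subst \<tau> (\<sigma> i)) f"
  for \<tau> :: "'w::finite \<Rightarrow> ('x, 'k::comm_semiring_1) mpoly" and f :: "('v::finite, 'k) mpoly"
  by (induction f rule: mpoly_induct) (simp_all add: subst_simps)

lemma subst_Var_id [simp]: "subst Var f = f"
  by (induction f rule: mpoly_induct) (simp_all add: subst_simps)

subsection \<open>Homogeneous parts\<close>

lemma mdeg_simps [simp]: "mdeg (a + b) = mdeg a + mdeg b" "mdeg 0 = 0" "mdeg (Poly_Mapping.single i n) = n"
  by (simp_all add: mdeg_def lookup_add sum.distrib lookup_single when_def)

lemma mdeg_eq_0 [simp]: "mdeg m = 0 \<longleftrightarrow> m = 0"
  by (auto simp: mdeg_def poly_mapping_eq_iff fun_eq_iff)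

text \<open>Bounds the termination measure in \<open>almost_integral_dvd\<close>.\<close>

lemma finite_mdeg: "finite {m :: 'v::finite \<Rightarrow>\<^sub>0 nat. mdeg m = d}"
proof -
  have "Poly_Mapping.lookup ` {m :: 'v \<Rightarrow>\<^sub>0 nat. mdeg m = d} \<subseteq> (\<Pi>\<^sub>E i\<in>UNIV. {..d})"
    by (auto simp: mdeg_def PiE_iff intro: member_le_sum)
  then have "finite (Poly_Mapping.lookup ` {m :: 'v \<Rightarrow>\<^sub>0 nat. mdeg m = d})"
    by (rule finite_subset) (simp add: finite_PiE)
  then show ?thesis
    by (rule finite_imageD) (metis inj_onI poly_mapping_eqI)
qed

lemma homogeneousD: "homogeneous d f \<Longrightarrow> cf f m \<noteq> 0 \<Longrightarrow> mdeg m = d"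
  by (auto simp: homogeneous_def in_keys_iff)

lemma homogeneousI: "(\<And>m. cf f m \<noteq> 0 \<Longrightarrow> mdeg m = d) \<Longrightarrow> homogeneous d f"
  by (auto simp: homogeneous_def in_keys_iff)

lemma homogeneous_0 [simp]: "homogeneous d 0"
  by (simp add: homogeneous_def)

lemma homogeneous_mono: "c = 0 \<or> mdeg m = d \<Longrightarrow> homogeneous d (mon m c)"
  by (auto simp: homogeneous_def)

lemma homogeneous_Const [simp]: "homogeneous 0 (Const c)"
  by (simp add: Const_def homogeneous_mono)

lemma homogeneous_1 [simp]: "homogeneous 0 1"
  by (metis Const_simps(2) homogeneous_Const)

lemma homogeneous_Var [simp]: "homogeneous (Suc 0) (Var i)"
  by (simp add: Var_def homogeneous_mono)

lemma homogeneous_add: "homogeneous d f \<Longrightarrow> homogeneous d g \<Longrightarrow> homogeneous d (f + g)"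
  unfolding homogeneous_def using keys_add[of f g] by blast

lemma homogeneous_uminus: "homogeneous d f \<Longrightarrow> homogeneous d (- f)" for f :: "('v::finite,'k::ab_group_add) mpoly"
  by (rule homogeneousI) (auto dest: homogeneousD)

lemma homogeneous_diff: "homogeneous d f \<Longrightarrow> homogeneous d g \<Longrightarrow> homogeneous d (f - g)" for f :: "('v::finite,'k::ab_group_add) mpoly"
  by (metis add_uminus_conv_diff homogeneous_add homogeneous_uminus)

lemma homogeneous_mult: "homogeneous d f \<Longrightarrow> homogeneous e g \<Longrightarrow> homogeneous (d + e) (f * g)"
  for f g :: "('v::finite,'k::comm_semiring_1) mpoly"
proof (subst homogeneous_def, intro ballI)
  fix m assume *: "homogeneous d f" "homogeneous e g" and "m \<in> Poly_Mapping.keys (f * g)"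
  then obtain a b where "m = a + b" "a \<in> Poly_Mapping.keys f" "b \<in> Poly_Mapping.keys g"
    using keys_mult[of f g] by blast
  then show "mdeg m = d + e" using * by (auto simp: homogeneous_def)
qed

lemma homogeneous_sum: "(\<And>i. i \<in> A \<Longrightarrow> homogeneous d (f i)) \<Longrightarrow> homogeneous d (sum f A)"
  by (induction A rule: infinite_finite_induct) (simp_all add: homogeneous_add)

lemma homogeneous_power: "homogeneous d f \<Longrightarrow> homogeneous (n * d) (f ^ n)"
  for f :: "('v::finite,'k::comm_semiring_1) mpoly"
  by (induction n) (simp_all add: homogeneous_mult)

lemma homogeneous_Const_mult: "homogeneous d f \<Longrightarrow> homogeneous d (Const c * f)"
  for f :: "('v::finite,'k::comm_semiring_1) mpoly"
  using homogeneous_mult[OF homogeneous_Const] by simp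

lemma homogeneous_subst:
  fixes \<sigma> :: "'v::finite \<Rightarrow> ('w::finite, 'k::comm_semiring_1) mpoly"
  assumes "homogeneous d f" "\<And>i. homogeneous e (\<sigma> i)"
  shows "homogeneous (d * e) (subst \<sigma> f)"
proof -
  have *: "homogeneous ((\<Sum>i\<in>A. Poly_Mapping.lookup m i) * e) (\<Prod>i\<in>A. \<sigma> i ^ Poly_Mapping.lookup m i)"
    if "finite A" for A m
    using that
    by induction (simp_all add: distrib_right homogeneous_mult homogeneous_power assms)
  show ?thesis
    unfolding subst_def
    by (rule homogeneous_sum, rule homogeneous_Const_mult)
      (metis * assms(1) finite homogeneous_def mdeg_def)
qed

lemma lookup_hom_part: "cf (hom_part d f) m = (cf f m when mdeg m = d)"
  by (auto simp: hom_part_def lookup_sum lookup_single when_def in_keys_iff)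

lemma homogeneous_hom_part [simp]: "homogeneous d (hom_part d f)"
  by (rule homogeneousI) (auto simp: lookup_hom_part)

lemma hom_part_add: "hom_part d (f + g) = hom_part d f + hom_part d g"
  by (rule poly_mapping_eqI) (simp add: lookup_hom_part lookup_add when_def)

lemma hom_part_0 [simp]: "hom_part d 0 = 0"
  by (rule poly_mapping_eqI) (simp add: lookup_hom_part when_def)

lemma hom_part_sum: "hom_part d (sum f A) = (\<Sum>i\<in>A. hom_part d (f i))"
  by (induction A rule: infinite_finite_induct) (simp_all add: hom_part_add)

lemma hom_part_diff: "hom_part d (f - g) = hom_part d f - hom_part d g" for f :: "('v::finite,'k::ab_group_add) mpoly"
  by (rule poly_mapping_eqI) (simp add: lookup_hom_part lookup_minus when_def)

lemma hom_part_homogeneous: "homogeneous e f \<Longrightarrow> hom_part d f = (if d = e then f else 0)"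
  by (rule poly_mapping_eqI) (auto simp: lookup_hom_part when_def dest: homogeneousD)

text \<open>The bound is uniform so that the range of summation can be enlarged to contain a
  prescribed degree.\<close>

lemma mpoly_hom_parts: "\<exists>N. \<forall>n\<ge>N. f = (\<Sum>d<n. hom_part d f)"
proof -
  define N where "N = Suc (Max (mdeg ` Poly_Mapping.keys f))"
  have "f = (\<Sum>d<n. hom_part d f)" if "n \<ge> N" for n
  proof (rule poly_mapping_eqI)
    fix m
    have "mdeg m < N" if "cf f m \<noteq> 0"
      unfolding N_def using that by (intro le_imp_less_Suc Max_ge) (auto simp: in_keys_iff)
    then show "cf f m = cf (\<Sum>d<n. hom_part d f) m"
      using that by (cases "cf f m = 0") (auto simp: lookup_sum lookup_hom_part when_def intro: order.strict_trans2)
  qed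
  then show ?thesis by blast
qed

lemma hom_part_mult_homogeneous:
  fixes f g :: "('v::finite,'k::comm_semiring_1) mpoly"
  assumes "homogeneous e g"
  shows "hom_part d (f * g) = (if d < e then 0 else hom_part (d - e) f * g)"
proof (induction f rule: mpoly_induct_mono)
  case (mon m c)
  have *: "homogeneous (mdeg m + e) (mon m c * g)"
    by (intro homogeneous_mult assms homogeneous_mono) simp
  have "hom_part (d - e) (mon m c) = (if d - e = mdeg m then mon m c else 0)"
    by (intro hom_part_homogeneous homogeneous_mono) simp
  then show ?case
    using hom_part_homogeneous[OF *, of d] by auto
qed (simp add: distrib_right hom_part_add)

lemma hom_part_mult:
  fixes f g :: "('v::finite,'k::comm_semiring_1) mpoly"
  shows "hom_part n (f * g) = (\<Sum>i\<le>n. hom_part i f * hom_part (n - i) g)"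
proof (induction f rule: mpoly_induct_mono)
  case (mon m c)
  have h: "homogeneous (mdeg m) (mon m c)" by (simp add: homogeneous_mono)
  have "hom_part n (mon m c * g) = (if n < mdeg m then 0 else mon m c * hom_part (n - mdeg m) g)"
    using hom_part_mult_homogeneous[OF h, of n g] by (simp add: mult.commute)
  moreover have "hom_part i (mon m c) * hom_part (n - i) g = (if i = mdeg m then mon m c * hom_part (n - mdeg m) g else 0)" for i
    by (simp add: hom_part_homogeneous[OF h])
  ultimately show ?case by simp
qed (simp add: distrib_right hom_part_add sum.distrib)

lemma homogeneous_unique: "homogeneous d f \<Longrightarrow> homogeneous e f \<Longrightarrow> f \<noteq> 0 \<Longrightarrow> d = e"
proof -
  assume *: "homogeneous d f" "homogeneous e f" "f \<noteq> 0"
  then obtain m where "cf f m \<noteq> 0" by (metis lookup_zero poly_mapping_eqI)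
  then show ?thesis using * homogeneousD by metis
qed

subsection \<open>Ideals\<close>

lemma poly_ring_simps [simp]:
  "carrier poly_ring = UNIV" "x \<otimes>\<^bsub>poly_ring\<^esub> y = x * y" "x \<oplus>\<^bsub>poly_ring\<^esub> y = x + y"
  "\<zero>\<^bsub>poly_ring\<^esub> = 0" "\<one>\<^bsub>poly_ring\<^esub> = 1"
  by (simp_all add: ring_of_type_algebra_def)

lemma poly_ring_cring: "cring (poly_ring :: ('v, 'k::field) mpoly ring)"
  by (rule cring_from_type_algebra)

lemma ideal_poly_ring_iff:
  fixes I :: "('v, 'k::field) mpoly set"
  shows "ideal I poly_ring \<longleftrightarrow> 0 \<in> I \<and> (\<forall>f\<in>I. \<forall>g\<in>I. f + g \<in> I) \<and> (\<forall>f\<in>I. \<forall>g. g * f \<in> I)"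
proof
  assume "ideal I poly_ring"
  then interpret ideal I poly_ring .
  have "0 \<in> I" using additive_subgroup.zero_closed[OF additive_subgroup_axioms] by simp
  moreover have "f + g \<in> I" if "f \<in> I" "g \<in> I" for f g using additive_subgroup.a_closed[OF additive_subgroup_axioms that] by simp
  moreover have "g * f \<in> I" if "f \<in> I" for f g using I_l_closed[OF that, of g] by simp
  ultimately show "0 \<in> I \<and> (\<forall>f\<in>I. \<forall>g\<in>I. f + g \<in> I) \<and> (\<forall>f\<in>I. \<forall>g. g * f \<in> I)"
    by blast
next
  assume *: "0 \<in> I \<and> (\<forall>f\<in>I. \<forall>g\<in>I. f + g \<in> I) \<and> (\<forall>f\<in>I. \<forall>g. g * f \<in> I)"
  interpret R: cring "poly_ring :: ('v, 'k) mpoly ring" by (rule poly_ring_cring)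
  have neg: "\<ominus>\<^bsub>poly_ring\<^esub> f = - f" for f :: "('v, 'k) mpoly"
    by (rule R.minus_equality) simp_all
  have "- f \<in> I" if "f \<in> I" for f
    using *[THEN conjunct2, THEN conjunct2, rule_format, OF that, of "- 1"] by simp
  then have "additive_subgroup I poly_ring"
    using * by (intro additive_subgroupI R.add.subgroupI) (auto simp: neg)
  then show "ideal I poly_ring"
    using * by (intro ideal.intro ideal_axioms.intro R.ring_axioms) (auto simp: mult.commute)
qed

lemma ideal_0: "ideal I poly_ring \<Longrightarrow> 0 \<in> I"
  and ideal_add: "ideal I poly_ring \<Longrightarrow> f \<in> I \<Longrightarrow> g \<in> I \<Longrightarrow> f + g \<in> I"
  and ideal_mult: "ideal I poly_ring \<Longrightarrow> f \<in> I \<Longrightarrow> g * f \<in> I"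
  and ideal_mult': "ideal I poly_ring \<Longrightarrow> f \<in> I \<Longrightarrow> f * g \<in> I"
  for I :: "('v, 'k::field) mpoly set"
  by (auto simp: ideal_poly_ring_iff mult.commute[of _ g])

lemma ideal_uminus: "ideal I poly_ring \<Longrightarrow> f \<in> I \<Longrightarrow> - f \<in> I"
  for I :: "('v, 'k::field) mpoly set"
  using ideal_mult[of I f "- 1"] by simp

lemma ideal_diff: "ideal I poly_ring \<Longrightarrow> f \<in> I \<Longrightarrow> g \<in> I \<Longrightarrow> f - g \<in> I"
  for I :: "('v, 'k::field) mpoly set"
  using ideal_add[of I f "- g"] ideal_uminus by auto

lemma ideal_sum: "ideal I poly_ring \<Longrightarrow> (\<And>i. i \<in> A \<Longrightarrow> f i \<in> I) \<Longrightarrow> sum f A \<in> I"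
  for I :: "('v, 'k::field) mpoly set"
  by (induction A rule: infinite_finite_induct) (auto simp: ideal_0 ideal_add)

lemma primeideal_poly_ring_iff:
  fixes P :: "('v, 'k::field) mpoly set"
  shows "primeideal P poly_ring \<longleftrightarrow> ideal P poly_ring \<and> 1 \<notin> P \<and> (\<forall>f g. f * g \<in> P \<longrightarrow> f \<in> P \<or> g \<in> P)"
proof
  assume "primeideal P poly_ring"
  then interpret primeideal P poly_ring .
  show "ideal P poly_ring \<and> 1 \<notin> P \<and> (\<forall>f g. f * g \<in> P \<longrightarrow> f \<in> P \<or> g \<in> P)"
    using I_prime I_notcarr one_imp_carrier ideal_axioms by auto
next
  assume *: "ideal P poly_ring \<and> 1 \<notin> P \<and> (\<forall>f g. f * g \<in> P \<longrightarrow> f \<in> P \<or> g \<in> P)"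
  then show "primeideal P poly_ring"
    by (intro primeidealI poly_ring_cring) auto
qed

lemma prime_power: "primeideal P poly_ring \<Longrightarrow> f ^ n \<in> P \<Longrightarrow> f \<in> P"
  for P :: "('v, 'k::field) mpoly set"
  by (induction n) (auto simp: primeideal_poly_ring_iff)

lemma homogeneous_ideal_ideal: "homogeneous_ideal I \<Longrightarrow> ideal I poly_ring"
  and homogeneous_ideal_hom_part: "homogeneous_ideal I \<Longrightarrow> f \<in> I \<Longrightarrow> hom_part d f \<in> I"
  by (auto simp: homogeneous_ideal_def)

lemma hypersurface_eq: "hypersurface h = {e * h | e. True}" for h :: "('v::finite, 'k::field) mpoly"
proof -
  interpret R: cring "poly_ring :: ('v, 'k) mpoly ring" by (rule poly_ring_cring)
  have "hypersurface h = PIdl\<^bsub>poly_ring\<^esub> h"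
    unfolding hypersurface_def using R.cgenideal_eq_genideal by simp
  then show ?thesis by (simp add: cgenideal_def)
qed

lemma hypersurface_iff: "f \<in> hypersurface h \<longleftrightarrow> h dvd f" for h :: "('v::finite, 'k::field) mpoly"
  by (auto simp: hypersurface_eq dvd_def mult.commute)

lemma ideal_hypersurface: "ideal (hypersurface h) poly_ring" for h :: "('v::finite, 'k::field) mpoly"
  by (auto simp: ideal_poly_ring_iff hypersurface_iff)

lemma homogeneous_ideal_hypersurface:
  "homogeneous d h \<Longrightarrow> homogeneous_ideal (hypersurface h)" for h :: "('v::finite, 'k::field) mpoly"
  unfolding homogeneous_ideal_def
  by (intro conjI ideal_hypersurface ballI allI)
    (auto simp: hypersurface_iff hom_part_mult_homogeneous mult.commute[of h] elim!: dvdE intro!: dvd_triv_right)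

definition principal_plus :: "('v, 'k::field) mpoly set \<Rightarrow> ('v, 'k) mpoly \<Rightarrow> ('v, 'k) mpoly set" where
  "principal_plus I h = {a + e * h | a e. a \<in> I}"

lemma homogeneous_ideal_principal_plus:
  assumes I: "homogeneous_ideal I" and h: "homogeneous d h"
  shows "homogeneous_ideal (principal_plus I h)"
proof -
  note id = homogeneous_ideal_ideal[OF I]
  have "ideal (principal_plus I h) poly_ring"
    unfolding ideal_poly_ring_iff
  proof (intro conjI ballI allI)
    show "0 \<in> principal_plus I h"
      unfolding principal_plus_def using ideal_0[OF id] by (auto intro!: exI[of _ 0])
  next
    fix f g assume "f \<in> principal_plus I h" "g \<in> principal_plus I h"
    then obtain a e b e' where "f = a + e * h" "g = b + e' * h" "a \<in> I" "b \<in> I"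
      by (auto simp: principal_plus_def)
    then have "f + g = (a + b) + (e + e') * h" "a + b \<in> I"
      by (simp_all add: algebra_simps ideal_add[OF id])
    then show "f + g \<in> principal_plus I h" by (auto simp: principal_plus_def)
  next
    fix f g assume "f \<in> principal_plus I h"
    then obtain a e where "f = a + e * h" "a \<in> I"
      by (auto simp: principal_plus_def)
    then have "g * f = g * a + (g * e) * h" "g * a \<in> I"
      using ideal_mult[OF id, of a g] by (simp_all add: algebra_simps)
    then show "g * f \<in> principal_plus I h" by (auto simp: principal_plus_def)
  qed
  moreover have "hom_part n f \<in> principal_plus I h" if f: "f \<in> principal_plus I h" for f n
  proof -
    obtain a e where f: "f = a + e * h" "a \<in> I"
      using f by (auto simp: principal_plus_def)
    have "hom_part n f = hom_part n a + (if n < d then 0 else hom_part (n - d) e) * h"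
      by (simp add: f hom_part_add hom_part_mult_homogeneous[OF h])
    then show ?thesis
      using homogeneous_ideal_hom_part[OF I f(2)] unfolding principal_plus_def by blast
  qed
  ultimately show ?thesis by (auto simp: homogeneous_ideal_def)
qed

text \<open>If f and g lie outside I, take their lowest components outside I, of degrees d and e. In
  degree d + e of f * g every other product of components has a factor in I, so the product of these
  two lies in I.\<close>

lemma homogeneous_parts_prime:
  assumes I: "homogeneous_ideal I" and 1: "1 \<notin> I"
    and prime: "\<And>f g d e. homogeneous d f \<Longrightarrow> homogeneous e g \<Longrightarrow> f * g \<in> I \<Longrightarrow> f \<in> I \<or> g \<in> I"
  shows "primeideal I poly_ring"
proof -
  note id = homogeneous_ideal_ideal[OF I]
  have hp: "f \<in> I" if "\<And>d. hom_part d f \<in> I" for f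
    using mpoly_hom_parts[of f] ideal_sum[OF id, of _ "\<lambda>d. hom_part d f"] that by (metis order_refl)
  have "f \<in> I \<or> g \<in> I" if fg: "f * g \<in> I" for f g
  proof (rule ccontr)
    assume "\<not> (f \<in> I \<or> g \<in> I)"
    then have ex: "\<exists>d. hom_part d f \<notin> I" "\<exists>d. hom_part d g \<notin> I"
      using hp by auto
    define d e where "d = (LEAST d. hom_part d f \<notin> I)" and "e = (LEAST d. hom_part d g \<notin> I)"
    have d: "hom_part d f \<notin> I" "\<And>i. i < d \<Longrightarrow> hom_part i f \<in> I"
      unfolding d_def by (rule LeastI_ex[OF ex(1)]) (use not_less_Least in blast)
    have e: "hom_part e g \<notin> I" "\<And>i. i < e \<Longrightarrow> hom_part i g \<in> I"
      unfolding e_def by (rule LeastI_ex[OF ex(2)]) (use not_less_Least in blast)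
    let ?t = "\<lambda>i. hom_part i f * hom_part (d + e - i) g"
    have *: "hom_part (d + e) (f * g) - (\<Sum>i\<in>{..d + e} - {d}. ?t i) = ?t d"
      unfolding hom_part_mult by (subst sum.remove[of _ d]) auto
    have "(\<Sum>i\<in>{..d + e} - {d}. ?t i) \<in> I"
    proof (rule ideal_sum[OF id])
      fix i assume "i \<in> {..d + e} - {d}"
      then have "i < d \<or> d + e - i < e" by auto
      then show "?t i \<in> I"
        using d e ideal_mult[OF id] ideal_mult'[OF id] by blast
    qed
    from ideal_diff[OF id homogeneous_ideal_hom_part[OF I fg, of "d + e"] this]
    have "?t d \<in> I" unfolding * .
    then have "hom_part d f * hom_part e g \<in> I" by simp
    then show False
      using prime[OF homogeneous_hom_part homogeneous_hom_part] d(1) e(1) by blast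
  qed
  then show ?thesis
    using id 1 by (simp add: primeideal_poly_ring_iff)
qed

text \<open>Zorn's lemma gives an ideal P maximal among the homogeneous ideals over J without powers
  of y. Primality need only be tested on homogeneous f and g outside P; then P + (f) and P + (g) are
  homogeneous and larger, so each contains a power of y, and the product of these powers would lie
  in P if f * g did.\<close>

lemma homogeneous_prime_avoiding:
  assumes J: "homogeneous_ideal J" and y: "homogeneous d y" and avoid: "\<And>n. y ^ n \<notin> J"
  obtains P where "primeideal P poly_ring" "homogeneous_ideal P" "J \<subseteq> P" "y \<notin> P"
proof -
  define \<A> where "\<A> = {Q. homogeneous_ideal Q \<and> J \<subseteq> Q \<and> (\<forall>n. y ^ n \<notin> Q)}"
  have "\<exists>U\<in>\<A>. \<forall>V\<in>C. V \<subseteq> U" if C: "subset.chain \<A> C" for C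
  proof (cases "C = {}")
    case True
    then show ?thesis using J avoid by (auto simp: \<A>_def)
  next
    case False
    have sub: "C \<subseteq> \<A>" using C by (auto simp: subset.chain_def)
    have "ideal (\<Union>C) poly_ring"
      unfolding ideal_poly_ring_iff
    proof (intro conjI ballI allI)
      show "0 \<in> \<Union>C" using False sub ideal_0 unfolding \<A>_def homogeneous_ideal_def by blast
    next
      fix f g assume "f \<in> \<Union>C" "g \<in> \<Union>C"
      then obtain V W where VW: "V \<in> C" "f \<in> V" "W \<in> C" "g \<in> W" by auto
      then consider "V \<subseteq> W" | "W \<subseteq> V" using C by (metis subset_chain_def)
      then obtain Z where "Z \<in> C" "f \<in> Z" "g \<in> Z" using VW by cases blast+
      then show "f + g \<in> \<Union>C"
        using sub ideal_add unfolding \<A>_def homogeneous_ideal_def by blast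
    next
      fix f g assume "f \<in> \<Union>C"
      then show "g * f \<in> \<Union>C"
        using sub ideal_mult unfolding \<A>_def homogeneous_ideal_def by blast
    qed
    moreover have "hom_part d f \<in> \<Union>C" if "f \<in> \<Union>C" for f d
      using that sub by (auto simp: \<A>_def intro: homogeneous_ideal_hom_part)
    moreover have "J \<subseteq> \<Union>C" "\<And>n. y ^ n \<notin> \<Union>C"
      using sub False by (auto simp: \<A>_def)
    ultimately have "\<Union>C \<in> \<A>"
      unfolding \<A>_def homogeneous_ideal_def by blast
    then show ?thesis by auto
  qed
  then have "\<exists>M\<in>\<A>. \<forall>V\<in>\<A>. M \<subseteq> V \<longrightarrow> V = M"
    by (rule subset_Zorn)
  then obtain P where P: "P \<in> \<A>" "\<And>V. V \<in> \<A> \<Longrightarrow> P \<subseteq> V \<Longrightarrow> V = P"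
    by auto
  have hP: "homogeneous_ideal P" and JP: "J \<subseteq> P" and yP: "\<And>n. y ^ n \<notin> P"
    using P(1) by (auto simp: \<A>_def)
  note id = homogeneous_ideal_ideal[OF hP]
  have power: "\<exists>n. y ^ n \<in> principal_plus P f" if "homogeneous e f" "f \<notin> P" for e f
  proof (rule ccontr)
    assume n: "\<nexists>n. y ^ n \<in> principal_plus P f"
    have "a = a + 0 * f" for a by simp
    then have sub: "P \<subseteq> principal_plus P f"
      unfolding principal_plus_def by blast
    then have "principal_plus P f \<in> \<A>"
      using n JP homogeneous_ideal_principal_plus[OF hP that(1)] by (auto simp: \<A>_def)
    then have "principal_plus P f = P" using P(2) sub by blast
    moreover have "f \<in> principal_plus P f"
      unfolding principal_plus_def using ideal_0[OF id]
      by (metis (mono_tags, lifting) add_0 mem_Collect_eq mult_1)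
    ultimately show False using that by simp
  qed
  have "primeideal P poly_ring"
  proof (rule homogeneous_parts_prime[OF hP])
    show "1 \<notin> P" using yP[of 0] by simp
    fix f g e e' assume fg: "homogeneous e f" "homogeneous e' g" "f * g \<in> P"
    show "f \<in> P \<or> g \<in> P"
    proof (rule ccontr)
      assume *: "\<not> (f \<in> P \<or> g \<in> P)"
      obtain n where "y ^ n \<in> principal_plus P f"
        using power[OF fg(1)] * by blast
      moreover obtain m where "y ^ m \<in> principal_plus P g"
        using power[OF fg(2)] * by blast
      ultimately obtain a b u v where ab: "a \<in> P" "b \<in> P" "y ^ n = a + u * f" "y ^ m = b + v * g"
        by (auto simp: principal_plus_def)
      have "y ^ (n + m) = (b + v * g) * a + (u * f) * b + (u * v) * (f * g)"
        by (simp add: power_add ab algebra_simps)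
      also have "\<dots> \<in> P" by (intro ideal_add[OF id] ideal_mult[OF id] ab fg)
      finally show False using yP by simp
    qed
  qed
  then show ?thesis using that hP JP yP[of 1] by simp
qed

section \<open>The structure sheaf: germs and sections\<close>

subsection \<open>Local rings\<close>

lemma fractionsI: "f \<notin> P \<Longrightarrow> homogeneous d a \<Longrightarrow> homogeneous d f \<Longrightarrow> (a, f) \<in> fractions P"
  by (auto simp: fractions_def)

lemma fractionsE:
  assumes "(a, f) \<in> fractions P"
  obtains d where "f \<notin> P" "homogeneous d a" "homogeneous d f"
  using assms by (auto simp: fractions_def)

locale proj_point =
  fixes I P :: "('v::finite, 'k::field) mpoly set"
  assumes I: "ideal I poly_ring" and P: "primeideal P poly_ring"
begin

lemma P_ideal: "ideal P poly_ring" and P_1: "1 \<notin> P"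
  and P_mult: "f \<notin> P \<Longrightarrow> g \<notin> P \<Longrightarrow> f * g \<notin> P"
  using P by (auto simp: primeideal_poly_ring_iff)

lemma P_power: "f \<notin> P \<Longrightarrow> f ^ n \<notin> P"
  by (induction n) (simp_all add: P_1 P_mult)

lemma fractions_mult: "(a, f) \<in> fractions P \<Longrightarrow> (b, g) \<in> fractions P \<Longrightarrow> (a * b, f * g) \<in> fractions P"
proof (elim fractionsE)
  fix d e assume "f \<notin> P" "homogeneous d a" "homogeneous d f" "g \<notin> P" "homogeneous e b" "homogeneous e g"
  then show ?thesis
    by (intro fractionsI[where d="d + e"] homogeneous_mult P_mult)
qed

lemma fractions_add: "(a, f) \<in> fractions P \<Longrightarrow> (b, g) \<in> fractions P \<Longrightarrow> (a * g + b * f, f * g) \<in> fractions P"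
proof (elim fractionsE)
  fix d e assume *: "f \<notin> P" "homogeneous d a" "homogeneous d f" "g \<notin> P" "homogeneous e b" "homogeneous e g"
  moreover have "homogeneous (d + e) (b * f)" using homogeneous_mult[of e b d f] * by (simp add: add.commute)
  ultimately show ?thesis
    using * by (intro fractionsI[where d="d + e"] homogeneous_add) (simp_all add: homogeneous_mult P_mult)
qed

lemma fractions_uminus: "(a, f) \<in> fractions P \<Longrightarrow> (- a, f) \<in> fractions P"
  by (elim fractionsE, rule fractionsI) (auto intro: homogeneous_uminus)

lemma fractions_01: "(0, 1) \<in> fractions P" "(1, 1) \<in> fractions P"
  by (auto intro!: fractionsI[where d=0] P_1)

lemma frac_rel_iff:
  "((a, f), (b, g)) \<in> frac_rel I P \<longleftrightarrow> (a, f) \<in> fractions P \<and> (b, g) \<in> fractions P \<and>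
     (\<exists>s e. homogeneous e s \<and> s \<notin> P \<and> s * (a * g - b * f) \<in> I)"
  by (auto simp: frac_rel_def)

lemma equiv_frac_rel: "equiv (fractions P) (frac_rel I P)"
proof (rule equivI)
  show "frac_rel I P \<subseteq> fractions P \<times> fractions P" by (auto simp: frac_rel_def)
  show "refl_on (fractions P) (frac_rel I P)"
  proof (rule refl_onI)
    fix x assume "x \<in> fractions P"
    then show "(x, x) \<in> frac_rel I P"
      using P_1 ideal_0[OF I] by (cases x) (auto simp: frac_rel_iff intro!: exI[of _ 1] exI[of _ "0::nat"])
  qed
  show "sym (frac_rel I P)"
  proof (rule symI)
    fix x y assume xy: "(x, y) \<in> frac_rel I P"
    obtain a f b g where [simp]: "x = (a, f)" "y = (b, g)" by (cases x, cases y) auto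
    from xy obtain s e where *: "s \<notin> P" "homogeneous e s" "s * (a * g - b * f) \<in> I"
      by (auto simp: frac_rel_iff)
    have "s * (b * f - a * g) = - (s * (a * g - b * f))" by (simp add: algebra_simps)
    then have "s * (b * f - a * g) \<in> I" using ideal_uminus[OF I *(3)] by simp
    then show "(y, x) \<in> frac_rel I P"
      using * xy by (auto simp: frac_rel_iff)
  qed
  show "trans (frac_rel I P)"
  proof (rule transI)
    fix x y z assume xyz: "(x, y) \<in> frac_rel I P" "(y, z) \<in> frac_rel I P"
    obtain a f b g c k where [simp]: "x = (a, f)" "y = (b, g)" "z = (c, k)"
      by (cases x, cases y, cases z) auto
    from xyz obtain s e t e' where fr: "(b, g) \<in> fractions P"
      and s: "s \<notin> P" "homogeneous e s" "s * (a * g - b * f) \<in> I"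
      and t: "t \<notin> P" "homogeneous e' t" "t * (b * k - c * g) \<in> I"
      by (auto simp: frac_rel_iff)
    \<comment> \<open>The middle denominator g is absorbed into the witness, being homogeneous and
      outside P.\<close>
    have "s * t * g * (a * k - c * f) = (t * k) * (s * (a * g - b * f)) + (s * f) * (t * (b * k - c * g))"
      by (simp add: algebra_simps)
    also have "\<dots> \<in> I" by (intro ideal_add[OF I] ideal_mult[OF I] s t)
    finally have "s * t * g * (a * k - c * f) \<in> I" .
    moreover obtain d where "g \<notin> P" "homogeneous d g" using fr by (auto elim: fractionsE)
    then have "s * t * g \<notin> P" "homogeneous (e + e' + d) (s * t * g)"
      using s t by (simp_all add: homogeneous_mult P_mult)
    ultimately show "(x, z) \<in> frac_rel I P"
      using xyz by (auto simp: frac_rel_iff)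
  qed
qed

lemma frac_eq_iff:
  assumes "(a, f) \<in> fractions P" "(b, g) \<in> fractions P"
  shows "frac I P a f = frac I P b g \<longleftrightarrow> (\<exists>s e. homogeneous e s \<and> s \<notin> P \<and> s * (a * g - b * f) \<in> I)"
  unfolding frac_def eq_equiv_class_iff[OF equiv_frac_rel assms] using assms by (simp add: frac_rel_iff)

lemma frac_eqI:
  assumes "(a, f) \<in> fractions P" "(b, g) \<in> fractions P" "a * g - b * f \<in> I"
  shows "frac I P a f = frac I P b g"
  unfolding frac_eq_iff[OF assms(1,2)]
  by (rule exI[of _ 1]) (use assms P_1 in \<open>auto intro: exI[of _ 0]\<close>)

lemma frac_eqI':
  assumes "(a, f) \<in> fractions P" "(b, g) \<in> fractions P" "a * g = b * f"
  shows "frac I P a f = frac I P b g"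
  using assms ideal_0[OF I] by (intro frac_eqI) auto

lemma frac_self: "(a, f) \<in> fractions P \<Longrightarrow> (a, f) \<in> frac I P a f"
  unfolding frac_def by (rule equiv_class_self[OF equiv_frac_rel])

lemma frac_mem: "(b, g) \<in> frac I P a f \<Longrightarrow> (b, g) \<in> fractions P \<and> frac I P b g = frac I P a f"
  unfolding frac_def using equiv_class_eq[OF equiv_frac_rel, of "(a, f)" "(b, g)"]
  by (auto simp: frac_rel_iff)

lemma carrier_local_ring: "carrier (local_ring I P) = {frac I P a f | a f. (a, f) \<in> fractions P}"
  by (auto simp: local_ring_def quotient_def frac_def)

lemma local_ring_carrierE:
  assumes "x \<in> carrier (local_ring I P)"
  obtains a f where "(a, f) \<in> fractions P" "x = frac I P a f"
  using assms by (auto simp: carrier_local_ring)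

lemma frac_closed: "(a, f) \<in> fractions P \<Longrightarrow> frac I P a f \<in> carrier (local_ring I P)"
  by (auto simp: carrier_local_ring)

text \<open>The operations of \<open>local_ring\<close> are unions over all representatives; this
  collapses such a union once the summand is known to be independent of the representative.\<close>

lemma UN_frac:
  assumes "(a, f) \<in> fractions P"
    and "\<And>b g. (b, g) \<in> fractions P \<Longrightarrow> frac I P b g = frac I P a f \<Longrightarrow> F b g = F a f"
  shows "(\<Union>(b, g)\<in>frac I P a f. F b g) = F a f"
proof (rule UN_constant_eq[of "(a, f)"])
  show "(a, f) \<in> frac I P a f" using assms(1) by (rule frac_self)
  show "\<forall>y\<in>frac I P a f. (case y of (b, g) \<Rightarrow> F b g) = F a f"
  proof
    fix y assume "y \<in> frac I P a f"
    then have "(fst y, snd y) \<in> frac I P a f" by simp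
    from frac_mem[OF this] show "(case y of (b, g) \<Rightarrow> F b g) = F a f"
      using assms(2) by (simp add: case_prod_beta)
  qed
qed

lemma frac_mult_cong:
  assumes "(a, f) \<in> fractions P" "(b, g) \<in> fractions P" "(a', f') \<in> fractions P" "(b', g') \<in> fractions P"
    and "frac I P a f = frac I P a' f'" "frac I P b g = frac I P b' g'"
  shows "frac I P (a * b) (f * g) = frac I P (a' * b') (f' * g')"
proof -
  obtain s e t e' where s: "homogeneous e s" "s \<notin> P" "s * (a * f' - a' * f) \<in> I"
    and t: "homogeneous e' t" "t \<notin> P" "t * (b * g' - b' * g) \<in> I"
    using assms(5,6) unfolding frac_eq_iff[OF assms(1,3)] frac_eq_iff[OF assms(2,4)] by blast
  have "s * t * (a * b * (f' * g') - a' * b' * (f * g)) =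
      (t * b * g') * (s * (a * f' - a' * f)) + (s * a' * f) * (t * (b * g' - b' * g))"
    by (simp add: algebra_simps)
  also have "\<dots> \<in> I" by (intro ideal_add[OF I] ideal_mult[OF I] s t)
  finally show ?thesis
    using P_mult[OF s(2) t(2)] homogeneous_mult[OF s(1) t(1)]
    by (subst frac_eq_iff) (use assms in \<open>auto intro!: fractions_mult exI[of _ "s * t"]\<close>)
qed

lemma frac_add_cong:
  assumes "(a, f) \<in> fractions P" "(b, g) \<in> fractions P" "(a', f') \<in> fractions P" "(b', g') \<in> fractions P"
    and "frac I P a f = frac I P a' f'" "frac I P b g = frac I P b' g'"
  shows "frac I P (a * g + b * f) (f * g) = frac I P (a' * g' + b' * f') (f' * g')"
proof -
  obtain s e t e' where s: "homogeneous e s" "s \<notin> P" "s * (a * f' - a' * f) \<in> I"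
    and t: "homogeneous e' t" "t \<notin> P" "t * (b * g' - b' * g) \<in> I"
    using assms(5,6) unfolding frac_eq_iff[OF assms(1,3)] frac_eq_iff[OF assms(2,4)] by blast
  have "s * t * ((a * g + b * f) * (f' * g') - (a' * g' + b' * f') * (f * g)) =
      (t * g * g') * (s * (a * f' - a' * f)) + (s * f * f') * (t * (b * g' - b' * g))"
    by (simp add: algebra_simps)
  also have "\<dots> \<in> I" by (intro ideal_add[OF I] ideal_mult[OF I] s t)
  finally show ?thesis
    using P_mult[OF s(2) t(2)] homogeneous_mult[OF s(1) t(1)]
    by (subst frac_eq_iff) (use assms in \<open>auto intro!: fractions_add exI[of _ "s * t"]\<close>)
qed

lemma frac_mult [simp]:
  assumes "(a, f) \<in> fractions P" "(b, g) \<in> fractions P"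
  shows "frac I P a f \<otimes>\<^bsub>local_ring I P\<^esub> frac I P b g = frac I P (a * b) (f * g)"
proof -
  have inner: "(\<Union>(b', g')\<in>frac I P b g. frac I P (a' * b') (f' * g')) = frac I P (a' * b) (f' * g)"
    if "(a', f') \<in> fractions P" for a' f'
    by (rule UN_frac[OF assms(2)], rule frac_mult_cong) (use assms that in simp_all)
  have "(\<Union>(a', f')\<in>frac I P a f. \<Union>(b', g')\<in>frac I P b g. frac I P (a' * b') (f' * g')) =
      (\<Union>(b', g')\<in>frac I P b g. frac I P (a * b') (f * g'))"
  proof (rule UN_frac[OF assms(1)])
    fix a' f' assume *: "(a', f') \<in> fractions P" "frac I P a' f' = frac I P a f"
    show "(\<Union>(b', g')\<in>frac I P b g. frac I P (a' * b') (f' * g')) =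
        (\<Union>(b', g')\<in>frac I P b g. frac I P (a * b') (f * g'))"
      unfolding inner[OF *(1)] inner[OF assms(1)]
      by (rule frac_mult_cong) (use assms * in simp_all)
  qed
  also have "\<dots> = frac I P (a * b) (f * g)"
    by (rule inner[OF assms(1)])
  finally show ?thesis by (simp add: local_ring_def)
qed

lemma frac_add [simp]:
  assumes "(a, f) \<in> fractions P" "(b, g) \<in> fractions P"
  shows "frac I P a f \<oplus>\<^bsub>local_ring I P\<^esub> frac I P b g = frac I P (a * g + b * f) (f * g)"
proof -
  have inner: "(\<Union>(b', g')\<in>frac I P b g. frac I P (a' * g' + b' * f') (f' * g')) = frac I P (a' * g + b * f') (f' * g)"
    if "(a', f') \<in> fractions P" for a' f'
    by (rule UN_frac[OF assms(2)], rule frac_add_cong) (use assms that in simp_all)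
  have "(\<Union>(a', f')\<in>frac I P a f. \<Union>(b', g')\<in>frac I P b g. frac I P (a' * g' + b' * f') (f' * g')) =
      (\<Union>(b', g')\<in>frac I P b g. frac I P (a * g' + b' * f) (f * g'))"
  proof (rule UN_frac[OF assms(1)])
    fix a' f' assume *: "(a', f') \<in> fractions P" "frac I P a' f' = frac I P a f"
    show "(\<Union>(b', g')\<in>frac I P b g. frac I P (a' * g' + b' * f') (f' * g')) =
        (\<Union>(b', g')\<in>frac I P b g. frac I P (a * g' + b' * f) (f * g'))"
      unfolding inner[OF *(1)] inner[OF assms(1)]
      by (rule frac_add_cong) (use assms * in simp_all)
  qed
  also have "\<dots> = frac I P (a * g + b * f) (f * g)"
    by (rule inner[OF assms(1)])
  finally show ?thesis by (simp add: local_ring_def)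
qed

lemma local_ring_one [simp]: "\<one>\<^bsub>local_ring I P\<^esub> = frac I P 1 1"
  and local_ring_zero [simp]: "\<zero>\<^bsub>local_ring I P\<^esub> = frac I P 0 1"
  by (simp_all add: local_ring_def)

text \<open>Numerators of equal degree are required for the sum to be a fraction. A denominator
  outside P is nonzero, so its degree is unique and fixes that of both numerators.\<close>

lemma frac_add_same:
  assumes "(a, f) \<in> fractions P" "(b, f) \<in> fractions P"
  shows "frac I P a f \<oplus>\<^bsub>local_ring I P\<^esub> frac I P b f = frac I P (a + b) f"
proof -
  obtain d where d: "f \<notin> P" "homogeneous d a" "homogeneous d f" using assms by (auto elim: fractionsE)
  have ab: "(a + b, f) \<in> fractions P"
  proof (cases "f = 0")
    case True
    then show ?thesis using d ideal_0[OF P_ideal] by simp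
  next
    case False
    then have "homogeneous d b" using assms(2) d(3) by (metis fractionsE homogeneous_unique)
    then show ?thesis using d by (intro fractionsI[where d=d] homogeneous_add)
  qed
  show ?thesis using assms ab
    by (simp, intro frac_eqI') (simp_all add: fractions_add algebra_simps)
qed

lemma frac_pow: "(a, f) \<in> fractions P \<Longrightarrow>
    (a ^ n, f ^ n) \<in> fractions P \<and> frac I P a f [^]\<^bsub>local_ring I P\<^esub> n = frac I P (a ^ n) (f ^ n)" for n :: nat
  by (induction n) (simp_all add: nat_pow_def fractions_01 fractions_mult mult.commute)

lemmas fractions_intros = fractions_mult fractions_add fractions_01 fractions_uminus

lemma cring_local_ring: "cring (local_ring I P)"
proof (rule cringI)
  show "abelian_group (local_ring I P)"
  proof (rule abelian_groupI)
    fix x assume "x \<in> carrier (local_ring I P)"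
    then obtain a f where x: "(a, f) \<in> fractions P" "x = frac I P a f" by (rule local_ring_carrierE)
    have "frac I P (- a) f \<oplus>\<^bsub>local_ring I P\<^esub> x = \<zero>\<^bsub>local_ring I P\<^esub>"
      using x fractions_add[OF fractions_uminus[OF x(1)] x(1)]
      by (simp add: fractions_intros, intro frac_eqI') (simp_all add: fractions_intros)
    then show "\<exists>y\<in>carrier (local_ring I P). y \<oplus>\<^bsub>local_ring I P\<^esub> x = \<zero>\<^bsub>local_ring I P\<^esub>"
      using x by (intro bexI[of _ "frac I P (- a) f"]) (simp_all add: frac_closed fractions_uminus)
  qed ((elim local_ring_carrierE)?; simp add: fractions_intros frac_closed;
      (rule frac_eqI'; (intro fractions_intros; assumption)?; simp add: algebra_simps)?)+
  show "Group.comm_monoid (local_ring I P)"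
    by (rule comm_monoidI; (elim local_ring_carrierE)?; simp add: fractions_intros frac_closed;
      (rule frac_eqI'; (intro fractions_intros; assumption)?; simp add: algebra_simps)?)
qed (elim local_ring_carrierE; simp add: fractions_intros; rule frac_eqI'; (intro fractions_intros; assumption)?; simp add: algebra_simps)

end

subsection \<open>Sections\<close>

lemma proj_points_point: "ideal I poly_ring \<Longrightarrow> P \<in> proj_points I \<Longrightarrow> proj_point I P"
  by (simp add: proj_points_def proj_point_def)

definition basic_open :: "('v::finite, 'k::field) mpoly set \<Rightarrow> ('v, 'k) mpoly \<Rightarrow> ('v, 'k) mpoly set set" where
  "basic_open I f = {P \<in> proj_points I. f \<notin> P}"

lemma proj_open_basic_open: "homogeneous d f \<Longrightarrow> proj_open I (basic_open I f)"
  unfolding proj_open_def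
proof (intro exI conjI)
  assume "homogeneous d f"
  then show "homogeneous_ideal (hypersurface f)" by (rule homogeneous_ideal_hypersurface)
  have "hypersurface f \<subseteq> P \<longleftrightarrow> f \<in> P" if "P \<in> proj_points I" for P
    using that ideal_mult[of P f] by (auto simp: hypersurface_eq proj_points_def primeideal_poly_ring_iff intro: exI[of _ 1])
  then show "basic_open I f = proj_points I - zero_locus I (hypersurface f)"
    by (auto simp: basic_open_def zero_locus_def)
qed

lemma proj_open_subset: "proj_open I U \<Longrightarrow> U \<subseteq> proj_points I"
  by (auto simp: proj_open_def)

definition sec :: "('v::finite, 'k::field) mpoly set \<Rightarrow> ('v, 'k) mpoly set set \<Rightarrow>
    ('v, 'k) mpoly \<Rightarrow> ('v, 'k) mpoly \<Rightarrow> ('v, 'k) mpoly set \<Rightarrow> ('v, 'k) germ" where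
  "sec I U a f = (\<lambda>P\<in>U. frac I P a f)"

lemma sec_in_sections:
  assumes "ideal I poly_ring" "proj_open I U" "homogeneous d a" "homogeneous d f" "\<And>P. P \<in> U \<Longrightarrow> f \<notin> P"
  shows "sec I U a f \<in> sections I U"
  unfolding sections_def
proof (intro CollectI conjI ballI)
  show "sec I U a f \<in> (\<Pi>\<^sub>E P\<in>U. carrier (local_ring I P))"
    using assms proj_open_subset[OF assms(2)] unfolding sec_def
    by (auto intro!: proj_point.frac_closed proj_points_point fractionsI[of f _ d])
  fix P assume "P \<in> U"
  then show "\<exists>V a' f' d. proj_open I V \<and> P \<in> V \<and> V \<subseteq> U \<and> homogeneous d a' \<and> homogeneous d f' \<and>
      (\<forall>Q\<in>V. f' \<notin> Q \<and> sec I U a f Q = frac I Q a' f')"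
    using assms by (intro exI[of _ U] exI[of _ a] exI[of _ f] exI[of _ d]) (auto simp: sec_def)
qed

lemma sections_carrier: "s \<in> sections I U \<Longrightarrow> P \<in> U \<Longrightarrow> s P \<in> carrier (local_ring I P)"
  by (auto simp: sections_def)

lemma sections_extensional: "s \<in> sections I U \<Longrightarrow> s \<in> extensional U"
  by (auto simp: sections_def PiE_def)

lemma section_ring_simps:
  "carrier (section_ring I U) = sections I U"
  "P \<in> U \<Longrightarrow> (s \<otimes>\<^bsub>section_ring I U\<^esub> t) P = s P \<otimes>\<^bsub>local_ring I P\<^esub> t P"
  "P \<in> U \<Longrightarrow> (s \<oplus>\<^bsub>section_ring I U\<^esub> t) P = s P \<oplus>\<^bsub>local_ring I P\<^esub> t P"
  "P \<in> U \<Longrightarrow> \<one>\<^bsub>section_ring I U\<^esub> P = \<one>\<^bsub>local_ring I P\<^esub>"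
  by (simp_all add: section_ring_def)

lemma section_ring_ext: "s \<otimes>\<^bsub>section_ring I U\<^esub> t \<in> extensional U"
    "s \<oplus>\<^bsub>section_ring I U\<^esub> t \<in> extensional U"
  by (simp_all add: section_ring_def)

text \<open>Powers are computed germ by germ, so that only the ring laws of the local rings
  enter.\<close>

lemma section_square:
  assumes "ideal I poly_ring" "U \<subseteq> proj_points I" "s \<in> sections I U" "P \<in> U"
  shows "(s [^]\<^bsub>section_ring I U\<^esub> (2::nat)) P = s P \<otimes>\<^bsub>local_ring I P\<^esub> s P"
proof -
  interpret proj_point I P using assms by (auto intro: proj_points_point)
  interpret cring "local_ring I P" by (rule cring_local_ring)
  have "s P \<in> carrier (local_ring I P)" using assms sections_carrier by blast
  then show ?thesis
    using assms(4) by (simp add: nat_pow_def numeral_2_eq_2 section_ring_simps flip: local_ring_one)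
qed

lemma section_square_ext: "s [^]\<^bsub>section_ring I U\<^esub> (2::nat) \<in> extensional U"
  by (simp add: nat_pow_def numeral_2_eq_2 section_ring_ext)

section \<open>Frobenius splittings: both directions of Fedder's criterion\<close>

subsection \<open>Characteristic two\<close>

text \<open>Stated from 1 + 1 = 0 so that it serves coefficients and polynomials alike.\<close>

lemma char2_add_self:
  assumes "(1 + 1 :: 'a::comm_ring_1) = 0"
  shows "x + x = (0::'a)" "- x = (x::'a)" "(x + y)\<^sup>2 = x\<^sup>2 + (y::'a)\<^sup>2"
proof -
  have *: "x + x = 0" for x :: 'a
    using arg_cong[OF assms, of "\<lambda>t. t * x"] by (simp only: distrib_right mult_1_left mult_zero_left)
  show "x + x = 0" by (rule *)
  show "- x = x" using * by (simp add: neg_eq_iff_add_eq_0)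
  show "(x + y)\<^sup>2 = x\<^sup>2 + y\<^sup>2"
  proof -
    have "(x + y)\<^sup>2 = x\<^sup>2 + y\<^sup>2 + (x * y + x * y)"
      by (simp only: power2_eq_square distrib_left distrib_right ac_simps)
    then show ?thesis by (simp only: *) simp
  qed
qed

lemma char2_one: "CHAR('k::comm_ring_1) = 2 \<Longrightarrow> (1 + 1 :: 'k) = 0"
  by (metis of_nat_CHAR of_nat_numeral one_add_one)

lemma char2_one_mpoly: "CHAR('k::comm_ring_1) = 2 \<Longrightarrow> (1 + 1 :: ('v, 'k) mpoly) = 0"
  by (metis Const_add Const_simps char2_one)

lemmas char2 = char2_add_self[OF char2_one]
lemmas char2_mpoly = char2_add_self[OF char2_one_mpoly]

lemma char2_square_eq: "CHAR('k::field) = 2 \<Longrightarrow> x\<^sup>2 = y\<^sup>2 \<longleftrightarrow> x = (y::'k)"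
  using char2(2)[where 'a='k] by (auto simp: power2_eq_iff)

text \<open>Square roots are unique in characteristic two, so there this is the inverse of
  Frobenius, additive and multiplicative.\<close>

definition froot :: "'k::alg_closed_field \<Rightarrow> 'k" where
  "froot x = (SOME y. y\<^sup>2 = x)"

lemma froot_square: "(froot x)\<^sup>2 = x"
  unfolding froot_def using nth_root_exists[of 2 x] by (rule someI_ex) simp

context
  assumes char2: "CHAR('k::alg_closed_field) = 2"
begin

lemma froot_simps: "froot (x\<^sup>2 :: 'k) = x" "froot (0::'k) = 0" "froot (1::'k) = 1"
    "froot (x * y) = froot x * froot (y::'k)" "froot (x + y) = froot x + froot (y::'k)"
  by (simp_all add: char2_square_eq[OF char2, symmetric] froot_square power_mult_distrib char2_add_self[OF char2_one[OF char2]])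

end

subsection \<open>Frobenius splittings from graded maps\<close>

text \<open>A fraction a / f equals a * f / f^2, so it has to go to \<psi>(a * f) / f. Gradedness
  makes this a fraction of degree zero, stability of I makes it independent of the representative,
  and working germ by germ gives compatibility with restriction.\<close>

lemma frobenius_split_of_graded_map:
  fixes I :: "('v::finite, 'k::field) mpoly set"
  assumes char2: "CHAR('k) = 2" and I: "ideal I poly_ring"
    and add: "\<And>u v. \<psi> (u + v) = \<psi> u + \<psi> v" and lin: "\<And>r u. \<psi> (r\<^sup>2 * u) = r * \<psi> u"
    and one: "\<psi> 1 = 1" and stable: "\<And>u. u \<in> I \<Longrightarrow> \<psi> u \<in> I"
    and graded: "\<And>d u. homogeneous (2 * d) u \<Longrightarrow> homogeneous d (\<psi> u)"
  shows "frobenius_split I"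
proof -
  define \<Psi> where "\<Psi> P x = (\<Union>(a, f)\<in>x. frac I P (\<psi> (a * f)) f)" for P x
  have fr: "(\<psi> (a * f), f) \<in> fractions P" if af: "(a, f) \<in> fractions P" for a f P
  proof -
    obtain d where d: "f \<notin> P" "homogeneous d a" "homogeneous d f" using af by (rule fractionsE)
    have "homogeneous d (\<psi> (a * f))"
      using homogeneous_mult[OF d(2,3)] by (intro graded) (simp add: mult_2)
    then show ?thesis using d by (intro fractionsI)
  qed
  have lin': "\<psi> (u * r\<^sup>2) = r * \<psi> u" for r u using lin by (simp add: mult.commute)
  have diff: "\<psi> (u - v) = \<psi> u - \<psi> v" for u v using add[of "u - v" v] by simp
  have \<Psi>_frac: "\<Psi> P (frac I P a f) = frac I P (\<psi> (a * f)) f"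
    if P: "P \<in> proj_points I" and af: "(a, f) \<in> fractions P" for P a f
  proof -
    interpret proj_point I P using I P by (rule proj_points_point)
    show ?thesis unfolding \<Psi>_def
    proof (rule UN_frac[OF af])
      fix b g assume bg: "(b, g) \<in> fractions P" "frac I P b g = frac I P a f"
      then obtain s e where s: "homogeneous e s" "s \<notin> P" "s * (b * f - a * g) \<in> I"
        using frac_eq_iff[OF bg(1) af] by blast
      \<comment> \<open>The factors s * f and s * g enter \<psi> as squares; the difference of the
        arguments is then a multiple of the relation s * (b * f - a * g).\<close>
      have "s * (\<psi> (b * g) * f - \<psi> (a * f) * g) = \<psi> ((s * f)\<^sup>2 * (b * g)) - \<psi> ((s * g)\<^sup>2 * (a * f))"
        by (simp only: lin) (simp add: algebra_simps)
      also have "\<dots> = \<psi> (s * f * g * (s * (b * f - a * g)))"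
        by (simp flip: diff) (simp add: power2_eq_square algebra_simps)
      also have "\<dots> \<in> I" by (intro stable ideal_mult[OF I] s)
      finally show "frac I P (\<psi> (b * g)) g = frac I P (\<psi> (a * f)) f"
        using s by (subst frac_eq_iff) (use bg af fr in auto)
    qed
  qed
  define \<phi> where "\<phi> U s = (\<lambda>P\<in>U. \<Psi> P (s P))" for U s
  have \<Psi>_lin: "\<Psi> P ((x \<otimes>\<^bsub>local_ring I P\<^esub> x) \<otimes>\<^bsub>local_ring I P\<^esub> y) = x \<otimes>\<^bsub>local_ring I P\<^esub> \<Psi> P y"
    if Pp: "P \<in> proj_points I" and xy: "x \<in> carrier (local_ring I P)" "y \<in> carrier (local_ring I P)" for P x y
  proof -
    interpret proj_point I P using I Pp by (rule proj_points_point)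
    obtain a f b g where af: "(a, f) \<in> fractions P" "x = frac I P a f"
      and bg: "(b, g) \<in> fractions P" "y = frac I P b g"
      using xy by (elim local_ring_carrierE)
    have "\<psi> (a * a * b * (f * f * g)) = (a * f) * \<psi> (b * g)"
      using lin[of "a * f" "b * g"] by (simp add: power2_eq_square mult_ac)
    then have "frac I P (\<psi> (a * a * b * (f * f * g))) (f * f * g) = frac I P (a * \<psi> (b * g)) (f * g)"
      using af bg by (intro frac_eqI' fractions_mult fr) (simp_all add: mult_ac)
    then show ?thesis
      unfolding af bg using af bg
      by (simp only: frac_mult fractions_mult \<Psi>_frac[OF Pp] fr)
  qed
  have \<Psi>_add: "\<Psi> P (x \<oplus>\<^bsub>local_ring I P\<^esub> y) = \<Psi> P x \<oplus>\<^bsub>local_ring I P\<^esub> \<Psi> P y"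
    if Pp: "P \<in> proj_points I" and xy: "x \<in> carrier (local_ring I P)" "y \<in> carrier (local_ring I P)" for P x y
  proof -
    interpret proj_point I P using I Pp by (rule proj_points_point)
    obtain a f b g where af: "(a, f) \<in> fractions P" "x = frac I P a f"
      and bg: "(b, g) \<in> fractions P" "y = frac I P b g"
      using xy by (elim local_ring_carrierE)
    have "\<psi> ((a * g + b * f) * (f * g)) = \<psi> (g\<^sup>2 * (a * f)) + \<psi> (f\<^sup>2 * (b * g))"
      by (simp only: add[symmetric]) (simp add: power2_eq_square algebra_simps)
    then have "\<psi> ((a * g + b * f) * (f * g)) = \<psi> (a * f) * g + \<psi> (b * g) * f"
      by (simp only: lin) (simp only: mult.commute)
    then show ?thesis
      unfolding af bg using af bg
      by (simp only: frac_add fractions_add \<Psi>_frac[OF Pp] fr)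
  qed
  have \<Psi>_sq: "\<Psi> P (x \<otimes>\<^bsub>local_ring I P\<^esub> x) = x"
    if Pp: "P \<in> proj_points I" and x: "x \<in> carrier (local_ring I P)" for P x
  proof -
    interpret proj_point I P using I Pp by (rule proj_points_point)
    interpret cring "local_ring I P" by (rule cring_local_ring)
    have "\<Psi> P \<one>\<^bsub>local_ring I P\<^esub> = \<one>\<^bsub>local_ring I P\<^esub>"
      using \<Psi>_frac[OF Pp fractions_01(2)] one by simp
    then show ?thesis using \<Psi>_lin[OF Pp x one_closed] x by (simp del: local_ring_one)
  qed
  have closed: "\<phi> U s \<in> sections I U" if U: "proj_open I U" and s: "s \<in> sections I U" for U s
    unfolding sections_def
  proof (intro CollectI conjI ballI)
    have UP: "U \<subseteq> proj_points I" using U by (rule proj_open_subset)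
    show "\<phi> U s \<in> (\<Pi>\<^sub>E P\<in>U. carrier (local_ring I P))"
      unfolding \<phi>_def
    proof (rule restrict_PiE_iff[THEN iffD2], rule ballI)
      fix P assume "P \<in> U"
      then have Pp: "P \<in> proj_points I" and sP: "s P \<in> carrier (local_ring I P)"
        using UP s sections_carrier by auto
      interpret proj_point I P using I Pp by (rule proj_points_point)
      obtain a f where "(a, f) \<in> fractions P" "s P = frac I P a f"
        using sP by (rule local_ring_carrierE)
      then show "\<Psi> P (s P) \<in> carrier (local_ring I P)"
        using \<Psi>_frac[OF Pp] fr frac_closed by simp
    qed
    fix P assume P: "P \<in> U"
    then obtain V a f d where V: "proj_open I V" "P \<in> V" "V \<subseteq> U" "homogeneous d a" "homogeneous d f"
        "\<forall>Q\<in>V. f \<notin> Q \<and> s Q = frac I Q a f"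
      using s by (auto simp: sections_def)
    have "homogeneous d (\<psi> (a * f))"
      using homogeneous_mult[OF V(4,5)] by (intro graded) (simp add: mult_2)
    moreover have "\<phi> U s Q = frac I Q (\<psi> (a * f)) f" if "Q \<in> V" for Q
      using V that UP \<Psi>_frac[of Q a f] fractionsI[of f Q d a] by (auto simp: \<phi>_def)
    ultimately show "\<exists>V a' f' d. proj_open I V \<and> P \<in> V \<and> V \<subseteq> U \<and> homogeneous d a' \<and> homogeneous d f' \<and>
        (\<forall>Q\<in>V. f' \<notin> Q \<and> \<phi> U s Q = frac I Q a' f')"
      using V by blast
  qed
  have ext: "\<phi> U s \<in> extensional U" for U s by (simp add: \<phi>_def)
  show ?thesis
    unfolding frobenius_split_def char2
  proof (intro exI[of _ \<phi>] allI impI conjI ballI)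
    fix U assume U: "proj_open I U"
    then have UP: "U \<subseteq> proj_points I" by (rule proj_open_subset)
    show "\<phi> U \<in> sections I U \<rightarrow> sections I U" using closed[OF U] by blast
    note car = sections_carrier[where U=U and I=I]
    show "\<phi> U (s \<oplus>\<^bsub>section_ring I U\<^esub> t) = \<phi> U s \<oplus>\<^bsub>section_ring I U\<^esub> \<phi> U t"
      if "s \<in> sections I U" "t \<in> sections I U" for s t
      using UP that car
      by (intro extensionalityI[OF ext section_ring_ext(2)])
        (simp add: section_ring_simps \<phi>_def \<Psi>_add subset_iff)
    show "\<phi> U ((r [^]\<^bsub>section_ring I U\<^esub> (2::nat)) \<otimes>\<^bsub>section_ring I U\<^esub> s) = r \<otimes>\<^bsub>section_ring I U\<^esub> \<phi> U s"
      if "r \<in> sections I U" "s \<in> sections I U" for r s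
      using UP that car section_square[OF I UP that(1)]
      by (intro extensionalityI[OF ext section_ring_ext(1)])
        (simp add: section_ring_simps \<phi>_def \<Psi>_lin subset_iff)
    show "\<phi> V (restrict s V) = restrict (\<phi> U s) V"
      if "proj_open I V \<and> V \<subseteq> U" "s \<in> sections I U" for V s
      using that by (auto simp: \<phi>_def restrict_def fun_eq_iff)
    show "\<phi> U (s [^]\<^bsub>section_ring I U\<^esub> (2::nat)) = s" if s: "s \<in> sections I U" for s
      using UP s car section_square[OF I UP s]
      by (intro extensionalityI[OF ext sections_extensional[OF s]])
        (simp add: \<phi>_def \<Psi>_sq subset_iff)
  qed
qed

subsection \<open>Fedder's criterion: forms with a squarefree monomial\<close>

definition ones :: "'v::finite \<Rightarrow>\<^sub>0 nat" where
  "ones = (\<Sum>i\<in>UNIV. Poly_Mapping.single i 1)"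

lemma lookup_ones [simp]: "Poly_Mapping.lookup ones i = 1"
  by (simp add: ones_def lookup_sum lookup_single when_def)

lemma mdeg_ones: "mdeg (ones :: 'v::finite \<Rightarrow>\<^sub>0 nat) = CARD('v)"
  by (simp add: mdeg_def)

definition ftrace :: "('v::finite, 'k::alg_closed_field) mpoly \<Rightarrow> ('v, 'k) mpoly" where
  "ftrace f = Poly_Mapping.map froot (Poly_Mapping.map_key (\<lambda>m. m + m + ones) f)"

text \<open>\<open>map_key\<close> has its pointwise description only for an injective
  reindexing.\<close>

lemma inj_double: "inj (\<lambda>m. m + m + (t :: 'v \<Rightarrow>\<^sub>0 nat))"
proof (rule injI, rule poly_mapping_eqI)
  fix a b :: "'v \<Rightarrow>\<^sub>0 nat" and k assume eq: "a + a + t = b + b + t"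
  have "Poly_Mapping.lookup (a + a + t) k = Poly_Mapping.lookup (b + b + t) k" by (simp only: eq)
  then show "Poly_Mapping.lookup a k = Poly_Mapping.lookup b k" by (simp add: lookup_add)
qed

lemma froot_0: "froot 0 = 0"
  using froot_square[of 0] by simp

lemma lookup_ftrace: "cf (ftrace f) m = froot (cf f (m + m + ones))"
  unfolding ftrace_def
  by (simp add: map.rep_eq map_key.rep_eq[OF inj_double] when_def froot_0)

context
  assumes char2: "CHAR('k::alg_closed_field) = 2"
begin

lemma ftrace_add: "ftrace (f + g) = ftrace f + ftrace (g :: ('v::finite, 'k) mpoly)"
  by (rule poly_mapping_eqI) (simp add: lookup_ftrace lookup_add froot_simps[OF char2])

text \<open>Squaring is additive in characteristic two, so it suffices to treat a monomial
  r.\<close>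

lemma ftrace_square_mult: "ftrace (r\<^sup>2 * f) = r * ftrace (f :: ('v::finite, 'k) mpoly)"
proof (induction r rule: mpoly_induct_mono)
  case (mon m c)
  have *: "(mon m c)\<^sup>2 = mon (m + m) (c\<^sup>2)"
    by (simp add: power2_eq_square mult_single)
  show ?case
  proof (rule poly_mapping_eqI)
    fix n
    show "cf (ftrace ((mon m c)\<^sup>2 * f)) n = cf (mon m c * ftrace f) n"
    proof (cases "\<exists>n'. n = m + n'")
      case True
      then obtain n' where n: "n = m + n'" by blast
      have "cf (mon (m + m) (c\<^sup>2) * f) ((m + m) + (n' + n' + ones)) = c\<^sup>2 * cf f (n' + n' + ones)"
        by (rule lookup_mono_mult)
      moreover have "(m + m) + (n' + n' + ones) = n + n + ones"
        by (simp add: n ac_simps)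
      ultimately show ?thesis
        by (simp add: lookup_ftrace * n lookup_mono_mult froot_simps[OF char2])
    next
      case False
      \<comment> \<open>If x^m does not divide x^n, then x^(2m) does not divide the monomial of
        exponent 2n + \<open>ones\<close>: 2 m_i <= 2 n_i + 1 already forces m_i <= n_i.\<close>
      have "n + n + ones \<noteq> (m + m) + n'" for n'
      proof
        assume *: "n + n + ones = (m + m) + n'"
        have "Poly_Mapping.lookup m i \<le> Poly_Mapping.lookup n i" for i
          using arg_cong[OF *, of "\<lambda>q. Poly_Mapping.lookup q i"] by (simp add: lookup_add)
        then have "n = m + (n - m)"
          by (intro poly_mapping_eqI) (simp add: lookup_add lookup_minus)
        then show False using False by blast
      qed
      then show ?thesis
        using False by (simp add: lookup_ftrace * lookup_mono_mult_eq_0 froot_0)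
    qed
  qed
next
  case (add r s)
  then show ?case
    by (simp add: char2_mpoly[OF char2] distrib_right ftrace_add)
qed

lemma ftrace_homogeneous:
  assumes "homogeneous (2 * d + CARD('v)) f"
  shows "homogeneous d (ftrace (f :: ('v::finite, 'k) mpoly))"
proof (rule homogeneousI)
  fix m assume "cf (ftrace f) m \<noteq> 0"
  then have "cf f (m + m + ones) \<noteq> 0" by (auto simp: lookup_ftrace froot_0)
  from homogeneousD[OF assms this] show "mdeg m = d" by (simp add: mdeg_ones)
qed

text \<open>The generator \<open>u \<mapsto> ftrace (h * u)\<close> of \<open>Hom(F\<^sub>* S, S)\<close> preserves \<open>(h)\<close>. Multiplying by the
  variable missing from the squarefree monomial makes it degree preserving.\<close>

theorem frobenius_split_of_squarefree:
  fixes h :: "('v::finite, 'k) mpoly"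
  assumes h: "homogeneous d h" and card: "CARD('v) = Suc d"
    and m0: "cf h m0 \<noteq> 0" "\<And>i. Poly_Mapping.lookup m0 i \<le> 1"
  shows "frobenius_split (hypersurface h)"
proof -
  have "mdeg m0 = d" using h m0(1) by (rule homogeneousD)
  have ones: "ones = m0 + (ones - m0)"
    using m0(2) by (intro poly_mapping_eqI) (simp add: lookup_add lookup_minus)
  have "mdeg (ones - m0) = 1"
    using arg_cong[OF ones, of mdeg] card \<open>mdeg m0 = d\<close> by (simp add: mdeg_ones)
  define l where "l = ones - m0"
  have l: "ones = l + m0" "mdeg l = 1"
    using ones \<open>mdeg (ones - m0) = 1\<close> by (simp_all add: l_def add.commute)
  define x :: "('v, 'k) mpoly" where "x = mon l 1"
  define c where "c = froot (cf h m0)"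
  have c: "c \<noteq> 0" using m0(1) froot_square[of "cf h m0"] by (auto simp: c_def)
  have hx: "homogeneous (CARD('v)) (h * x)"
    using homogeneous_mult[OF h, of 1 x] l(2) card by (simp add: x_def homogeneous_mono)
  \<comment> \<open>The degree of h * x is that of \<open>ones\<close>, so the trace is a constant,
    read off at the exponent l + m0 = \<open>ones\<close>.\<close>
  have tr: "ftrace (h * x) = Const c"
  proof (rule poly_mapping_eqI)
    fix m
    have hom: "homogeneous 0 (ftrace (h * x))" using hx by (intro ftrace_homogeneous) simp
    show "cf (ftrace (h * x)) m = cf (Const c) m"
    proof (cases "m = 0")
      case True
      have "cf (mon l 1 * h) (l + m0) = cf h m0" using lookup_mono_mult[of l 1 h m0] by simp
      then show ?thesis
        using True by (simp add: lookup_ftrace c_def Const_def l(1) x_def mult.commute)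
    next
      case False
      then have "mdeg m \<noteq> 0" by simp
      then have "cf (ftrace (h * x)) m = 0" using homogeneousD[OF hom, of m] by auto
      then show ?thesis using False by (simp add: Const_def lookup_single when_def)
    qed
  qed
  define \<psi> where "\<psi> u = Const (inverse c) * ftrace (h * x * u)" for u
  show ?thesis
  proof (rule frobenius_split_of_graded_map[OF char2 ideal_hypersurface, of \<psi>])
    show "\<psi> (u + v) = \<psi> u + \<psi> v" for u v
      by (simp add: \<psi>_def distrib_left ftrace_add)
    show lin: "\<psi> (r\<^sup>2 * u) = r * \<psi> u" for r u
    proof -
      have "h * x * (r\<^sup>2 * u) = r\<^sup>2 * (h * x * u)" by (simp only: mult_ac)
      then show ?thesis by (simp only: \<psi>_def ftrace_square_mult) (simp only: mult_ac)
    qed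
    show "\<psi> 1 = 1"
      using c by (simp add: \<psi>_def tr flip: Const_mult)
    show "\<psi> u \<in> hypersurface h" if u: "u \<in> hypersurface h" for u
    proof -
      obtain e where u: "u = e * h" using u by (auto simp: hypersurface_eq)
      \<comment> \<open>A multiple of h becomes a multiple of h^2, and the trace takes one factor h
        out.\<close>
      have eq: "h * x * u = h\<^sup>2 * (x * e)" by (simp add: u power2_eq_square mult_ac)
      have "\<psi> u = h * (Const (inverse c) * ftrace (x * e))"
        unfolding \<psi>_def eq ftrace_square_mult by (rule mult.left_commute)
      then show ?thesis by (simp add: hypersurface_iff)
    qed
    show "homogeneous d (\<psi> u)" if "homogeneous (2 * d) u" for d u
      unfolding \<psi>_def
      using homogeneous_mult[OF that hx]
      by (intro homogeneous_Const_mult ftrace_homogeneous) (simp add: mult_ac)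
  qed
qed

end

subsection \<open>Sections near the generic point\<close>

text \<open>Consequently a prime avoiding some form of positive degree misses a variable, as
  \<open>proj_points\<close> demands.\<close>

lemma homogeneous_in_irrelevant:
  fixes P :: "('v::finite, 'k::field) mpoly set"
  assumes P: "ideal P poly_ring" and V: "\<And>i. Var i \<in> P" and f: "homogeneous (Suc d) f"
  shows "f \<in> P"
proof -
  have "mon m (cf f m) \<in> P" if "m \<in> Poly_Mapping.keys f" for m
  proof -
    have "mdeg m \<noteq> 0" using f that by (auto simp: homogeneous_def)
    then obtain i where i: "Poly_Mapping.lookup m i \<noteq> 0" by (auto simp: mdeg_def)
    then have "m = (m - Poly_Mapping.single i 1) + Poly_Mapping.single i 1"
      by (intro poly_mapping_eqI) (auto simp: lookup_add lookup_minus lookup_single when_def)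
    then have "mon m (cf f m) = mon (m - Poly_Mapping.single i 1) (cf f m) * Var i"
      by (simp add: Var_def mult_single)
    then show ?thesis using ideal_mult[OF P V] by simp
  qed
  then have "(\<Sum>m\<in>Poly_Mapping.keys f. mon m (cf f m)) \<in> P" by (intro ideal_sum[OF P])
  then show ?thesis using mpoly_sum_monos[of f] by simp
qed

text \<open>When I is prime it is itself a point, the generic one, lying in every nonempty open set.
  Cancelling factors outside I turns equality of germs there into a single congruence modulo
  I.\<close>

locale generic_point =
  fixes I :: "('v::finite, 'k::field) mpoly set"
  assumes I_prime: "primeideal I poly_ring" and I_hom: "homogeneous_ideal I"
    and I_proj: "I \<in> proj_points I"
begin

lemma I_ideal: "ideal I poly_ring" using I_hom by (rule homogeneous_ideal_ideal)

sublocale gen: proj_point I I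
  using I_ideal I_prime by (rule proj_point.intro)

lemma generic_eq:
  assumes "(a, f) \<in> fractions I" "(b, g) \<in> fractions I"
  shows "frac I I a f = frac I I b g \<longleftrightarrow> a * g - b * f \<in> I"
proof
  assume "frac I I a f = frac I I b g"
  then obtain s where "s \<notin> I" "s * (a * g - b * f) \<in> I"
    using gen.frac_eq_iff[OF assms] by blast
  then show "a * g - b * f \<in> I" using gen.P_mult by blast
qed (rule gen.frac_eqI[OF assms])

lemma generic_in_open:
  assumes "proj_open I V" "P \<in> V"
  shows "I \<in> V"
  using assms I_proj unfolding proj_open_def zero_locus_def proj_points_def by fast

text \<open>The denominators of the germ at I form a homogeneous ideal J. If J contained no power of
  y, some homogeneous prime P over J would avoid y and so be a point of the open set; the fraction
  representing the section near P would then put a denominator outside P into J.\<close>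

lemma generic_germ:
  assumes t: "t \<in> sections I (basic_open I y)" and y: "homogeneous (Suc 0) y" "y \<notin> I"
  obtains N a where "homogeneous N a" "t I = frac I I a (y ^ N)"
proof -
  have IU: "I \<in> basic_open I y" using I_proj y by (simp add: basic_open_def)
  obtain a0 f0 where af0: "(a0, f0) \<in> fractions I" "t I = frac I I a0 f0"
    using sections_carrier[OF t IU] by (rule gen.local_ring_carrierE)
  obtain d where d: "f0 \<notin> I" "homogeneous d a0" "homogeneous d f0"
    using af0(1) by (rule fractionsE)
  define J where "J = {f. \<exists>a. f * a0 - a * f0 \<in> I}"
  have hp: "hom_part (n + d) (f * a0 - a * f0) = hom_part n f * a0 - hom_part n a * f0" for n f a
    by (simp add: hom_part_diff hom_part_mult_homogeneous[OF d(2)] hom_part_mult_homogeneous[OF d(3)])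
  have "homogeneous_ideal J"
    unfolding homogeneous_ideal_def ideal_poly_ring_iff
  proof (intro conjI ballI allI)
    show "0 \<in> J" unfolding J_def by (auto intro!: exI[of _ 0] ideal_0[OF I_ideal])
  next
    fix f g assume "f \<in> J" "g \<in> J"
    then obtain a b where *: "f * a0 - a * f0 \<in> I" "g * a0 - b * f0 \<in> I" by (auto simp: J_def)
    have "(f + g) * a0 - (a + b) * f0 = (f * a0 - a * f0) + (g * a0 - b * f0)" by (simp add: algebra_simps)
    then show "f + g \<in> J" using ideal_add[OF I_ideal *] unfolding J_def by (intro CollectI exI[of _ "a + b"]) simp
  next
    fix f g assume "f \<in> J"
    then obtain a where *: "f * a0 - a * f0 \<in> I" by (auto simp: J_def)
    have "(g * f) * a0 - (g * a) * f0 = g * (f * a0 - a * f0)" by (simp add: algebra_simps)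
    then show "g * f \<in> J" using ideal_mult[OF I_ideal *] unfolding J_def by (intro CollectI exI[of _ "g * a"]) simp
  next
    fix f n assume "f \<in> J"
    then obtain a where *: "f * a0 - a * f0 \<in> I" by (auto simp: J_def)
    show "hom_part n f \<in> J"
      using homogeneous_ideal_hom_part[OF I_hom *, of "n + d"] unfolding hp J_def by blast
  qed
  moreover have "\<exists>N. y ^ N \<in> J"
  proof (rule ccontr)
    assume "\<nexists>N. y ^ N \<in> J"
    then obtain P where P: "primeideal P poly_ring" "homogeneous_ideal P" "J \<subseteq> P" "y \<notin> P"
      using homogeneous_prime_avoiding[OF \<open>homogeneous_ideal J\<close> y(1)] by blast
    have "I \<subseteq> J" unfolding J_def using ideal_mult'[OF I_ideal] by (auto intro: exI[of _ 0])
    moreover have "\<exists>i. Var i \<notin> P"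
      using homogeneous_in_irrelevant[OF homogeneous_ideal_ideal[OF P(2)] _ y(1)] P(4) by blast
    ultimately have "P \<in> basic_open I y"
      using P by (auto simp: basic_open_def proj_points_def)
    then obtain V a f e where V: "proj_open I V" "P \<in> V" "homogeneous e a" "homogeneous e f"
        "\<forall>Q\<in>V. f \<notin> Q \<and> t Q = frac I Q a f"
      using t unfolding sections_def by blast
    have "I \<in> V" using generic_in_open V by blast
    then have "f \<notin> I" "frac I I a f = frac I I a0 f0" using V(5) af0(2) by auto
    then have "a * f0 - a0 * f \<in> I" using generic_eq[of a f a0 f0] V af0 fractionsI by blast
    then have "f * a0 - a * f0 \<in> I" using ideal_uminus[OF I_ideal, of "a * f0 - a0 * f"] by (simp add: mult.commute)
    then have "f \<in> J" by (auto simp: J_def)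
    then show False using P V by blast
  qed
  then obtain N a where Na: "y ^ N * a0 - a * f0 \<in> I" by (auto simp: J_def)
  have yN: "homogeneous N (y ^ N)" using homogeneous_power[OF y(1), of N] by simp
  have "y ^ N * a0 - hom_part N a * f0 \<in> I"
    using homogeneous_ideal_hom_part[OF I_hom Na, of "N + d"] hom_part_homogeneous[OF yN, of N] unfolding hp by simp
  then have "a0 * y ^ N - hom_part N a * f0 \<in> I" by (simp add: mult.commute)
  moreover have "(hom_part N a, y ^ N) \<in> fractions I"
    using yN y gen.P_power by (intro fractionsI[of _ _ N]) auto
  ultimately have "t I = frac I I (hom_part N a) (y ^ N)"
    unfolding af0(2) using af0(1) by (simp add: generic_eq)
  then show ?thesis using that homogeneous_hom_part by blast
qed

end

subsection \<open>Fedder's criterion: forms without squarefree monomials\<close>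

lemma hypersurface_low_degree:
  fixes h :: "('v::finite, 'k::field) mpoly"
  assumes "homogeneous d h" "f \<in> hypersurface h" "homogeneous n f" "n < d"
  shows "f = 0"
proof -
  obtain e where "f = e * h" using assms(2) by (auto simp: hypersurface_eq)
  then have "hom_part n f = 0" using assms(1,4) by (simp add: hom_part_mult_homogeneous)
  then show ?thesis using assms(3) by (simp add: hom_part_homogeneous)
qed

lemma Var_neq_0 [simp]: "Var i \<noteq> (0 :: ('v, 'k::zero_neq_one) mpoly)"
  unfolding Var_def by (metis lookup_single_eq lookup_zero zero_neq_one)

lemma mdeg_1E:
  assumes "mdeg m = Suc 0"
  obtains i where "m = Poly_Mapping.single i 1"
proof -
  obtain i where i: "Poly_Mapping.lookup m i \<noteq> 0" using assms by (force simp: mdeg_def)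
  then have m: "m = (m - Poly_Mapping.single i 1) + Poly_Mapping.single i 1"
    by (intro poly_mapping_eqI) (auto simp: lookup_add lookup_minus lookup_single when_def)
  then have "mdeg (m - Poly_Mapping.single i 1) = 0"
    using assms by (metis add_cancel_left_left mdeg_simps(1,3) One_nat_def)
  then show ?thesis using m that by (metis add_0 mdeg_eq_0)
qed

lemma linear_form_eqI:
  assumes "homogeneous (Suc 0) f" "homogeneous (Suc 0) g"
    and "\<And>i. cf f (Poly_Mapping.single i 1) = cf g (Poly_Mapping.single i 1)"
  shows "f = g"
proof (rule poly_mapping_eqI)
  fix m
  show "cf f m = cf g m"
  proof (cases "mdeg m = Suc 0")
    case True
    then show ?thesis using assms(3) by (elim mdeg_1E) simp
  next
    case False
    then have "cf f m = 0" "cf g m = 0" using homogeneousD assms(1,2) by metis+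
    then show ?thesis by simp
  qed
qed

lemma lookup_Var_mult_linear:
  fixes f :: "('v, 'k::comm_semiring_1) mpoly"
  shows "cf (Var i * f) (Poly_Mapping.single p 1 + Poly_Mapping.single q 1) =
    (if i = p then cf f (Poly_Mapping.single q 1) else if i = q then cf f (Poly_Mapping.single p 1) else 0)"
proof -
  have "cf (mon (Poly_Mapping.single p 1) 1 * f) (Poly_Mapping.single p 1 + Poly_Mapping.single q 1) = cf f (Poly_Mapping.single q 1)" for p q
    using lookup_mono_mult[of _ 1 f] by simp
  from this[of p q] this[of q p] have
    "cf (Var p * f) (Poly_Mapping.single p 1 + Poly_Mapping.single q 1) = cf f (Poly_Mapping.single q 1)"
    "cf (Var q * f) (Poly_Mapping.single p 1 + Poly_Mapping.single q 1) = cf f (Poly_Mapping.single p 1)"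
    by (simp_all add: Var_def add.commute)
  moreover have "cf (Var i * f) (Poly_Mapping.single p 1 + Poly_Mapping.single q 1) = 0" if "i \<noteq> p" "i \<noteq> q"
    unfolding Var_def
  proof (rule lookup_mono_mult_eq_0)
    fix m'
    show "Poly_Mapping.single p (1::nat) + Poly_Mapping.single q 1 \<noteq> Poly_Mapping.single i 1 + m'"
    proof
      assume eq: "Poly_Mapping.single p (1::nat) + Poly_Mapping.single q 1 = Poly_Mapping.single i 1 + m'"
      have "Poly_Mapping.lookup (Poly_Mapping.single p (1::nat) + Poly_Mapping.single q 1) i = Poly_Mapping.lookup (Poly_Mapping.single i 1 + m') i"
        by (simp only: eq)
      then show False using that by (simp add: lookup_add lookup_single)
    qed
  qed
  ultimately show ?thesis by auto
qed

text \<open>A symmetric matrix \<open>b\<close> of linear forms whose rows are Koszul relations has zero diagonal: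
  the coefficients \<open>c\<^sub>i\<^sub>j\<^sub>k\<close> are symmetric in \<open>i, j\<close> and alternating in \<open>i, k\<close>.\<close>

lemma symmetric_koszul_diagonal:
  fixes b :: "'v::finite \<Rightarrow> 'v \<Rightarrow> ('v, 'k::field) mpoly"
  assumes lin: "\<And>i j. homogeneous (Suc 0) (b i j)" and sym: "\<And>i j. b i j = b j i"
    and rel: "\<And>j. (\<Sum>i\<in>UNIV. Var i * b i j) = 0"
  shows "b i i = 0"
proof -
  define c where "c i j k = cf (b i j) (Poly_Mapping.single k 1)" for i j k
  have csym: "c i j k = c j i k" for i j k using sym[of i j] by (simp add: c_def)
  have *: "(\<Sum>i\<in>UNIV. if i = p then c p j q else if i = q then c q j p else 0) = 0" for j p q
  proof -
    have "0 = cf (\<Sum>i\<in>UNIV. Var i * b i j) (Poly_Mapping.single p 1 + Poly_Mapping.single q 1)"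
      by (simp add: rel)
    also have "\<dots> = (\<Sum>i\<in>UNIV. if i = p then c p j q else if i = q then c q j p else 0)"
      unfolding lookup_sum lookup_Var_mult_linear by (rule sum.cong) (auto simp: c_def)
    finally show ?thesis by simp
  qed
  have alt: "c p j p = 0" for p j
    using *[of p j p] by (simp cong: if_cong)
  have anti: "c p j q + c q j p = 0" if "p \<noteq> q" for p q j
  proof -
    have "(\<Sum>i\<in>UNIV. if i = p then c p j q else if i = q then c q j p else 0) =
        (\<Sum>i\<in>{p, q}. if i = p then c p j q else if i = q then c q j p else 0)"
      by (rule sum.mono_neutral_right) auto
    then show ?thesis using *[of p j q] that by simp
  qed
  have "c i i k = 0" for k
  proof (cases "k = i")
    case False
    \<comment> \<open>c_iik = - c_kii = - c_iki = 0.\<close>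
    then show ?thesis using anti[of i k i] alt[of i k] csym[of k i i] by simp
  qed (simp add: alt)
  then show ?thesis
    by (intro linear_form_eqI[OF lin]) (simp_all add: c_def)
qed

text \<open>The assumption \<open>regular\<close> says that y2^M is a nonzerodivisor modulo h and
  y1^N. It stands in for computing the global sections of a twisting sheaf: a fraction that can be
  written with a power of y1 and also with a power of y2 as denominator is a polynomial modulo
  h.\<close>

theorem not_frobenius_split_of_no_squarefree:
  fixes h :: "('v::finite, 'k::field) mpoly"
  assumes char2: "CHAR('k) = 2" and h3: "homogeneous 3 h" and h0: "h \<noteq> 0"
    and hL: "h = (\<Sum>i\<in>UNIV. (Var i)\<^sup>2 * L i)" and L: "\<And>i. homogeneous (Suc 0) (L i)"
    and prime: "primeideal (hypersurface h) poly_ring"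
    and y: "homogeneous (Suc 0) y1" "homogeneous (Suc 0) y2" "y1 \<noteq> 0" "y2 \<noteq> 0"
    and regular: "\<And>N M a c. y1 ^ N * c - y2 ^ M * a \<in> hypersurface h \<Longrightarrow> \<exists>b. a - y1 ^ N * b \<in> hypersurface h"
  shows "\<not> frobenius_split (hypersurface h)"
proof
  define I where "I = hypersurface h"
  have Ihom: "homogeneous_ideal I" unfolding I_def by (rule homogeneous_ideal_hypersurface[OF h3])
  have low: "f = 0" if "f \<in> I" "homogeneous n f" "n < 3" for f n
    using hypersurface_low_degree[OF h3] that unfolding I_def by blast
  have yI: "y1 \<notin> I" "y2 \<notin> I" using low[of _ "Suc 0"] y by auto
  have "Var i \<notin> I" for i using low[OF _ homogeneous_Var, of i] by auto
  then interpret generic_point I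
    using prime Ihom by (intro generic_point.intro) (auto simp: I_def proj_points_def)
  assume "frobenius_split (hypersurface h)"
  then obtain \<phi> where \<phi>0: "\<forall>U. proj_open I U \<longrightarrow>
        \<phi> U \<in> sections I U \<rightarrow> sections I U \<and>
        (\<forall>s\<in>sections I U. \<forall>t\<in>sections I U.
           \<phi> U (s \<oplus>\<^bsub>section_ring I U\<^esub> t) = \<phi> U s \<oplus>\<^bsub>section_ring I U\<^esub> \<phi> U t) \<and>
        (\<forall>r\<in>sections I U. \<forall>s\<in>sections I U.
           \<phi> U ((r [^]\<^bsub>section_ring I U\<^esub> (2::nat)) \<otimes>\<^bsub>section_ring I U\<^esub> s)
             = r \<otimes>\<^bsub>section_ring I U\<^esub> \<phi> U s) \<and>
        (\<forall>V. proj_open I V \<and> V \<subseteq> U \<longrightarrow>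
           (\<forall>s\<in>sections I U. \<phi> V (restrict s V) = restrict (\<phi> U s) V)) \<and>
        (\<forall>s\<in>sections I U. \<phi> U (s [^]\<^bsub>section_ring I U\<^esub> (2::nat)) = s)"
    unfolding frobenius_split_def char2 I_def by (rule exE)
  note \<phi>c = \<phi>0[rule_format, THEN conjunct2]
  have \<phi>: "\<phi> U s \<in> sections I U" if "proj_open I U" "s \<in> sections I U" for U s
    using \<phi>0[rule_format, OF that(1), THEN conjunct1] that(2) by (rule funcset_mem)
  have \<phi>_add: "\<phi> U (s \<oplus>\<^bsub>section_ring I U\<^esub> t) = \<phi> U s \<oplus>\<^bsub>section_ring I U\<^esub> \<phi> U t"
    if "proj_open I U" "s \<in> sections I U" "t \<in> sections I U" for U s t
    using \<phi>c[OF that(1), THEN conjunct1] that(2,3) by simp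
  have \<phi>_lin: "\<phi> U ((r [^]\<^bsub>section_ring I U\<^esub> (2::nat)) \<otimes>\<^bsub>section_ring I U\<^esub> s) = r \<otimes>\<^bsub>section_ring I U\<^esub> \<phi> U s"
    if "proj_open I U" "r \<in> sections I U" "s \<in> sections I U" for U r s
    using \<phi>c[OF that(1), THEN conjunct2, THEN conjunct1] that(2,3) by simp
  have \<phi>_res: "\<phi> V (restrict s V) = restrict (\<phi> U s) V"
    if "proj_open I U" "proj_open I V" "V \<subseteq> U" "s \<in> sections I U" for U V s
    using \<phi>c[OF that(1), THEN conjunct2, THEN conjunct2, THEN conjunct1] that(2-4) by simp
  have \<phi>_sq: "\<phi> U (s [^]\<^bsub>section_ring I U\<^esub> (2::nat)) = s"
    if "proj_open I U" "s \<in> sections I U" for U s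
    using \<phi>c[OF that(1), THEN conjunct2, THEN conjunct2, THEN conjunct2] that(2) by simp
  define D where "D f = basic_open I f" for f
  have D_open: "proj_open I (D f)" if "homogeneous d f" for d f
    unfolding D_def using that by (rule proj_open_basic_open)
  have D_proj: "D f \<subseteq> proj_points I" for f by (auto simp: D_def basic_open_def)
  have D_mem: "P \<in> D f \<Longrightarrow> proj_point I P" "P \<in> D f \<Longrightarrow> f \<notin> P" for P f
    using I_ideal by (auto simp: D_def basic_open_def intro: proj_points_point)
  have D_notin: "f ^ n \<notin> P" if "P \<in> D f" for P f n
    using D_mem[OF that] proj_point.P_power by blast
  have I_D: "I \<in> D f" if "f \<notin> I" for f using that I_proj by (simp add: D_def basic_open_def)
  note hpow = homogeneous_power[where d="Suc 0", simplified]
  have sec: "sec I (D f) a (f ^ n) \<in> sections I (D f)" if "homogeneous n a" "homogeneous (Suc 0) f" for a f n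
    using that by (intro sec_in_sections[OF I_ideal D_open _ hpow[of f n]] D_notin) auto
  \<comment> \<open>The left-hand fraction is (r / f^n)^2 * (s / f^m), so the first factor leaves
    \<phi> as r / f^n.\<close>
  have lin_frac: "\<phi> (D f) (sec I (D f) (r\<^sup>2 * s) (f ^ (2 * n + m))) = sec I (D f) r (f ^ n) \<otimes>\<^bsub>section_ring I (D f)\<^esub> \<phi> (D f) (sec I (D f) s (f ^ m))"
    if f: "homogeneous (Suc 0) f" and r: "homogeneous n r" and s: "homogeneous m s" for f r s n m
  proof -
    have "sec I (D f) (r\<^sup>2 * s) (f ^ (2 * n + m)) =
      (sec I (D f) r (f ^ n) [^]\<^bsub>section_ring I (D f)\<^esub> (2::nat)) \<otimes>\<^bsub>section_ring I (D f)\<^esub> sec I (D f) s (f ^ m)"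
    proof (rule extensionalityI[OF _ section_ring_ext(1)])
      show "sec I (D f) (r\<^sup>2 * s) (f ^ (2 * n + m)) \<in> extensional (D f)" by (simp add: sec_def)
      fix P assume P: "P \<in> D f"
      interpret pp: proj_point I P using P by (rule D_mem)
      have pw: "f ^ (2 * n + m) = f ^ n * f ^ n * f ^ m" by (simp only: mult_2 power_add)
      have fr: "(r, f ^ n) \<in> fractions P" "(s, f ^ m) \<in> fractions P"
        using r s hpow[OF f] D_notin[OF P] by (auto intro!: fractionsI)
      show "sec I (D f) (r\<^sup>2 * s) (f ^ (2 * n + m)) P =
        ((sec I (D f) r (f ^ n) [^]\<^bsub>section_ring I (D f)\<^esub> (2::nat)) \<otimes>\<^bsub>section_ring I (D f)\<^esub> sec I (D f) s (f ^ m)) P"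
        using P fr pw
        by (simp add: section_ring_simps section_square[OF I_ideal D_proj sec[OF r f]])
          (simp add: sec_def pp.fractions_intros power2_eq_square)
    qed
    then show ?thesis
      using \<phi>_lin[OF D_open[OF f] sec[OF r f] sec[OF s f]] by simp
  qed
  have frI: "(a, f ^ n) \<in> fractions I" if "homogeneous n a" "homogeneous (Suc 0) f" "f \<notin> I" for a f n
    using that hpow gen.P_power by (auto intro!: fractionsI)
  have lin_gen: "\<phi> (D f) (sec I (D f) (r\<^sup>2 * s) (f ^ (2 * n + m))) I = frac I I (r * c) (f ^ (n + q))"
    if f: "homogeneous (Suc 0) f" "f \<notin> I" and r: "homogeneous n r" and s: "homogeneous m s"
      and c: "homogeneous q c" "\<phi> (D f) (sec I (D f) s (f ^ m)) I = frac I I c (f ^ q)" for f r s n m c q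
    unfolding lin_frac[OF f(1) r s]
    using I_D[OF f(2)] frI[OF r f] frI[OF c(1) f] by (simp add: section_ring_simps c(2)) (simp add: sec_def power_add)
  \<comment> \<open>Here the denominators disappear: on quadratic forms \<phi> acts like a map to
    linear forms. The fraction s is followed on both charts y1 and y2, and the results are compared
    on their intersection W.\<close>
  have lam: "\<exists>b. homogeneous (Suc 0) b \<and> \<phi> (D y1) (sec I (D y1) s (y1 ^ 2)) I = frac I I b (y1 ^ Suc 0)"
    if s: "homogeneous 2 s" for s
  proof -
    define t1 where "t1 = \<phi> (D y1) (sec I (D y1) s (y1 ^ 2))"
    define t2 where "t2 = \<phi> (D y2) (sec I (D y2) s (y2 ^ 2))"
    have t: "t1 \<in> sections I (D y1)" "t2 \<in> sections I (D y2)"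
      unfolding t1_def t2_def using \<phi>[OF D_open sec[OF s]] y by simp_all
    obtain N a1 where a1: "homogeneous N a1" "t1 I = frac I I a1 (y1 ^ N)"
      using generic_germ[OF t(1)[unfolded D_def] y(1) yI(1)] by blast
    obtain M a2 where a2: "homogeneous M a2" "t2 I = frac I I a2 (y2 ^ M)"
      using generic_germ[OF t(2)[unfolded D_def] y(2) yI(2)] by blast
    define W where "W = D (y1 * y2)"
    have y12: "homogeneous 2 (y1 * y2)" using homogeneous_mult[OF y(1,2)] by (simp add: numeral_2_eq_2)
    have W: "proj_open I W" unfolding W_def using D_open[OF y12] .
    have WP: "proj_point I P" "y1 \<notin> P" "y2 \<notin> P" "P \<in> D y1" "P \<in> D y2" if "P \<in> W" for P
    proof -
      show pp: "proj_point I P" using that unfolding W_def by (rule D_mem)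
      show "y1 \<notin> P" "y2 \<notin> P"
        using D_mem(2)[OF that[unfolded W_def]] ideal_mult[OF proj_point.P_ideal[OF pp]]
          ideal_mult'[OF proj_point.P_ideal[OF pp]] by auto
      then show "P \<in> D y1" "P \<in> D y2" using that by (auto simp: W_def D_def basic_open_def)
    qed
    then have Wsub: "W \<subseteq> D y1" "W \<subseteq> D y2" by auto
    have IW: "I \<in> W" unfolding W_def using yI gen.P_mult by (intro I_D)
    have secW: "sec I W y2 y1 \<in> sections I W" "restrict (sec I (D y2) s (y2 ^ 2)) W \<in> sections I W"
    proof -
      show "sec I W y2 y1 \<in> sections I W"
        using y WP by (intro sec_in_sections[OF I_ideal W]) auto
      have "restrict (sec I (D y2) s (y2 ^ 2)) W = sec I W s (y2 ^ 2)"
        using Wsub by (auto simp: sec_def restrict_def fun_eq_iff)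
      moreover have "sec I W s (y2 ^ 2) \<in> sections I W"
        using WP by (intro sec_in_sections[OF I_ideal W s hpow[OF y(2)]] proj_point.P_power)
      ultimately show "restrict (sec I (D y2) s (y2 ^ 2)) W \<in> sections I W" by simp
    qed
    \<comment> \<open>s / y1^2 = (y2 / y1)^2 * (s / y2^2), so the two images differ by the factor y2
      / y1.\<close>
    have "restrict (sec I (D y1) s (y1 ^ 2)) W =
      (sec I W y2 y1 [^]\<^bsub>section_ring I W\<^esub> (2::nat)) \<otimes>\<^bsub>section_ring I W\<^esub> restrict (sec I (D y2) s (y2 ^ 2)) W"
    proof (rule extensionalityI[OF restrict_extensional section_ring_ext(1)])
      fix P assume P: "P \<in> W"
      interpret pp: proj_point I P using P by (rule WP)
      have fr: "(s, y1 ^ 2) \<in> fractions P" "(s, y2 ^ 2) \<in> fractions P" "(y2, y1) \<in> fractions P"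
        using WP[OF P] pp.P_power s hpow[OF y(1), of 2] hpow[OF y(2), of 2] y by (auto intro!: fractionsI)
      have "frac I P s (y1 ^ 2) = frac I P (y2 * y2 * s) (y1 * y1 * y2 ^ 2)"
        using fr by (intro pp.frac_eqI' pp.fractions_mult) (simp_all add: power2_eq_square mult_ac)
      then show "restrict (sec I (D y1) s (y1 ^ 2)) W P =
        ((sec I W y2 y1 [^]\<^bsub>section_ring I W\<^esub> (2::nat)) \<otimes>\<^bsub>section_ring I W\<^esub> restrict (sec I (D y2) s (y2 ^ 2)) W) P"
        using P fr Wsub
        by (simp add: section_ring_simps section_square[OF I_ideal proj_open_subset[OF W] secW(1)])
          (simp add: sec_def pp.fractions_mult subset_iff)
    qed
    then have "restrict t1 W = sec I W y2 y1 \<otimes>\<^bsub>section_ring I W\<^esub> restrict t2 W"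
      using \<phi>_lin[OF W secW] \<phi>_res[OF D_open[OF y(1)] W Wsub(1) sec[OF s y(1)]]
        \<phi>_res[OF D_open[OF y(2)] W Wsub(2) sec[OF s y(2)]]
      unfolding t1_def t2_def by simp
    then have "restrict t1 W I = (sec I W y2 y1 \<otimes>\<^bsub>section_ring I W\<^esub> restrict t2 W) I" by simp
    then have "t1 I = frac I I y2 y1 \<otimes>\<^bsub>local_ring I I\<^esub> t2 I"
      using IW by (simp add: section_ring_simps) (simp add: sec_def)
    then have eq: "frac I I a1 (y1 ^ N) = frac I I (y2 * a2) (y1 * y2 ^ M)"
      using a1 a2 frI[OF y(2,1) yI(1), of] frI[OF a2(1) y(2) yI(2)] frI[of 1 y2 y1] y yI
      by (simp add: fractionsI)
    have fr1: "(y2 * a2, y1 * y2 ^ M) \<in> fractions I"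
      using frI[OF a2(1) y(2) yI(2)] fractionsI[OF yI(1) y(2,1)] by (intro gen.fractions_mult)
    have "a1 * (y1 * y2 ^ M) - (y2 * a2) * y1 ^ N \<in> I"
      using eq unfolding generic_eq[OF frI[OF a1(1) y(1) yI(1)] fr1] .
    then have "y1 ^ N * (y2 * a2) - y2 ^ M * (a1 * y1) \<in> I"
      using ideal_uminus[OF I_ideal, of "a1 * (y1 * y2 ^ M) - (y2 * a2) * y1 ^ N"] by (simp add: mult_ac)
    then obtain b where b: "a1 * y1 - y1 ^ N * b \<in> I"
      using regular unfolding I_def by blast
    \<comment> \<open>The congruence lives in degree N + 1, so b can be replaced by its linear
      part.\<close>
    have "hom_part (Suc N) (a1 * y1 - y1 ^ N * b) \<in> I"
      using homogeneous_ideal_hom_part[OF I_hom b] .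
    moreover have "hom_part (Suc N) (a1 * y1) = a1 * y1"
      using hom_part_homogeneous[OF homogeneous_mult[OF a1(1) y(1)], of "Suc N"] by simp
    moreover have "hom_part (Suc N) (y1 ^ N * b) = hom_part 1 b * y1 ^ N"
      using hom_part_mult_homogeneous[OF hpow[OF y(1), of N], of "Suc N" b] by (simp add: mult.commute)
    ultimately have "a1 * y1 ^ 1 - hom_part 1 b * y1 ^ N \<in> I" by (simp add: hom_part_diff)
    then have "t1 I = frac I I (hom_part 1 b) (y1 ^ 1)"
      unfolding a1(2) using generic_eq[OF frI[OF a1(1) y(1) yI(1)] frI[OF homogeneous_hom_part[of 1 b] y(1) yI(1)]] by blast
    then show ?thesis unfolding t1_def using homogeneous_hom_part[of "Suc 0" b] by (intro exI[of _ "hom_part 1 b"]) simp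
  qed
  have L2: "homogeneous 2 (L i * L j)" for i j using homogeneous_mult[OF L L] by (simp add: numeral_2_eq_2)
  \<comment> \<open>The choice depends only on the product L i * L j, which is what makes b
    symmetric.\<close>
  define b where "b i j = (SOME b. homogeneous (Suc 0) b \<and> \<phi> (D y1) (sec I (D y1) (L i * L j) (y1 ^ 2)) I = frac I I b (y1 ^ Suc 0))" for i j
  have b: "homogeneous (Suc 0) (b i j)" "\<phi> (D y1) (sec I (D y1) (L i * L j) (y1 ^ 2)) I = frac I I (b i j) (y1 ^ Suc 0)" for i j
    using someI_ex[OF lam[OF L2, of i j]] by (simp_all add: b_def)
  \<comment> \<open>The denominator y1^4 matches the degree four of L j * h, to which this is going
    to be applied.\<close>
  define \<Phi> where "\<Phi> u = \<phi> (D y1) (sec I (D y1) u (y1 ^ 4)) I" for u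
  have b_sym: "b i j = b j i" for i j by (simp add: b_def mult.commute)
  have \<Phi>_term: "\<Phi> ((Var i)\<^sup>2 * (L i * L j)) = frac I I (Var i * b i j) (y1 ^ 2)" for i j
    using lin_gen[OF y(1) yI(1) homogeneous_Var[of i] L2[of i j] b(1,2)[of i j]] by (simp add: \<Phi>_def numeral_eq_Suc)
  have hVL: "homogeneous 4 ((Var i)\<^sup>2 * (L i * L j))" for i j
    using homogeneous_mult[OF hpow[OF homogeneous_Var[of i], of 2] L2[of i j]] by simp
  have hVb: "homogeneous 2 (Var i * b i j)" for i j
    using homogeneous_mult[OF homogeneous_Var[of i] b(1)[of i j]] by (simp add: numeral_2_eq_2)
  have sec_cong: "sec I (D y1) u (y1 ^ n) = sec I (D y1) v (y1 ^ n)"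
    if "homogeneous n u" "homogeneous n v" "u - v \<in> I" for u v n
  proof -
    have "frac I P u (y1 ^ n) = frac I P v (y1 ^ n)" if P: "P \<in> D y1" for P
    proof -
      interpret pp: proj_point I P using P by (rule D_mem)
      have "u * y1 ^ n - v * y1 ^ n \<in> I"
        using ideal_mult'[OF I_ideal \<open>u - v \<in> I\<close>, of "y1 ^ n"] by (simp add: algebra_simps)
      then show ?thesis
        using \<open>homogeneous n u\<close> \<open>homogeneous n v\<close> hpow[OF y(1), of n] D_notin[OF P, of n]
        by (intro pp.frac_eqI) (auto intro: fractionsI)
    qed
    then show ?thesis by (simp add: sec_def cong: restrict_cong)
  qed
  have \<Phi>_add: "\<Phi> (u + v) = frac I I (c + d) (y1 ^ 2)"
    if u: "homogeneous 4 u" "\<Phi> u = frac I I c (y1 ^ 2)" "homogeneous 2 c"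
      and v: "homogeneous 4 v" "\<Phi> v = frac I I d (y1 ^ 2)" "homogeneous 2 d" for u v c d
  proof -
    have "sec I (D y1) (u + v) (y1 ^ 4) = sec I (D y1) u (y1 ^ 4) \<oplus>\<^bsub>section_ring I (D y1)\<^esub> sec I (D y1) v (y1 ^ 4)"
    proof (rule extensionalityI[OF _ section_ring_ext(2)])
      show "sec I (D y1) (u + v) (y1 ^ 4) \<in> extensional (D y1)" by (simp add: sec_def)
      fix P assume P: "P \<in> D y1"
      interpret pp: proj_point I P using P by (rule D_mem)
      have "(u, y1 ^ 4) \<in> fractions P" "(v, y1 ^ 4) \<in> fractions P"
        using u v hpow[OF y(1), of 4] D_notin[OF P, of 4] by (auto intro: fractionsI)
      then show "sec I (D y1) (u + v) (y1 ^ 4) P = (sec I (D y1) u (y1 ^ 4) \<oplus>\<^bsub>section_ring I (D y1)\<^esub> sec I (D y1) v (y1 ^ 4)) P"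
        using P by (simp add: section_ring_simps) (simp add: sec_def pp.frac_add_same del: pp.frac_add)
    qed
    then have "\<Phi> (u + v) = frac I I c (y1 ^ 2) \<oplus>\<^bsub>local_ring I I\<^esub> frac I I d (y1 ^ 2)"
      using \<phi>_add[OF D_open[OF y(1)] sec[OF u(1) y(1)] sec[OF v(1) y(1)]] u v I_D[OF yI(1)]
      by (simp add: \<Phi>_def section_ring_simps)
    then show ?thesis
      using frI[OF u(3) y(1) yI(1)] frI[OF v(3) y(1) yI(1)] by (simp add: gen.frac_add_same del: gen.frac_add)
  qed
  have \<Phi>_0: "\<Phi> 0 = frac I I 0 (y1 ^ 2)"
    using lin_gen[OF y(1) yI(1) homogeneous_0[of "Suc 0"] L2 b(1,2)] by (simp add: \<Phi>_def numeral_eq_Suc)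
  have "(\<Sum>i\<in>UNIV. Var i * b i j) = 0" for j
  proof -
    have *: "\<Phi> (\<Sum>i\<in>A. (Var i)\<^sup>2 * (L i * L j)) = frac I I (\<Sum>i\<in>A. Var i * b i j) (y1 ^ 2)" if "finite A" for A
      using that
    proof (induction rule: finite_induct)
      case empty
      then show ?case using \<Phi>_0 by simp
    next
      case (insert i A)
      then show ?case
        using \<Phi>_add[OF hVL \<Phi>_term hVb _ insert.IH] by (simp add: homogeneous_sum hVL hVb)
    qed
    \<comment> \<open>L j * h vanishes on the surface, so applying \<phi> termwise to its expansion
      gives the Koszul relation of row j modulo I; a quadratic form in I is zero.\<close>
    have hLj: "(\<Sum>i\<in>UNIV. (Var i)\<^sup>2 * (L i * L j)) = L j * h"
      unfolding hL by (simp add: sum_distrib_left mult_ac)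
    have "L j * h \<in> I" unfolding I_def by (simp add: hypersurface_iff)
    then have "\<Phi> (L j * h) = \<Phi> 0"
      unfolding \<Phi>_def using sec_cong[of 4 "L j * h" 0] homogeneous_mult[OF L[of j] h3] by simp
    then have eq: "frac I I (\<Sum>i\<in>UNIV. Var i * b i j) (y1 ^ 2) = frac I I 0 (y1 ^ 2)"
      using *[of UNIV] \<Phi>_0 hLj by simp
    have hs: "homogeneous 2 (\<Sum>i\<in>UNIV. Var i * b i j)" by (rule homogeneous_sum) (rule hVb)
    have "(\<Sum>i\<in>UNIV. Var i * b i j) * y1 ^ 2 \<in> I"
      using eq generic_eq[OF frI[OF hs y(1) yI(1)] frI[OF homogeneous_0 y(1) yI(1)]] by simp
    then have "(\<Sum>i\<in>UNIV. Var i * b i j) \<in> I" using gen.P_mult gen.P_power yI(1) by blast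
    then show ?thesis using low hs by simp
  qed
  then have b0: "b i i = 0" for i using symmetric_koszul_diagonal[of b, OF b(1) b_sym] by blast
  have "L i = 0" for i
  proof -
    \<comment> \<open>Linearity with r = L i and s = 1 evaluates \<phi> on the square as L i / y1,
      whereas the same germ is b i i / y1 = 0.\<close>
    have "\<phi> (D y1) (sec I (D y1) ((L i)\<^sup>2 * 1) (y1 ^ (2 * 1 + 0))) I = frac I I (L i * 1) (y1 ^ (1 + 0))"
    proof (rule lin_gen[OF y(1) yI(1) _ homogeneous_1 homogeneous_1])
      show "homogeneous 1 (L i)" using L by simp
      have s1: "sec I (D y1) 1 (y1 ^ 0) \<in> sections I (D y1)" by (rule sec[OF homogeneous_1 y(1)])
      have "sec I (D y1) 1 (y1 ^ 0) [^]\<^bsub>section_ring I (D y1)\<^esub> (2::nat) = sec I (D y1) 1 (y1 ^ 0)"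
      proof (rule extensionalityI[OF section_square_ext])
        show "sec I (D y1) 1 (y1 ^ 0) \<in> extensional (D y1)" by (simp add: sec_def)
        fix P assume P: "P \<in> D y1"
        interpret pp: proj_point I P using P by (rule D_mem)
        show "(sec I (D y1) 1 (y1 ^ 0) [^]\<^bsub>section_ring I (D y1)\<^esub> (2::nat)) P = sec I (D y1) 1 (y1 ^ 0) P"
          unfolding section_square[OF I_ideal D_proj s1 P] using P pp.fractions_01 by (simp add: sec_def)
      qed
      then have "\<phi> (D y1) (sec I (D y1) 1 (y1 ^ 0)) = sec I (D y1) 1 (y1 ^ 0)"
        using \<phi>_sq[OF D_open[OF y(1)] s1] by simp
      then show "\<phi> (D y1) (sec I (D y1) 1 (y1 ^ 0)) I = frac I I 1 (y1 ^ 0)"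
        using I_D[OF yI(1)] by (simp add: sec_def)
    qed
    then have "frac I I (L i) (y1 ^ 1) = frac I I 0 (y1 ^ 1)"
      using b(2)[of i i] b0[of i] by (simp add: power2_eq_square)
    then have "L i * y1 \<in> I"
      using generic_eq[of "L i" "y1 ^ 1" 0 "y1 ^ 1"] frI[of 1 "L i" y1] frI[of 1 0 y1] L y yI by simp
    then have "L i \<in> I" using gen.P_mult yI(1) by blast
    then show ?thesis using low[OF _ L] by simp
  qed
  then show False using h0 hL by simp
qed

section \<open>Semilinear algebra and the classification of Frobenius forms\<close>

subsection \<open>Fixed vectors of Frobenius-semilinear maps\<close>

lemma invertibleI_ker:
  fixes g :: "'k::field^'n^'n"
  assumes "\<And>x. g *v x = 0 \<Longrightarrow> x = 0"
  shows "invertible g"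
  using assms matrix_left_invertible_ker[of g] matrix_left_right_inverse[of _ g] unfolding invertible_def by blast

text \<open>The vectors form an indexed family; a repetition is treated apart, because the
  underlying set may then be independent.\<close>

lemma linear_dependence:
  fixes u :: "nat \<Rightarrow> 'k::field^'n"
  shows "\<exists>a. (\<exists>i\<le>CARD('n). a i \<noteq> 0) \<and> (\<Sum>i\<le>CARD('n). a i *s u i) = 0"
proof (cases "inj_on u {..CARD('n)}")
  case True
  let ?S = "u ` {..CARD('n)}"
  have "vec.dependent ?S"
  proof (rule vec.dependent_biggerset_general)
    have "vec.dim ?S \<le> vec.dim (UNIV :: ('k^'n) set)" by (rule vec.dim_subset) simp
    also have "\<dots> = CARD('n)" by (rule vec_dim_card)
    finally show "vec.dim ?S < card ?S" by (simp add: card_image[OF True])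
  qed
  then obtain c where c: "\<exists>v\<in>?S. c v \<noteq> 0" "(\<Sum>v\<in>?S. c v *s v) = 0"
    by (subst (asm) vec.dependent_finite) auto
  then show ?thesis
    by (intro exI[of _ "c \<circ> u"]) (auto simp: sum.reindex[OF True])
next
  case False
  then obtain i j where ij: "i \<le> CARD('n)" "j \<le> CARD('n)" "i \<noteq> j" "u i = u j"
    by (auto simp: inj_on_def)
  define a :: "nat \<Rightarrow> 'k" where "a k = (if k = i then 1 else if k = j then - 1 else 0)" for k
  have "(\<Sum>k\<le>CARD('n). a k *s u k) = (\<Sum>k\<in>{i, j}. a k *s u k)"
    using ij by (intro sum.mono_neutral_right) (auto simp: a_def)
  also have "\<dots> = 0" using ij by (simp add: a_def)
  finally show ?thesis using ij by (intro exI[of _ a]) (auto simp: a_def)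
qed

text \<open>Solves \<open>c\<^sub>0 = - \<mu> a\<^sub>0\<close>, \<open>c\<^sub>i\<^sub>+\<^sub>1 = c\<^sub>i\<^sup>4 - \<mu> a\<^sub>i\<^sub>+\<^sub>1\<close>, \<open>c\<^sub>m = 0\<close> with \<open>\<mu> \<noteq> 0\<close>; the polynomials
  \<open>r\<^sub>i\<close> are \<open>c\<^sub>i / \<mu>\<close>.\<close>

lemma recursion_root:
  fixes a :: "nat \<Rightarrow> 'k::alg_closed_field"
  assumes m: "m > 0" and a: "a 0 \<noteq> 0" "a m \<noteq> 0"
  shows "\<exists>\<mu> c. \<mu> \<noteq> 0 \<and> c 0 = - \<mu> * a 0 \<and> (\<forall>i. c (Suc i) = c i ^ 4 - \<mu> * a (Suc i)) \<and> c m = 0"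
proof -
  \<comment> \<open>With c_i = \<mu> r_i(\<mu>) one has c_i^4 = \<mu> * \<mu>^3 r_i(\<mu>)^4; hence
    the factor X^3.\<close>
  define r :: "nat \<Rightarrow> 'k poly" where "r = rec_nat [:- a 0:] (\<lambda>i p. [:0, 1:] ^ 3 * p ^ 4 - [:a (Suc i):])"
  have r0: "r 0 = [:- a 0:]" and rS: "r (Suc i) = [:0, 1:] ^ 3 * r i ^ 4 - [:a (Suc i):]" for i
    by (simp_all add: r_def)
  have deg: "degree (r (Suc i)) > 0" if "r i \<noteq> 0" for i
  proof -
    have "degree ([:0, 1:] ^ 3 * r i ^ 4) = 3 + degree (r i ^ 4)"
      using that by (subst degree_mult_eq) (auto simp: degree_power_eq)
    moreover from this have "degree ([:0, 1:] ^ 3 * r i ^ 4 + [:- a (Suc i):]) = degree ([:0, 1:] ^ 3 * r i ^ 4)"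
      by (intro degree_add_eq_left) simp
    moreover have "r (Suc i) = [:0, 1:] ^ 3 * r i ^ 4 + [:- a (Suc i):]" by (simp add: rS)
    ultimately show ?thesis by simp
  qed
  have "r i \<noteq> 0" for i
  proof (induction i)
    case (Suc i)
    then show ?case using deg[of i] by auto
  qed (use a in \<open>simp add: r0\<close>)
  then have "degree (r m) > 0" using deg[of "m - 1"] m by simp
  then obtain \<mu> where root: "poly (r m) \<mu> = 0" using alg_closed_imp_poly_has_root by blast
  \<comment> \<open>The constant term of r_m is nonzero, so the root \<mu> is nonzero.\<close>
  have "poly (r m) 0 = - a m" using m by (cases m) (simp_all add: rS)
  then have "\<mu> \<noteq> 0" using root a by auto
  moreover define c where "c i = \<mu> * poly (r i) \<mu>" for i
  ultimately show ?thesis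
    using root by (intro exI[of _ \<mu>] exI[of _ c]) (simp_all add: c_def r0 rS algebra_simps power_mult_distrib eval_nat_numeral)
qed

lemma artin_schreier: "\<exists>t. t ^ 4 - t = (c :: 'k::alg_closed_field)"
proof -
  have "degree [:- c, - 1, 0, 0, 1:] > 0" by simp
  then obtain t where "poly [:- c, - 1, 0, 0, 1:] t = 0" using alg_closed_imp_poly_has_root by blast
  then show ?thesis by (intro exI[of _ t]) (simp add: algebra_simps eval_nat_numeral)
qed

text \<open>Suppose v lies outside the span F of the fixed vectors, and take a shortest relation
  modulo F between the iterates of v. From it one builds a combination u of fewer iterates with
  \<phi> u - u in F. As \<phi> - 1 reaches all of F from F, u differs from a fixed vector by an
  element of F; so u lies in F, which is a shorter relation.\<close>

theorem fixed_vectors_span: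
  fixes \<phi> :: "'k::alg_closed_field^'n \<Rightarrow> 'k^'n"
  assumes add: "\<And>v w. \<phi> (v + w) = \<phi> v + \<phi> w" and scale: "\<And>c v. \<phi> (c *s v) = c ^ 4 *s \<phi> v"
    and ker: "\<And>v. \<phi> v = 0 \<Longrightarrow> v = 0"
  shows "vec.span {v. \<phi> v = v} = UNIV"
proof (rule ccontr)
  define F where "F = vec.span {v. \<phi> v = v}"
  assume "vec.span {v. \<phi> v = v} \<noteq> UNIV"
  then obtain v where v: "v \<notin> F" by (auto simp: F_def)
  have F_sub: "vec.subspace F" unfolding F_def by (rule vec.subspace_span)
  note F_add = vec.subspace_add[OF F_sub] and F_scale = vec.subspace_scale[OF F_sub]
    and F_diff = vec.subspace_diff[OF F_sub] and F_0 = vec.subspace_0[OF F_sub]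
  have \<phi>0: "\<phi> 0 = 0" using scale[of 0 0] by simp
  have diff: "\<phi> (v - w) = \<phi> v - \<phi> w" for v w using add[of "v - w" w] by simp
  have \<phi>_sum: "\<phi> (\<Sum>i\<in>A. f i) = (\<Sum>i\<in>A. \<phi> (f i))" for f :: "nat \<Rightarrow> 'k^'n" and A
    by (induction A rule: infinite_finite_induct) (simp_all add: \<phi>0 add)
  have surj: "\<exists>x\<in>F. \<phi> x = y" if "y \<in> F" for y
    using that unfolding F_def
  proof (induction rule: vec.span_induct_alt)
    case base
    show ?case using F_0 \<phi>0 unfolding F_def by blast
  next
    case (step c x y)
    obtain d where d: "d ^ 4 = c" using nth_root_exists[of 4 c] by auto
    from step obtain z where z: "z \<in> F" "\<phi> z = y" by (auto simp: F_def)
    have "d *s x + z \<in> F" using step(1) z by (intro F_add F_scale) (auto simp: F_def intro: vec.span_base)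
    then show ?case using step(1) z d by (auto simp: add scale F_def intro!: bexI[of _ "d *s x + z"])
  qed
  have F_inv: "x \<in> F" if "\<phi> x \<in> F" for x
  proof -
    obtain x' where x': "x' \<in> F" "\<phi> x' = \<phi> x" using surj \<open>\<phi> x \<in> F\<close> by blast
    then have "x' - x = 0" using ker[of "x' - x"] by (simp add: diff)
    then show ?thesis using x' by simp
  qed
  have solve: "\<exists>x\<in>F. \<phi> x - x = y" if "y \<in> F" for y
    using that unfolding F_def
  proof (induction rule: vec.span_induct_alt)
    case base
    show ?case using F_0 \<phi>0 unfolding F_def by (intro bexI[of _ 0]) auto
  next
    case (step c x y)
    obtain t where t: "t ^ 4 - t = c" using artin_schreier by blast
    from step obtain z where z: "z \<in> F" "\<phi> z - z = y" by (auto simp: F_def)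
    have "t *s x + z \<in> F" using step(1) z by (intro F_add F_scale) (auto simp: F_def intro: vec.span_base)
    moreover have "\<phi> (t *s x + z) - (t *s x + z) = c *s x + y"
    proof -
      have "\<phi> (t *s x + z) - (t *s x + z) = (t ^ 4 *s x - t *s x) + (\<phi> z - z)"
        using step(1) by (simp add: add scale)
      also have "t ^ 4 *s x - t *s x = c *s x"
        unfolding t[symmetric] by (rule vec.scale_left_diff_distrib[symmetric])
      finally show ?thesis by (simp add: z)
    qed
    ultimately show ?case unfolding F_def by blast
  qed
  define rel where "rel m a \<longleftrightarrow> a m \<noteq> 0 \<and> (\<Sum>i\<le>m. a i *s (\<phi> ^^ i) v) \<in> F" for m and a :: "nat \<Rightarrow> 'k"
  have "\<exists>m a. rel m a"
  proof -
    obtain a where a: "\<exists>i\<le>CARD('n). a i \<noteq> 0" "(\<Sum>i\<le>CARD('n). a i *s (\<phi> ^^ i) v) = 0"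
      using linear_dependence[of "\<lambda>i. (\<phi> ^^ i) v"] by blast
    define m where "m = Max {i. i \<le> CARD('n) \<and> a i \<noteq> 0}"
    have m: "m \<le> CARD('n)" "a m \<noteq> 0" "\<And>i. i \<le> CARD('n) \<Longrightarrow> a i \<noteq> 0 \<Longrightarrow> i \<le> m"
    proof -
      let ?M = "{i. i \<le> CARD('n) \<and> a i \<noteq> 0}"
      have fin: "finite ?M" by simp
      have "m \<in> ?M" unfolding m_def using a(1) by (intro Max_in) auto
      then show "m \<le> CARD('n)" "a m \<noteq> 0" by auto
      show "i \<le> m" if "i \<le> CARD('n)" "a i \<noteq> 0" for i
        unfolding m_def using that by (intro Max_ge fin) simp
    qed
    have "(\<Sum>i\<le>m. a i *s (\<phi> ^^ i) v) = (\<Sum>i\<le>CARD('n). a i *s (\<phi> ^^ i) v)"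
    proof (rule sum.mono_neutral_left)
      show "\<forall>i\<in>{..CARD('n)} - {..m}. a i *s (\<phi> ^^ i) v = 0"
        using m(3) by (auto simp: vec.scale_eq_0_iff)
    qed (use m in auto)
    then have "rel m a" using a m F_0 by (simp add: rel_def)
    then show ?thesis by blast
  qed
  define m where "m = (LEAST m. \<exists>a. rel m a)"
  obtain a where a: "rel m a" using LeastI_ex[OF \<open>\<exists>m a. rel m a\<close>] unfolding m_def by blast
  have min: "\<not> rel i b" if "i < m" for i b using not_less_Least that unfolding m_def by blast
  have m0: "m > 0"
  proof (rule ccontr)
    assume "\<not> m > 0"
    then have "a 0 \<noteq> 0" "a 0 *s v \<in> F" using a by (simp_all add: rel_def)
    then have "inverse (a 0) *s (a 0 *s v) \<in> F" using F_scale by blast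
    moreover have "inverse (a 0) *s (a 0 *s v) = v" using \<open>a 0 \<noteq> 0\<close> by (simp add: vector_smult_assoc)
    ultimately show False using v by simp
  qed
  then obtain n where n: "m = Suc n" by (cases m) auto
  have a0: "a 0 \<noteq> 0"
  proof
    assume a0: "a 0 = 0"
    \<comment> \<open>If a_0 = 0, the relation is the image under \<phi> of one with fourth roots as
      coefficients, and \<open>F_inv\<close> pulls it back to a shorter relation.\<close>
    define b where "b i = (SOME b. b ^ 4 = a (Suc i))" for i
    have b: "b i ^ 4 = a (Suc i)" for i
    proof -
      have "\<exists>b. b ^ 4 = a (Suc i)" by (rule nth_root_exists) simp
      then show ?thesis unfolding b_def by (rule someI_ex)
    qed
    have "(\<Sum>i\<le>m. a i *s (\<phi> ^^ i) v) = (\<Sum>i\<le>n. a (Suc i) *s (\<phi> ^^ Suc i) v)"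
      unfolding n sum.atMost_Suc_shift using a0 by simp
    also have "\<dots> = \<phi> (\<Sum>i\<le>n. b i *s (\<phi> ^^ i) v)"
      by (simp add: \<phi>_sum scale b)
    finally have "(\<Sum>i\<le>n. b i *s (\<phi> ^^ i) v) \<in> F"
      using a by (auto simp: rel_def intro: F_inv)
    moreover have "b n \<noteq> 0" using a b[of n] by (auto simp: rel_def n)
    ultimately show False using min[of n b] by (simp add: rel_def n)
  qed
  have am: "a m \<noteq> 0" using a by (simp add: rel_def)
  obtain \<mu> c where c: "\<mu> \<noteq> 0" "c 0 = - \<mu> * a 0" "\<And>i. c (Suc i) = c i ^ 4 - \<mu> * a (Suc i)" "c m = 0"
    using recursion_root[of m a, OF m0 a0 am] by auto
  \<comment> \<open>The recursion for c makes \<phi> u - u equal to \<mu> times the shortest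
    relation.\<close>
  define u where "u = (\<Sum>i\<le>n. c i *s (\<phi> ^^ i) v)"
  have "\<phi> u = (\<Sum>i\<le>n. (c (Suc i) + \<mu> * a (Suc i)) *s (\<phi> ^^ Suc i) v)"
    unfolding u_def by (simp add: \<phi>_sum scale c(3))
  also have "\<dots> = (\<Sum>i\<le>m. (c i + \<mu> * a i) *s (\<phi> ^^ i) v)"
    unfolding n sum.atMost_Suc_shift by (simp add: c(2))
  also have "\<dots> = (\<Sum>i\<le>m. c i *s (\<phi> ^^ i) v) + \<mu> *s (\<Sum>i\<le>m. a i *s (\<phi> ^^ i) v)"
    by (simp add: vec.scale_left_distrib sum.distrib vec.scale_sum_right)
  also have "(\<Sum>i\<le>m. c i *s (\<phi> ^^ i) v) = u"
    using c(4) by (simp add: u_def n)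
  finally have "\<phi> u - u \<in> F" using a F_scale by (simp add: rel_def)
  then obtain f where f: "f \<in> F" "\<phi> f - f = \<phi> u - u" using solve by blast
  then have "\<phi> (u - f) = u - f" by (simp add: diff algebra_simps)
  then have "u - f \<in> F" unfolding F_def by (intro vec.span_base) simp
  then have "u \<in> F" using F_add[OF _ f(1), of "u - f"] by simp
  \<comment> \<open>c_n = 0 would give c_m = - \<mu> a_m, contrary to c_m = 0.\<close>
  moreover have "c n \<noteq> 0" using c(1,4) c(3)[of n] am by (auto simp: n)
  ultimately have "rel n c" by (simp add: rel_def u_def)
  then show False using min[of n c] by (simp add: n)
qed

subsection \<open>Frobenius forms\<close>

text \<open>The cubic form \<open>\<Sum> A\<^sub>i\<^sub>j x\<^sub>i\<^sup>2 x\<^sub>j\<close> is the diagonal of the form \<open>\<beta>(v, w) = \<Sum> A\<^sub>i\<^sub>j v\<^sub>i\<^sup>2 w\<^sub>j\<close>,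
  which is linear in \<open>w\<close> and Frobenius-semilinear in \<open>v\<close>.\<close>

definition ff :: "'k::field^'n^'n \<Rightarrow> 'k^'n \<Rightarrow> 'k^'n \<Rightarrow> 'k" where
  "ff A v w = (\<Sum>i\<in>UNIV. \<Sum>j\<in>UNIV. (v $ i)\<^sup>2 * A $ i $ j * w $ j)"

locale frob_form =
  fixes \<beta> :: "'k::alg_closed_field^'n \<Rightarrow> 'k^'n \<Rightarrow> 'k"
  assumes char2: "CHAR('k) = 2"
    and add_l: "\<beta> (u + v) w = \<beta> u w + \<beta> v w" and add_r: "\<beta> u (v + w) = \<beta> u v + \<beta> u w"
    and scale_l: "\<beta> (c *s v) w = c\<^sup>2 * \<beta> v w" and scale_r: "\<beta> v (c *s w) = c * \<beta> v w"
begin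

lemma zero [simp]: "\<beta> 0 w = 0" "\<beta> v 0 = 0"
  using scale_l[of 0 0] scale_r[of _ 0 0] by simp_all

lemma diff_l: "\<beta> (u - v) w = \<beta> u w - \<beta> v w" and diff_r: "\<beta> u (v - w) = \<beta> u v - \<beta> u w"
  using add_l[of "u - v" v] add_r[of u "v - w" w] by (simp_all add: algebra_simps)

lemma sum_l: "\<beta> (sum f B) w = (\<Sum>i\<in>B. \<beta> (f i) w)"
  by (induction B rule: infinite_finite_induct) (simp_all add: add_l)

lemma sum_r: "\<beta> v (sum f B) = (\<Sum>i\<in>B. \<beta> v (f i))"
  by (induction B rule: infinite_finite_induct) (simp_all add: add_r)

lemmas expand = add_l add_r scale_l scale_r diff_l diff_r

text \<open>The form annihilates a linear relation x from both sides, linearly on the right and with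
  squared coefficients on the left; a Gram matrix without common kernel therefore forces
  independence.\<close>

lemma invertible_of_gram:
  fixes e :: "'m::finite \<Rightarrow> 'k^'n" and x :: "'m \<Rightarrow> 'k"
  assumes nondeg: "\<And>x :: 'm \<Rightarrow> 'k. (\<And>i. (\<Sum>j\<in>UNIV. x j * \<beta> (e i) (e j)) = 0) \<Longrightarrow>
      (\<And>j. (\<Sum>i\<in>UNIV. (x i)\<^sup>2 * \<beta> (e i) (e j)) = 0) \<Longrightarrow> x = (\<lambda>_. 0)"
    and "(\<Sum>j\<in>UNIV. x j *s e j) = 0"
  shows "x = (\<lambda>_. 0)"
proof (rule nondeg)
  show "(\<Sum>j\<in>UNIV. x j * \<beta> (e i) (e j)) = 0" for i
    using arg_cong[OF assms(2), of "\<beta> (e i)"] by (simp add: sum_r scale_r)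
  show "(\<Sum>i\<in>UNIV. (x i)\<^sup>2 * \<beta> (e i) (e j)) = 0" for j
    using arg_cong[OF assms(2), of "\<lambda>v. \<beta> v (e j)"] by (simp add: sum_l scale_l)
qed

end

lemma frob_form_ff: "CHAR('k::alg_closed_field) = 2 \<Longrightarrow> frob_form (ff (A :: 'k^'n^'n))"
  by unfold_locales
    (simp_all add: ff_def char2_add_self[OF char2_one] distrib_left distrib_right sum.distrib sum_distrib_left power_mult_distrib mult_ac)

lemma ff_mult_right: "ff A v w = (\<Sum>i\<in>UNIV. (v $ i)\<^sup>2 * (A *v w) $ i)"
  by (simp add: ff_def matrix_vector_mult_def sum_distrib_left mult_ac)

lemma ff_mult_left: "ff A v w = (\<Sum>j\<in>UNIV. (\<Sum>i\<in>UNIV. (v $ i)\<^sup>2 * A $ i $ j) * w $ j)"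
  unfolding ff_def by (subst sum.swap) (simp add: sum_distrib_right)

lemma ff_axis_right: "ff A v (axis j 1) = (\<Sum>i\<in>UNIV. (v $ i)\<^sup>2 * A $ i $ j)"
  unfolding ff_mult_left by (simp add: axis_def if_distrib cong: if_cong)

lemma ff_axis_left: "ff A (axis i 1) w = (A *v w) $ i"
  unfolding ff_mult_right by (simp add: axis_def if_distrib if_distribR cong: if_cong)

subsection \<open>Lang's theorem for Frobenius forms\<close>

lemma cube_root_of_unity: "\<exists>\<omega> :: 'k::alg_closed_field. \<omega>\<^sup>2 + \<omega> + 1 = 0"
proof -
  have "degree [:1, 1, 1 :: 'k:] > 0" by simp
  then obtain t where "poly [:1, 1, 1 :: 'k:] t = 0" using alg_closed_imp_poly_has_root by blast
  then show ?thesis by (intro exI[of _ t]) (simp add: algebra_simps power2_eq_square)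
qed

text \<open>The map \<phi> is determined by \<beta>(w, \<phi> v) = \<beta>(v, w)^2. Its fixed
  vectors span, and on them \<beta> has values in F_4 and is Hermitian, with squaring as
  conjugation. A maximal orthonormal set of fixed vectors is a basis, because the form vanishes on
  the fixed vectors orthogonal to it, and nondegeneracy leaves only zero.\<close>

theorem orthonormal_basis:
  fixes A :: "'k::alg_closed_field^'n^'n"
  assumes char2: "CHAR('k) = 2" and inv: "invertible A"
  shows "\<exists>e :: 'n \<Rightarrow> 'k^'n. \<forall>i j. ff A (e i) (e j) = (if i = j then 1 else 0)"
proof -
  interpret frob_form "ff A" using char2 by (rule frob_form_ff)
  define \<beta> where "\<beta> = ff A"
  note expand' = expand[folded \<beta>_def] and sum_l' = sum_l[folded \<beta>_def] and sum_r' = sum_r[folded \<beta>_def]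
  note ch = char2_add_self[OF char2_one[OF char2]]
  have kerA: "v = 0" if "A *v v = 0" for v
    using inv that by (metis matrix_left_invertible_ker invertible_def)
  obtain B where B: "A ** B = mat 1" "B ** A = mat 1" using inv by (auto simp: invertible_def)
  define \<phi> where "\<phi> v = B *v (\<chi> j. \<Sum>i\<in>UNIV. (A $ i $ j)\<^sup>2 * (v $ i) ^ 4)" for v
  have p4: "(x + y) ^ 4 = x ^ 4 + y ^ 4" for x y :: 'k
  proof -
    have "(x + y) ^ 4 = ((x + y)\<^sup>2)\<^sup>2" by (simp flip: power_mult)
    then show ?thesis by (simp only: ch(3)) (simp flip: power_mult)
  qed
  have sum_sq: "(\<Sum>i\<in>S. f i)\<^sup>2 = (\<Sum>i\<in>S. (f i)\<^sup>2)" for f :: "'n \<Rightarrow> 'k" and S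
    by (induction S rule: infinite_finite_induct) (simp_all add: ch(3))
  have A\<phi>: "A *v \<phi> v = (\<chi> j. (\<Sum>i\<in>UNIV. (v $ i)\<^sup>2 * A $ i $ j)\<^sup>2)" for v
    unfolding \<phi>_def matrix_vector_mul_assoc B sum_sq
    by (simp add: power_mult_distrib vec_eq_iff mult.commute flip: power_mult)
  have fix_iff: "\<phi> v = v \<longleftrightarrow> (\<forall>w. \<beta> w v = (\<beta> v w)\<^sup>2)" for v
  proof
    assume v: "\<phi> v = v"
    have "\<beta> w v = (\<Sum>j\<in>UNIV. (w $ j)\<^sup>2 * (\<Sum>i\<in>UNIV. (v $ i)\<^sup>2 * A $ i $ j)\<^sup>2)" for w
      using A\<phi>[of v] by (simp add: \<beta>_def ff_mult_right v)
    also have "\<dots> w = (\<beta> v w)\<^sup>2" for w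
      by (simp add: \<beta>_def ff_mult_left sum_sq power_mult_distrib mult.commute)
    finally show "\<forall>w. \<beta> w v = (\<beta> v w)\<^sup>2" by blast
  next
    assume *: "\<forall>w. \<beta> w v = (\<beta> v w)\<^sup>2"
    have "(A *v v) $ i = (A *v \<phi> v) $ i" for i
      using *[rule_format, of "axis i 1"] by (simp add: \<beta>_def ff_axis_left ff_axis_right A\<phi>)
    then have "A *v (v - \<phi> v) = 0" by (simp add: vec_eq_iff matrix_vector_mult_diff_distrib)
    then have "v - \<phi> v = 0" by (rule kerA)
    then show "\<phi> v = v" by simp
  qed
  have \<phi>_add: "\<phi> (v + w) = \<phi> v + \<phi> w" for v w
    by (simp add: \<phi>_def p4 distrib_left sum.distrib flip: matrix_vector_right_distrib) (simp add: plus_vec_def)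
  have \<phi>_scale: "\<phi> (c *s v) = c ^ 4 *s \<phi> v" for c v
  proof -
    have "(\<chi> j. \<Sum>i\<in>UNIV. (A $ i $ j)\<^sup>2 * ((c *s v) $ i) ^ 4) = c ^ 4 *s (\<chi> j. \<Sum>i\<in>UNIV. (A $ i $ j)\<^sup>2 * (v $ i) ^ 4)"
      by (simp add: vec_eq_iff power_mult_distrib sum_distrib_left mult_ac)
    then show ?thesis by (simp add: \<phi>_def vec.scale)
  qed
  have nondeg: "v = 0" if "\<And>w. \<beta> v w = 0" for v
  proof -
    have "\<beta> v (axis j 1) = 0" for j by (rule that)
    then have z: "(\<Sum>i\<in>UNIV. (v $ i)\<^sup>2 * A $ i $ j) = 0" for j by (simp add: \<beta>_def ff_axis_right)
    define x where "x = (\<chi> i. (v $ i)\<^sup>2)"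
    have "transpose A *v x = 0"
      using z by (simp add: x_def vec_eq_iff matrix_vector_mult_def transpose_def mult.commute)
    moreover have "transpose B ** transpose A = mat 1"
      using B by (simp flip: matrix_transpose_mul)
    ultimately have "x = 0" by (metis matrix_left_invertible_ker)
    then show ?thesis by (simp add: x_def vec_eq_iff)
  qed
  have ker: "v = 0" if "\<phi> v = 0" for v
  proof (rule nondeg)
    fix w
    have "(\<Sum>i\<in>UNIV. (v $ i)\<^sup>2 * A $ i $ j) = 0" for j
      using arg_cong[OF A\<phi>[of v], of "\<lambda>x. x $ j"] by (simp add: \<open>\<phi> v = 0\<close>)
    then show "\<beta> v w = 0" by (simp add: \<beta>_def ff_mult_left)
  qed
  have span: "vec.span {v. \<phi> v = v} = UNIV"
    by (rule fixed_vectors_span) (fact \<phi>_add \<phi>_scale ker)+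
  have flip: "\<beta> w v = (\<beta> v w)\<^sup>2" if "\<phi> v = v" for v w using that fix_iff by blast
  have four: "\<beta> v w ^ 4 = \<beta> v w" if "\<phi> v = v" "\<phi> w = w" for v w
  proof -
    have "\<beta> v w ^ 4 = ((\<beta> v w)\<^sup>2)\<^sup>2" by (simp flip: power_mult)
    also have "\<dots> = (\<beta> w v)\<^sup>2" by (simp only: flip[OF that(1), of w])
    also have "\<dots> = \<beta> v w" by (rule flip[OF that(2), symmetric])
    finally show ?thesis .
  qed
  define ON where "ON S \<longleftrightarrow> finite S \<and> S \<subseteq> {v. \<phi> v = v} \<and> (\<forall>x\<in>S. \<forall>y\<in>S. \<beta> x y = (if x = y then 1 else 0))" for S
  have ON_ind: "vec.independent S" if "ON S" for S
  proof (rule vec.independent_if_scalars_zero)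
    show "finite S" using that by (simp add: ON_def)
    fix f x assume z: "(\<Sum>x\<in>S. f x *s x) = 0" and x: "x \<in> S"
    have "0 = \<beta> x (\<Sum>y\<in>S. f y *s y)" by (simp add: z \<beta>_def)
    also have "\<dots> = (\<Sum>y\<in>S. f y * (if x = y then 1 else 0))"
      using that x by (simp add: sum_r' expand' ON_def)
    also have "\<dots> = f x" using that x by (simp add: ON_def if_distrib cong: if_cong)
    finally show "f x = 0" by simp
  qed
  have ON_card: "card S \<le> CARD('n)" if "ON S" for S
    using vec.dim_subset_UNIV[of S, unfolded vec.dimension_def] vec.dim_eq_card_independent[OF ON_ind[OF that]] vec_dim_card[where 'a='k and 'n='n] by simp
  have "ON {}" by (simp add: ON_def)
  define m where "m = Max (card ` {S. ON S})"
  have fin: "finite (card ` {S. ON S})"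
  proof (rule finite_subset)
    show "card ` {S. ON S} \<subseteq> {..CARD('n)}" using ON_card by (simp add: image_subset_iff)
  qed simp
  have "m \<in> card ` {S. ON S}" unfolding m_def using fin \<open>ON {}\<close> by (intro Max_in) auto
  then obtain S where S: "ON S" "card S = m" by auto
  have max: "card T \<le> card S" if "ON T" for T
    unfolding S m_def using fin that by (intro Max_ge) auto
  have fS: "finite S" and S_fix: "\<And>e. e \<in> S \<Longrightarrow> \<phi> e = e"
    and S_on: "\<And>e f. e \<in> S \<Longrightarrow> f \<in> S \<Longrightarrow> \<beta> e f = (if e = f then 1 else 0)"
    using S(1) by (auto simp: ON_def)
  define perp where "perp v = v - (\<Sum>e\<in>S. \<beta> e v *s e)" for v
  have \<phi>_sum: "\<phi> (\<Sum>e\<in>S'. c e *s e) = (\<Sum>e\<in>S'. c e ^ 4 *s \<phi> e)" for S' c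
    by (induction S' rule: infinite_finite_induct) (use \<phi>_scale[of 0 0] in \<open>simp_all add: \<phi>_add \<phi>_scale\<close>)
  have perp_fix: "\<phi> (perp v) = perp v" if "\<phi> v = v" for v
  proof -
    have "\<phi> (perp v) + \<phi> (\<Sum>e\<in>S. \<beta> e v *s e) = \<phi> v" by (simp add: perp_def flip: \<phi>_add)
    moreover have "\<phi> (\<Sum>e\<in>S. \<beta> e v *s e) = (\<Sum>e\<in>S. \<beta> e v *s e)"
      unfolding \<phi>_sum by (rule sum.cong) (simp_all add: S_fix four that)
    ultimately show ?thesis using that by (simp add: perp_def algebra_simps)
  qed
  have perp_orth: "\<beta> e (perp v) = 0" if "e \<in> S" for e v
  proof -
    have "(\<Sum>f\<in>S. \<beta> f v * \<beta> e f) = (\<Sum>f\<in>S. if e = f then \<beta> e v else 0)"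
      using that by (intro sum.cong) (auto simp: S_on)
    also have "\<dots> = \<beta> e v" using fS that by simp
    finally show ?thesis by (simp add: perp_def expand' sum_r')
  qed
  \<comment> \<open>\<beta>(x, x) equals its own square, so it is 0 or 1, and the value 1 would
    enlarge S.\<close>
  have iso: "\<beta> x x = 0" if x: "\<phi> x = x" "\<And>e. e \<in> S \<Longrightarrow> \<beta> e x = 0" for x
  proof (rule ccontr)
    assume nz: "\<beta> x x \<noteq> 0"
    have "\<beta> x x * (\<beta> x x - 1) = 0" using flip[OF x(1), of x] by (simp add: power2_eq_square algebra_simps)
    then have 1: "\<beta> x x = 1" using nz by simp
    have "x \<notin> S" using x(2)[of x] 1 by auto
    moreover have "ON (insert x S)"
    proof -
      have "\<beta> x e = 0" if "e \<in> S" for e using flip[OF S_fix[OF that], of x] x(2)[OF that] by simp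
      then show ?thesis using S(1) x 1 \<open>x \<notin> S\<close> by (auto simp: ON_def)
    qed
    ultimately show False using max[of "insert x S"] fS by simp
  qed
  obtain \<omega> :: 'k where \<omega>: "\<omega>\<^sup>2 + \<omega> + 1 = 0" using cube_root_of_unity by blast
  have \<omega>2: "\<omega>\<^sup>2 = \<omega> + 1" 
  proof -
    have "\<omega>\<^sup>2 = - (\<omega> + 1)" using \<omega> by (subst eq_neg_iff_add_eq_0) (simp only: add.assoc)
    then show ?thesis by (simp only: ch(2))
  qed
  have \<omega>4: "\<omega> ^ 4 = \<omega>"
  proof -
    have "\<omega> ^ 4 = (\<omega> + 1)\<^sup>2" by (simp flip: \<omega>2 power_mult)
    also have "\<dots> = \<omega> + (1 + 1)" by (simp only: ch(3) \<omega>2) (simp add: add.assoc)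
    finally show ?thesis using char2_one[OF char2] by simp
  qed
  have sym: "\<beta> y x = \<beta> x y" if x: "\<phi> x = x" "\<And>e. e \<in> S \<Longrightarrow> \<beta> e x = 0" and y: "\<phi> y = y" "\<And>e. e \<in> S \<Longrightarrow> \<beta> e y = 0" for x y
  proof -
    \<comment> \<open>Polarization: x + y is fixed and orthogonal to S as well.\<close>
    have "\<beta> (x + y) (x + y) = 0" using x y by (intro iso) (simp_all add: \<phi>_add expand')
    then have "\<beta> x y + \<beta> y x = 0" using iso[OF x] iso[OF y] by (simp add: expand' add.commute)
    then have "\<beta> y x = - \<beta> x y" by (simp add: eq_neg_iff_add_eq_0 add.commute)
    then show ?thesis by (simp add: ch(2))
  qed
  have orth: "\<beta> x y = 0" if x: "\<phi> x = x" "\<And>e. e \<in> S \<Longrightarrow> \<beta> e x = 0" and y: "\<phi> y = y" "\<And>e. e \<in> S \<Longrightarrow> \<beta> e y = 0" for x y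
  proof -
    \<comment> \<open>The vector \<omega> x is again fixed, since \<omega>^4 = \<omega>. Pulling
      \<omega> out gives \<omega> on the linear side and \<omega>^2 = \<omega> + 1 on the semilinear
      side.\<close>
    have "\<beta> y (\<omega> *s x) = \<beta> (\<omega> *s x) y"
      using x by (intro sym y) (simp_all add: \<phi>_scale \<omega>4 expand')
    then have "\<omega> * \<beta> x y = (\<omega> + 1) * \<beta> x y" using sym[OF x y] by (simp add: expand' \<omega>2)
    then show ?thesis by (simp add: distrib_right)
  qed
  have decomp: "v = perp v + (\<Sum>e\<in>S. \<beta> e v *s e)" for v by (simp add: perp_def)
  have perp0: "perp v = 0" if "\<phi> v = v" for v
  proof (rule nondeg)
    fix w
    have fixw: "\<beta> (perp v) w = 0" if w: "\<phi> w = w" for w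
    proof -
      have "\<beta> (perp v) e = 0" if "e \<in> S" for e
        using flip[OF S_fix[OF that], of "perp v"] perp_orth[OF that] by simp
      then have "\<beta> (perp v) (\<Sum>e\<in>S. \<beta> e w *s e) = 0" by (simp add: sum_r' expand')
      moreover have "\<beta> (perp v) (perp w) = 0"
        by (rule orth) (simp_all add: perp_fix perp_orth w \<open>\<phi> v = v\<close>)
      ultimately show ?thesis using decomp[of w] expand'(2) by (metis add_0)
    qed
    \<comment> \<open>Orthogonality to the fixed vectors extends linearly to their span, the whole
      space.\<close>
    have "w \<in> vec.span {v. \<phi> v = v}" using span by simp
    then show "\<beta> (perp v) w = 0"
      by (induction rule: vec.span_induct_alt) (simp_all add: expand' fixw, simp add: \<beta>_def)
  qed
  have "{v. \<phi> v = v} \<subseteq> vec.span S"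
  proof
    fix v assume "v \<in> {v. \<phi> v = v}"
    then have "v = (\<Sum>e\<in>S. \<beta> e v *s e)" using decomp[of v] perp0 by simp
    also have "\<dots> \<in> vec.span S" by (intro vec.span_sum vec.span_scale vec.span_base)
    finally show "v \<in> vec.span S" .
  qed
  then have "vec.span {v. \<phi> v = v} \<subseteq> vec.span S" by (rule vec.span_minimal) (rule vec.subspace_span)
  then have "UNIV \<subseteq> vec.span S" unfolding span .
  then have "card S = CARD('n)"
    using vec.basis_card_eq_dim[of S UNIV] ON_ind[OF S(1)] vec_dim_card[where 'a='k and 'n='n] by simp
  then obtain e :: "'n \<Rightarrow> 'k^'n" where e: "bij_betw e UNIV S"
    using fS finite_same_card_bij[of "UNIV :: 'n set" S] by auto
  show ?thesis
  proof (intro exI[of _ e] allI)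
    fix i j
    have "e i \<in> S" "e j \<in> S" "e i = e j \<longleftrightarrow> i = j"
      using e by (auto simp: bij_betw_def inj_on_def)
    then show "ff A (e i) (e j) = (if i = j then 1 else 0)" using S_on unfolding \<beta>_def by simp
  qed
qed

subsection \<open>Classification of nondegenerate Frobenius forms in four variables\<close>

lemma neq_4 [simp]: "(1::4) \<noteq> 2" "(1::4) \<noteq> 3" "(1::4) \<noteq> 4" "(2::4) \<noteq> 1" "(2::4) \<noteq> 3" "(2::4) \<noteq> 4"
    "(3::4) \<noteq> 1" "(3::4) \<noteq> 2" "(3::4) \<noteq> 4" "(4::4) \<noteq> 1" "(4::4) \<noteq> 2" "(4::4) \<noteq> 3"
  by simp_all

definition vec4 :: "'a \<Rightarrow> 'a \<Rightarrow> 'a \<Rightarrow> 'a \<Rightarrow> 4 \<Rightarrow> 'a" where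
  "vec4 a b c d i = (if i = 1 then a else if i = 2 then b else if i = 3 then c else d)"

lemma vec4_simps [simp]: "vec4 a b c d 1 = a" "vec4 a b c d 2 = b" "vec4 a b c d 3 = c" "vec4 a b c d 4 = d"
  by (simp_all add: vec4_def)

text \<open>A pair (i, j) stands for the monomial x_i^2 x_j, and the list follows the order of the
  five cubics. The Gram matrices are partial permutation matrices.\<close>

definition patterns :: "(4 \<times> 4) set list" where
  "patterns = [{(1,1), (2,2), (3,3), (4,4)}, {(1,4), (2,2), (3,1)}, {(1,4), (2,3), (3,1)},
     {(1,4), (2,2), (3,3)}, {(1,3), (2,4)}]"

lemma not_in_span:
  fixes S :: "('k::field^4) set"
  assumes "finite S" "card S < 4"
  obtains u where "u \<notin> vec.span S"
proof -
  have "vec.span S \<noteq> UNIV"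
  proof
    assume "vec.span S = UNIV"
    then have "vec.dim (UNIV :: ('k^4) set) \<le> card S" using assms by (intro vec.dim_le_card) auto
    then show False using assms vec_dim_card[where 'a='k and 'n=4] by simp
  qed
  then show ?thesis using that by auto
qed

lemma span_four:
  fixes a :: "'k::field^4"
  assumes "a \<noteq> 0" "b \<notin> vec.span {a}" "c \<notin> vec.span {a, b}" "d \<notin> vec.span {a, b, c}"
  shows "vec.span {a, b, c, d} = UNIV"
proof -
  have neq: "b \<notin> {a}" "c \<notin> {a, b}" "d \<notin> {a, b, c}"
    using assms(2)[THEN contrapos_nn, OF vec.span_base] assms(3)[THEN contrapos_nn, OF vec.span_base]
      assms(4)[THEN contrapos_nn, OF vec.span_base] by blast+
  have "vec.independent {a}" using assms(1) by simp
  then have "vec.independent {b, a}"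
    using assms(2) neq by (subst vec.independent_insert) simp
  then have "vec.independent {c, a, b}"
    using assms(3) neq by (subst vec.independent_insert) (simp add: insert_commute)
  then have "vec.independent {d, a, b, c}"
    using assms(4) neq by (subst vec.independent_insert) (simp add: insert_commute)
  then have ind: "vec.independent {a, b, c, d}" by (simp add: insert_commute)
  have "card {a, b, c, d} = 4" using neq by auto
  then have "UNIV \<subseteq> vec.span {a, b, c, d}"
    using vec_dim_card[where 'a='k and 'n=4] by (intro vec.card_ge_dim_independent ind) simp_all
  then show ?thesis by blast
qed

context frob_form
begin

lemma span_zero_l: "v \<in> vec.span S \<Longrightarrow> (\<And>x. x \<in> S \<Longrightarrow> \<beta> x y = 0) \<Longrightarrow> \<beta> v y = 0"
  by (induction rule: vec.span_induct_alt) (simp_all add: expand)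

lemma span_zero_r: "v \<in> vec.span S \<Longrightarrow> (\<And>x. x \<in> S \<Longrightarrow> \<beta> y x = 0) \<Longrightarrow> \<beta> y v = 0"
  by (induction rule: vec.span_induct_alt) (simp_all add: expand)

end

context
  fixes A :: "'k::alg_closed_field^4^4"
  assumes char2: "CHAR('k) = 2"
begin

interpretation frob_form "ff A" using char2 by (rule frob_form_ff)

text \<open>The equations of the left kernel involve the squares of the coordinates, so they are
  solved by the square roots of a kernel vector of the transpose.\<close>

lemma left_kernel:
  assumes "w \<noteq> 0" "\<And>v. ff A v w = 0"
  obtains l where "l \<noteq> 0" "\<And>v. ff A l v = 0"
proof -
  have "A *v w = 0" using assms(2)[of "axis _ 1"] by (simp add: vec_eq_iff ff_axis_left)
  then have "\<not> invertible A" using assms(1) by (metis invertible_def matrix_left_invertible_ker)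
  then have "\<not> invertible (transpose A)" by (simp add: invertible_det_nz)
  then obtain x where x: "transpose A *v x = 0" "x \<noteq> 0" using invertibleI_ker[of "transpose A"] by blast
  define l where "l = (\<chi> i. froot (x $ i))"
  have "l = 0 \<Longrightarrow> x = 0" using froot_square[of "x $ _"] by (simp add: l_def vec_eq_iff)
  moreover have "ff A l v = 0" for v
  proof -
    have "(\<Sum>i\<in>UNIV. x $ i * A $ i $ j) = 0" for j
      using arg_cong[OF x(1), of "\<lambda>y. y $ j"] by (simp add: matrix_vector_mult_def transpose_def mult.commute)
    then show ?thesis by (simp add: ff_mult_left l_def froot_square)
  qed
  ultimately show ?thesis using that x by blast
qed

context
  assumes nondeg: "\<And>v. (\<And>w. ff A v w = 0) \<Longrightarrow> (\<And>w. ff A w v = 0) \<Longrightarrow> v = 0"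
begin

lemma not_in_span_kernel: "l \<notin> vec.span {w}"
  if "\<And>v. ff A v w = 0" "\<And>v. ff A l v = 0" "l \<noteq> 0" for l w
proof
  assume "l \<in> vec.span {w}"
  then have "ff A v l = 0" for v by (rule span_zero_r) (use that in auto)
  then show False using nondeg[of l] that by blast
qed

text \<open>The pair w, l splits off, leaving the two-dimensional space of u with \<beta>(w, u) = 0
  = \<beta>(u, l). If the form is nondegenerate there, it has an orthonormal basis; otherwise a
  right kernel vector of the restriction leads to a second pair like the first.\<close>

lemma classify_hyperbolic:
  assumes W: "\<And>v. ff A v w = 0" and L: "\<And>v. ff A l v = 0" and wl: "ff A w l = 1"
  shows "\<exists>S\<in>set patterns. \<exists>e. \<forall>i j. ff A (e i) (e j) = (if (i, j) \<in> S then 1 else 0)"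
proof -
  have "w \<noteq> 0" "l \<noteq> 0" using wl by auto
  have extend: "\<exists>u. u \<notin> vec.span {w, l, x} \<and> ff A w u = 0 \<and> ff A u l = 0" for x
  proof -
    have "card {w, l, x} < 4" by (simp add: card_insert_if)
    then obtain u0 where u0: "u0 \<notin> vec.span {w, l, x}" using not_in_span[of "{w, l, x}"] by auto
    \<comment> \<open>The coefficient of l enters \<beta>(w, u) linearly, that of w enters
      \<beta>(u, l) through its square; hence the square root.\<close>
    define u where "u = u0 - (ff A w u0 *s l + froot (ff A u0 l) *s w)"
    have "ff A w u0 *s l + froot (ff A u0 l) *s w \<in> vec.span {w, l, x}"
      by (intro vec.span_add vec.span_scale vec.span_base) auto
    then have "u \<notin> vec.span {w, l, x}"
      using u0 vec.span_add[of u "{w, l, x}" "ff A w u0 *s l + froot (ff A u0 l) *s w"] by (auto simp: u_def)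
    then show ?thesis by (intro exI[of _ u]) (simp add: u_def expand froot_square W L wl)
  qed
  have l_span: "l \<notin> vec.span {w}" by (rule not_in_span_kernel[OF W L \<open>l \<noteq> 0\<close>])
  obtain u1 where u1: "u1 \<notin> vec.span {w, l}" "ff A w u1 = 0" "ff A u1 l = 0"
    using extend[of w] by (auto simp: insert_commute)
  obtain u2 where u2: "u2 \<notin> vec.span {w, l, u1}" "ff A w u2 = 0" "ff A u2 l = 0"
    using extend[of u1] by auto
  have span: "vec.span {w, l, u1, u2} = UNIV"
    using \<open>w \<noteq> 0\<close> l_span u1(1) u2(1) by (rule span_four)
  define u where "u i = (if i = (1::2) then u1 else u2)" for i
  define A2 :: "'k^2^2" where "A2 = (\<chi> i j. ff A (u i) (u j))"
  define em where "em x = (\<Sum>i\<in>UNIV. (x $ i) *s u i)" for x :: "'k^2"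
  have ff2: "ff A2 x y = ff A (em x) (em y)" for x y
  proof -
    have "ff A (em x) (em y) = (\<Sum>i\<in>UNIV. \<Sum>j\<in>UNIV. (x $ i)\<^sup>2 * (y $ j * ff A (u i) (u j)))"
      unfolding em_def sum_l unfolding sum_r by (simp add: expand mult.left_commute)
    then show ?thesis unfolding ff_def[of A2] by (simp add: A2_def mult_ac)
  qed
  have u_U: "ff A w (u i) = 0" "ff A (u i) l = 0" for i using u1 u2 by (simp_all add: u_def)
  have em_U: "ff A w (em x) = 0" "ff A (em x) l = 0" for x by (simp_all add: em_def sum_l sum_r expand u_U)
  show ?thesis
  proof (cases "invertible A2")
    case True
    from orthonormal_basis[OF char2 True]
    obtain e :: "2 \<Rightarrow> 'k^2" where e: "\<And>i j. ff A2 (e i) (e j) = (if i = j then 1 else 0)" by auto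
    show ?thesis
      using e[unfolded ff2] em_U W L wl
      by (intro bexI[of _ "{(1,4), (2,2), (3,3)}"] exI[of _ "vec4 w (em (e 1)) (em (e 2)) l"])
        (simp_all add: forall_4 patterns_def)
  next
    case False
    then obtain x where x: "A2 *v x = 0" "x \<noteq> 0" using invertibleI_ker[of A2] by blast
    define w' where "w' = em x"
    have w'_U: "ff A w w' = 0" "ff A w' l = 0" using em_U by (simp_all add: w'_def)
    have uw': "ff A (u i) w' = 0" for i
    proof -
      have "em (axis i 1) = (\<Sum>j\<in>UNIV. if j = i then u i else 0)"
        unfolding em_def by (rule sum.cong) (auto simp: axis_def)
      then have "em (axis i 1) = u i" by simp
      then have "ff A (u i) w' = (A2 *v x) $ i" using ff2[of "axis i 1" x] by (simp add: w'_def ff_axis_left)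
      then show ?thesis using x by simp
    qed
    have W': "ff A v w' = 0" for v
    proof (rule span_zero_l[of v "{w, l, u1, u2}"])
      show "v \<in> vec.span {w, l, u1, u2}" using span by simp
      show "ff A y w' = 0" if "y \<in> {w, l, u1, u2}" for y
        using that w'_U L uw'[of 1] uw'[of 2] by (auto simp: u_def)
    qed
    have "w' \<noteq> 0"
    proof
      assume "w' = 0"
      then have z: "x $ 1 *s u1 + x $ 2 *s u2 = 0" by (simp add: w'_def em_def sum_2 u_def)
      have "x $ 2 = 0"
      proof (rule ccontr)
        assume "x $ 2 \<noteq> 0"
        then have "u2 = (- inverse (x $ 2) * x $ 1) *s u1"
        proof -
          have "x $ 2 *s u2 = - (x $ 1 *s u1)" using z by (simp add: eq_neg_iff_add_eq_0 add.commute)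
          then have "inverse (x $ 2) *s (x $ 2 *s u2) = inverse (x $ 2) *s (- (x $ 1 *s u1))" by simp
          then show ?thesis using \<open>x $ 2 \<noteq> 0\<close> by (simp add: vector_smult_assoc)
        qed
        moreover have "(- inverse (x $ 2) * x $ 1) *s u1 \<in> vec.span {w, l, u1}"
          by (intro vec.span_scale vec.span_base) simp
        ultimately show False using u2(1) by simp
      qed
      moreover have "u1 \<noteq> 0" using u1(1) vec.span_zero by auto
      ultimately have "x $ 1 = 0" using z by (simp add: vec.scale_eq_0_iff)
      then show False using x(2) \<open>x $ 2 = 0\<close> by (simp add: vec_eq_iff forall_2)
    qed
    obtain u' where u': "u' \<notin> vec.span {w, l, w'}" "ff A w u' = 0" "ff A u' l = 0"
      using extend[of w'] by auto
    have "w' \<notin> vec.span {w, l}"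
    proof
      assume "w' \<in> vec.span {w, l}"
      then have "w' \<in> vec.span {l, w}" by (simp add: insert_commute)
      then obtain k where k: "w' - k *s l \<in> vec.span {w}" by (auto simp: vec.span_insert)
      then obtain k' where k': "w' - k *s l = k' *s w" by (auto simp: vec.span_singleton)
      then have w'_eq: "w' = k *s l + k' *s w" by (simp add: algebra_simps)
      have "k = 0" using w'_U(1) W[of w] wl unfolding w'_eq by (simp add: expand)
      moreover have "k' = 0" using w'_U(2) L[of l] wl unfolding w'_eq by (simp add: expand)
      ultimately show False using w'_eq \<open>w' \<noteq> 0\<close> by simp
    qed
    then have span': "vec.span {w, l, w', u'} = UNIV"
      using \<open>w \<noteq> 0\<close> l_span u'(1) by (intro span_four)
    define p where "p = ff A w' u'"
    have "p \<noteq> 0"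
    proof
      assume "p = 0"
      have "ff A w' v = 0" for v
      proof (rule span_zero_r[of v "{w, l, w', u'}"])
        show "v \<in> vec.span {w, l, w', u'}" using span' by simp
        show "ff A w' y = 0" if "y \<in> {w, l, w', u'}" for y
          using that w'_U W W' \<open>p = 0\<close> by (auto simp: p_def)
      qed
      then show False using nondeg[of w'] W' \<open>w' \<noteq> 0\<close> by blast
    qed
    \<comment> \<open>Since every \<beta>(v, w') vanishes, subtracting c w' changes \<beta>(u', u')
      only by c^2 p; the choice c^2 = \<beta>(u', u') / p makes the vector isotropic.\<close>
    define l' where "l' = inverse p *s (u' - froot (inverse p * ff A u' u') *s w')"
    have "ff A l' l' = 0"
      using \<open>p \<noteq> 0\<close> W' by (simp add: l'_def expand froot_square p_def[symmetric])
    moreover have "ff A w' l' = 1" using \<open>p \<noteq> 0\<close> W' by (simp add: l'_def expand p_def[symmetric])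
    moreover have "ff A w l' = 0" "ff A l' l = 0" using u' w'_U by (simp_all add: l'_def expand)
    ultimately show ?thesis
      using W L wl W' w'_U
      by (intro bexI[of _ "{(1,3), (2,4)}"] exI[of _ "vec4 w w' l l'"]) (simp_all add: forall_4 patterns_def)
  qed
qed

text \<open>The kernels pair to zero, and e1, e3 separate the functionals \<beta>(-, l) and
  \<beta>(w, -). After corrections the nonzero pairings link w, f3, f1, l in this order, which is
  the chain of the third pattern.\<close>

lemma classify_chain:
  assumes W: "\<And>v. ff A v w = 0" "w \<noteq> 0" and L: "\<And>v. ff A l v = 0" "l \<noteq> 0"
    and orth: "\<And>w' l'. (\<And>v. ff A v w' = 0) \<Longrightarrow> (\<And>v. ff A l' v = 0) \<Longrightarrow> ff A w' l' = 0"
    and v: "ff A e1 l = 1" "ff A w e1 = 0" "ff A e3 l = 0" "ff A w e3 = 1"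
  shows "\<exists>S\<in>set patterns. \<exists>e. \<forall>i j. ff A (e i) (e j) = (if (i, j) \<in> S then 1 else 0)"
proof -
  have wl: "ff A w l = 0" by (rule orth[OF W(1) L(1)])
  \<comment> \<open>The multiples of l and w remove \<beta>(f1, f1), \<beta>(f1, f3) and \<beta>(f3,
    f3).\<close>
  define f1 where "f1 = e1 - ff A e1 e1 *s l"
  define f3 where "f3 = e3 - (ff A e1 e3 *s l + froot (ff A e3 e3) *s w)"
  have f: "ff A f1 f1 = 0" "ff A f1 f3 = 0" "ff A f3 f3 = 0" "ff A f3 l = 0" "ff A w f3 = 1" "ff A f1 l = 1" "ff A w f1 = 0"
    by (simp_all add: f1_def f3_def expand froot_square W L wl v)
  define p where "p = ff A f3 f1"
  have l_span: "l \<notin> vec.span {w}" by (rule not_in_span_kernel[OF W(1) L])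
  have "f1 \<notin> vec.span {w, l}"
  proof
    assume "f1 \<in> vec.span {w, l}"
    then have "ff A f1 l = 0" by (rule span_zero_l) (use wl L in auto)
    then show False using f by simp
  qed
  moreover have "f3 \<notin> vec.span {w, l, f1}"
  proof
    assume "f3 \<in> vec.span {w, l, f1}"
    then have "ff A w f3 = 0" by (rule span_zero_r) (use wl W f in auto)
    then show False using f by simp
  qed
  ultimately have span: "vec.span {w, l, f1, f3} = UNIV" by (rule span_four[OF W(2) l_span])
  have "p \<noteq> 0"
  proof
    \<comment> \<open>Then f1 would lie in the right kernel and pair to zero with l, although the
      pairing is 1.\<close>
    assume "p = 0"
    have "ff A x f1 = 0" for x
    proof (rule span_zero_l[of x "{w, l, f1, f3}"])
      show "x \<in> vec.span {w, l, f1, f3}" using span by simp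
      show "ff A y f1 = 0" if "y \<in> {w, l, f1, f3}" for y
        using that f L \<open>p = 0\<close> by (auto simp: p_def)
    qed
    then have "ff A f1 l = 0" using L(1) by (rule orth)
    then show False using f by simp
  qed
  \<comment> \<open>Scaling f3 by s and w by t turns the pairings p and 1 into s^2 p and t^2
    s.\<close>
  define s where "s = froot (inverse p)"
  define t where "t = froot (inverse s)"
  have s: "s\<^sup>2 * p = 1" using \<open>p \<noteq> 0\<close> by (simp add: s_def froot_square)
  then have "s \<noteq> 0" by auto
  then have t: "t\<^sup>2 * s = 1" by (simp add: t_def froot_square)
  show ?thesis
    using f W(1) L(1) s t wl
    by (intro bexI[of _ "{(1,4), (2,3), (3,1)}"] exI[of _ "vec4 f1 (t *s w) (s *s f3) l"])
      (simp_all add: forall_4 patterns_def expand p_def mult_ac)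
qed

text \<open>Here \<beta>(-, l) and \<beta>(w, -) have the same zeros, so a single vector e1 is
  linked to both kernels. A further vector e2 that pairs to zero with w, l and e1 must be
  anisotropic, since otherwise it would lie in both kernels.\<close>

lemma classify_loop:
  assumes W: "\<And>v. ff A v w = 0" "w \<noteq> 0" and L: "\<And>v. ff A l v = 0" "l \<noteq> 0" and wl: "ff A w l = 0"
    and H: "\<And>v. ff A v l = 0 \<longleftrightarrow> ff A w v = 0" and e1: "ff A e1 l = 1" "ff A w e1 = 1"
  shows "\<exists>S\<in>set patterns. \<exists>e. \<forall>i j. ff A (e i) (e j) = (if (i, j) \<in> S then 1 else 0)"
proof -
  have l_span: "l \<notin> vec.span {w}" by (rule not_in_span_kernel[OF W(1) L])
  have e1_span: "e1 \<notin> vec.span {w, l}"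
  proof
    assume "e1 \<in> vec.span {w, l}"
    then have "ff A e1 l = 0" by (rule span_zero_l) (use wl L in auto)
    then show False using e1 by simp
  qed
  have "card {w, l, e1} < 4" by (simp add: card_insert_if)
  then obtain u0 where u0: "u0 \<notin> vec.span {w, l, e1}" using not_in_span[of "{w, l, e1}"] by auto
  define u where "u = u0 - froot (ff A u0 l) *s e1"
  have u: "ff A u l = 0" by (simp add: u_def expand froot_square e1)
  then have u': "ff A w u = 0" using H by blast
  define e2 where "e2 = u - (ff A e1 u *s l + froot (ff A u e1) *s w)"
  have e2: "ff A e1 e2 = 0" "ff A e2 e1 = 0" "ff A e2 l = 0" "ff A w e2 = 0"
    by (simp_all add: e2_def expand froot_square W L wl e1 u u')
  have e2_span: "e2 \<notin> vec.span {w, l, e1}"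
  proof
    assume e2: "e2 \<in> vec.span {w, l, e1}"
    have "froot (ff A u0 l) *s e1 + (ff A e1 u *s l + froot (ff A u e1) *s w) \<in> vec.span {w, l, e1}"
      by (intro vec.span_add vec.span_scale vec.span_base) auto
    from vec.span_add[OF e2 this] show False using u0 by (simp add: e2_def u_def)
  qed
  have span: "vec.span {w, l, e1, e2} = UNIV" using W(2) l_span e1_span e2_span by (rule span_four)
  define p where "p = ff A e2 e2"
  have "p \<noteq> 0"
  proof
    assume p: "p = 0"
    have mem: "x \<in> vec.span {w, l, e1, e2}" for x using span by simp
    have "ff A x e2 = 0" "ff A e2 x = 0" for x
      using e2 p W L by (auto intro: span_zero_l[OF mem] span_zero_r[OF mem] simp: p_def)
    then have "e2 = 0" by (intro nondeg)
    then show False using e2_span vec.span_zero by blast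
  qed
  \<comment> \<open>\<beta>(s e2, s e2) = s^3 p.\<close>
  obtain s where s: "s ^ 3 = inverse p" using nth_root_exists[of 3 "inverse p"] by auto
  have s': "s\<^sup>2 * (s * p) = 1" using s \<open>p \<noteq> 0\<close> by (simp add: power3_eq_cube power2_eq_square field_simps)
  define f1 where "f1 = e1 - ff A e1 e1 *s l"
  have f1: "ff A f1 f1 = 0" "ff A f1 l = 1" "ff A w f1 = 1" "ff A f1 e2 = 0" "ff A e2 f1 = 0"
    by (simp_all add: f1_def expand e1 e2 L wl)
  show ?thesis
    using f1 W(1) L(1) s' wl e2
    by (intro bexI[of _ "{(1,4), (2,2), (3,1)}"] exI[of _ "vec4 f1 (s *s e2) w l"])
      (simp_all add: forall_4 patterns_def expand p_def mult_ac)
qed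

text \<open>A trivial right kernel is the orthonormal case. Otherwise the question is whether some
  right kernel vector pairs nontrivially with a left kernel vector and, if not, whether \<beta>(-,
  l) and \<beta>(w, -) have the same zeros.\<close>

theorem classify_frobenius_forms:
  "\<exists>S\<in>set patterns. \<exists>e. \<forall>i j. ff A (e i) (e j) = (if (i, j) \<in> S then 1 else 0)"
proof (cases "\<exists>w. w \<noteq> 0 \<and> (\<forall>v. ff A v w = 0)")
  case False
  have "invertible A"
  proof (rule invertibleI_ker)
    fix x assume "A *v x = 0"
    then show "x = 0" using False by (auto simp: ff_mult_right)
  qed
  from orthonormal_basis[OF char2 this]
  obtain e :: "4 \<Rightarrow> 'k^4" where "\<And>i j. ff A (e i) (e j) = (if i = j then 1 else 0)" by auto
  then show ?thesis
    by (intro bexI[of _ "{(1,1), (2,2), (3,3), (4,4)}"] exI[of _ e]) (simp_all add: forall_4 patterns_def)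
next
  case True
  then obtain w where w: "w \<noteq> 0" "\<And>v. ff A v w = 0" by blast
  obtain l where l: "l \<noteq> 0" "\<And>v. ff A l v = 0" using left_kernel[OF w] by blast
  show ?thesis
  proof (cases "\<exists>w l. (\<forall>v. ff A v w = 0) \<and> (\<forall>v. ff A l v = 0) \<and> ff A w l \<noteq> 0")
    case True
    then obtain w l where wl: "\<And>v. ff A v w = 0" "\<And>v. ff A l v = 0" "ff A w l \<noteq> 0" by blast
    then show ?thesis
      by (intro classify_hyperbolic[of w "inverse (ff A w l) *s l"]) (simp_all add: expand)
  next
    case False
    then have orth: "ff A w' l' = 0" if "\<And>v. ff A v w' = 0" "\<And>v. ff A l' v = 0" for w' l'
      using that by blast
    obtain x where x: "ff A w x \<noteq> 0" using nondeg[of w] w by blast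
    obtain y where y: "ff A y l \<noteq> 0" using nondeg[of l] l by blast
    show ?thesis
    proof (cases "\<forall>v. ff A v l = 0 \<longleftrightarrow> ff A w v = 0")
      case True
      have yw: "ff A w y \<noteq> 0" using True y by blast
      show ?thesis
        using w l y yw True orth[OF w(2) l(2)]
        by (intro classify_loop[of "froot (inverse (ff A w y)) *s w" "inverse (ff A y l) *s l" y])
          (auto simp: expand froot_square vec.scale_eq_0_iff dest: arg_cong[of "froot _" 0 "\<lambda>x. x\<^sup>2"])
    next
      case False
      then obtain v where v: "(ff A v l = 0) \<noteq> (ff A w v = 0)" by blast
      have "\<exists>e1 e3. ff A e1 l \<noteq> 0 \<and> ff A w e1 = 0 \<and> ff A e3 l = 0 \<and> ff A w e3 \<noteq> 0"
      proof (cases "ff A v l = 0")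
        case True
        then have "ff A w v \<noteq> 0" using v by blast
        \<comment> \<open>Subtracting a multiple of v from y kills one functional and leaves the
          other unchanged; the remaining case exchanges the two functionals.\<close>
        then show ?thesis using True y
          by (intro exI[of _ "y - (ff A w y / ff A w v) *s v"] exI[of _ v]) (simp add: expand)
      next
        case False
        then have "ff A w v = 0" using v by blast
        then show ?thesis using False x
          by (intro exI[of _ v] exI[of _ "x - froot (ff A x l / ff A v l) *s v"]) (simp only: expand froot_square, simp)
      qed
      then obtain e1 e3 where e: "ff A e1 l \<noteq> 0" "ff A w e1 = 0" "ff A e3 l = 0" "ff A w e3 \<noteq> 0" by blast
      show ?thesis
        using w l e orth
        by (intro classify_chain[of "froot (inverse (ff A w e3)) *s w" "inverse (ff A e1 l) *s l" e1 e3])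
          (auto simp: expand froot_square vec.scale_eq_0_iff dest: arg_cong[of "froot _" 0 "\<lambda>x. x\<^sup>2"])
    qed
  qed
qed

end

end

section \<open>From Frobenius forms to cubic forms and their linear equivalence\<close>

subsection \<open>Cubic forms without squarefree monomials\<close>

definition cform :: "'k::field^'n^'n \<Rightarrow> ('n::finite, 'k) mpoly" where
  "cform A = (\<Sum>i\<in>UNIV. \<Sum>j\<in>UNIV. Const (A $ i $ j) * ((Var i)\<^sup>2 * Var j))"

definition sqm :: "'n \<Rightarrow> 'n \<Rightarrow> ('n \<Rightarrow>\<^sub>0 nat)" where
  "sqm i j = Poly_Mapping.single i 2 + Poly_Mapping.single j 1"

lemma square_mult_mono: "(Var i)\<^sup>2 * Var j = (mon (sqm i j) 1 :: ('n, 'k::field) mpoly)"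
  unfolding Var_power by (simp add: Var_def mult_single sqm_def)

lemma sqm_inject [simp]: "sqm i j = sqm i' j' \<longleftrightarrow> i = i' \<and> j = j'"
proof
  assume eq: "sqm i j = sqm i' j'"
  have "Poly_Mapping.lookup (sqm i j) i = Poly_Mapping.lookup (sqm i' j') i" by (simp only: eq)
  then have "i = i'" by (auto simp: sqm_def lookup_add lookup_single when_def split: if_splits)
  then have "Poly_Mapping.single j (1::nat) = Poly_Mapping.single j' 1" using eq by (simp add: sqm_def)
  then have "Poly_Mapping.lookup (Poly_Mapping.single j (1::nat)) j = Poly_Mapping.lookup (Poly_Mapping.single j' 1) j"
    by simp
  then show "i = i' \<and> j = j'" using \<open>i = i'\<close> by (auto simp: lookup_single when_def split: if_splits)
qed simp

lemma cform_mono: "cform A = (\<Sum>i\<in>UNIV. \<Sum>j\<in>UNIV. mon (sqm i j) (A $ i $ j))"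
  by (simp add: cform_def square_mult_mono Const_def mult_single)

lemma lookup_cform: "cf (cform A) (sqm i j) = A $ i $ j"
proof -
  have "cf (cform A) (sqm i j) = (\<Sum>i'\<in>UNIV. \<Sum>j'\<in>UNIV. if j' = j then (if i' = i then A $ i' $ j else 0) else 0)"
    unfolding cform_mono lookup_sum lookup_single by (intro sum.cong) (auto simp: when_def)
  then show ?thesis by simp
qed

lemma lookup_cform_0: "(\<And>i j. m \<noteq> sqm i j) \<Longrightarrow> cf (cform A) m = 0"
  by (simp add: cform_mono lookup_sum lookup_single when_def eq_commute)

lemma lookup_cform_neq_0: "cf (cform A) m \<noteq> 0 \<Longrightarrow> \<exists>i j. m = sqm i j \<and> A $ i $ j \<noteq> 0"
  using lookup_cform lookup_cform_0 by metis

lemma cform_inject: "cform A = cform B \<Longrightarrow> A = B"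
  by (simp add: vec_eq_iff flip: lookup_cform)

lemma homogeneous_cform: "homogeneous 3 (cform A)"
proof (rule homogeneousI)
  fix m assume "cf (cform A) m \<noteq> 0"
  then obtain i j where "m = sqm i j" using lookup_cform_neq_0 by blast
  then show "mdeg m = 3" by (simp add: sqm_def)
qed

text \<open>A cubic monomial divisible by x_i^2 is x_i^2 x_j for some j.\<close>

lemma no_squarefree_cform:
  fixes h :: "('n::finite, 'k::field) mpoly"
  assumes h: "homogeneous 3 h" and sq: "\<And>m. cf h m \<noteq> 0 \<Longrightarrow> \<exists>i. Poly_Mapping.lookup m i \<ge> 2"
  obtains A where "h = cform A"
proof
  show "h = cform (\<chi> i j. cf h (sqm i j))"
  proof (rule poly_mapping_eqI)
    fix m
    show "cf h m = cf (cform (\<chi> i j. cf h (sqm i j))) m"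
    proof (cases "\<exists>i j. m = sqm i j")
      case True
      then show ?thesis by (auto simp: lookup_cform)
    next
      case False
      have "cf h m = 0"
      proof (rule ccontr)
        assume nz: "cf h m \<noteq> 0"
        then obtain i where i: "Poly_Mapping.lookup m i \<ge> 2" using sq by blast
        have m: "m = Poly_Mapping.single i 2 + (m - Poly_Mapping.single i 2)"
          using i by (intro poly_mapping_eqI) (auto simp: lookup_add lookup_minus lookup_single when_def)
        have "mdeg m = 3" using homogeneousD[OF h nz] .
        then have "mdeg (m - Poly_Mapping.single i 2) = Suc 0"
          using arg_cong[OF m, of mdeg] by simp
        then show False using m False by (elim mdeg_1E) (auto simp: sqm_def)
      qed
      then show ?thesis using False by (simp add: lookup_cform_0)
    qed
  qed
qed

subsection \<open>Linear changes of coordinates\<close>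

abbreviation linv :: "'k::comm_semiring_1^'n^'n \<Rightarrow> 'n \<Rightarrow> ('n::finite, 'k) mpoly" where
  "linv g i \<equiv> (\<Sum>j\<in>UNIV. Const (g $ i $ j) * Var j)"

lemma lin_change_comp: "lin_change g (lin_change g' f) = lin_change (g' ** g) f"
proof -
  have "(\<Sum>j\<in>UNIV. Const (g' $ i $ j) * linv g j) = linv (g' ** g) i" for i
    unfolding sum_distrib_left matrix_matrix_mult_def
    by (subst sum.swap) (simp add: Const_sum Const_mult sum_distrib_left sum_distrib_right mult_ac)
  then show ?thesis
    unfolding lin_change_def subst_subst by (simp add: subst_simps)
qed

lemma lin_change_mat_1 [simp]: "lin_change (mat 1) f = f" for f :: "('n::finite, 'k::comm_semiring_1) mpoly"
proof -
  have "linv (mat 1 :: 'k^'n^'n) i = Var i" for i :: 'n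
  proof -
    have "linv (mat 1 :: 'k^'n^'n) i = (\<Sum>j\<in>UNIV. if j = i then Var i else 0)"
      by (rule sum.cong) (auto simp: mat_def)
    then show ?thesis by simp
  qed
  then show ?thesis by (simp add: lin_change_def)
qed

lemma homogeneous_linv: "homogeneous (Suc 0) (linv g i)"
  by (intro homogeneous_sum homogeneous_Const_mult homogeneous_Var)

lemma homogeneous_lin_change: "homogeneous d f \<Longrightarrow> homogeneous d (lin_change g f)"
  unfolding lin_change_def using homogeneous_subst[of d f "Suc 0" "linv g"] homogeneous_linv[of g] by simp

lemma lin_change_inverse:
  assumes "invertible g"
  obtains g' where "invertible g'" "\<And>f. lin_change g' (lin_change g f) = f" "\<And>f. lin_change g (lin_change g' f) = f"
proof -
  obtain g' where g': "g ** g' = mat 1" "g' ** g = mat 1" using assms by (auto simp: invertible_def)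
  show ?thesis by (rule that[of g']) (use g' in \<open>auto simp: lin_change_comp invertible_def\<close>)
qed

lemma lin_equiv_sym: "lin_equiv f f' \<Longrightarrow> lin_equiv f' f"
  unfolding lin_equiv_def by (metis lin_change_inverse)

lemma lin_equiv_trans: "lin_equiv f f' \<Longrightarrow> lin_equiv f' f'' \<Longrightarrow> lin_equiv f f''"
  unfolding lin_equiv_def by (metis invertible_mult lin_change_comp)

definition pat :: "('n \<times> 'n) set \<Rightarrow> 'k::field^'n^'n" where
  "pat S = (\<chi> i j. if (i, j) \<in> S then 1 else 0)"

definition cubics :: "(4, 'k::field) mpoly list" where
  "cubics = [cubic1, cubic2, cubic3, cubic4, cubic5]"

text \<open>The number of the normal form, read off from the left kernel, the right kernel, and
  how the form pairs them.\<close>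

definition form_class :: "('k::field^4 \<Rightarrow> 'k^4 \<Rightarrow> 'k) \<Rightarrow> nat" where
  "form_class \<beta> =
    (let R = (\<lambda>w. w \<noteq> 0 \<and> (\<forall>v. \<beta> v w = 0)); L = (\<lambda>l. l \<noteq> 0 \<and> (\<forall>v. \<beta> l v = 0)) in
     if \<not> (\<exists>w. R w) then 0
     else if \<not> (\<exists>w l. R w \<and> L l \<and> \<beta> w l \<noteq> 0)
       then (if \<exists>w l v. R w \<and> L l \<and> \<beta> v l = 0 \<and> \<beta> w v \<noteq> 0 then 2 else 1)
     else (if \<exists>w l. R w \<and> L l \<and> \<beta> w l = 0 then 4 else 3))"

lemma matrix_with_column:
  fixes v :: "'k::field^'n"
  assumes "v \<noteq> 0"
  obtains g s where "invertible (g :: 'k^'n^'n)" "column s g = v"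
proof -
  obtain s where s: "v $ s \<noteq> 0" using assms by (auto simp: vec_eq_iff)
  define g :: "'k^'n^'n" where "g = (\<chi> i j. if j = s then v $ i else if i = j then 1 else 0)"
  have col: "column s g = v" by (simp add: g_def column_def vec_eq_iff)
  have "invertible g"
  proof (rule invertibleI_ker)
    fix x assume x: "g *v x = 0"
    have gx: "(g *v x) $ i = v $ i * x $ s + (if i = s then 0 else x $ i)" for i
    proof -
      have "(g *v x) $ i = (\<Sum>j\<in>UNIV. (if j = s then v $ i * x $ s else 0) + (if j = i then (if i = s then 0 else x $ i) else 0))"
        unfolding matrix_vector_mult_def vec_lambda_beta by (intro sum.cong) (auto simp: g_def)
      then show ?thesis by (simp add: sum.distrib)
    qed
    then have "x $ s = 0" using s x gx[of s] by simp
    then have "x $ i = 0" for i using gx[of i] x by (cases "i = s") auto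
    then show "x = 0" by (simp add: vec_eq_iff)
  qed
  then show ?thesis using col that by blast
qed

context
  assumes char2: "CHAR('k::alg_closed_field) = 2"
begin

lemma square_sum_mpoly: "(\<Sum>i\<in>A. f i)\<^sup>2 = (\<Sum>i\<in>A. (f i)\<^sup>2)" for f :: "'i \<Rightarrow> ('n, 'k) mpoly"
  by (induction A rule: infinite_finite_induct) (simp_all add: char2_mpoly[OF char2])

text \<open>The square of a linear form is a sum of squares in characteristic two, so no squarefree
  monomial arises and the new coefficients are the pairings of the columns of g.\<close>

lemma lin_change_cform:
  "lin_change g (cform A) = cform (\<chi> r s. ff A (column r g) (column s g))" for A g :: "'k^'n^'n"
proof -
  have "lin_change g (cform A) = (\<Sum>i\<in>UNIV. \<Sum>j\<in>UNIV. Const (A $ i $ j) *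
      ((\<Sum>r\<in>UNIV. Const ((g $ i $ r)\<^sup>2) * (Var r)\<^sup>2) * (\<Sum>s\<in>UNIV. Const (g $ j $ s) * Var s)))"
    by (simp add: lin_change_def cform_def subst_simps square_sum_mpoly power_mult_distrib Const_power)
  also have "\<dots> = (\<Sum>i\<in>UNIV. \<Sum>j\<in>UNIV. \<Sum>r\<in>UNIV. \<Sum>s\<in>UNIV.
      Const ((g $ i $ r)\<^sup>2 * A $ i $ j * g $ j $ s) * ((Var r)\<^sup>2 * Var s))"
    by (simp add: sum_product sum_distrib_left Const_mult mult_ac)
  also have "\<dots> = (\<Sum>i\<in>UNIV. \<Sum>r\<in>UNIV. \<Sum>j\<in>UNIV. \<Sum>s\<in>UNIV.
      Const ((g $ i $ r)\<^sup>2 * A $ i $ j * g $ j $ s) * ((Var r)\<^sup>2 * Var s))"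
    by (intro sum.cong refl sum.swap)
  also have "\<dots> = (\<Sum>r\<in>UNIV. \<Sum>i\<in>UNIV. \<Sum>s\<in>UNIV. \<Sum>j\<in>UNIV.
      Const ((g $ i $ r)\<^sup>2 * A $ i $ j * g $ j $ s) * ((Var r)\<^sup>2 * Var s))"
    by (subst sum.swap) (intro sum.cong refl sum.swap)
  also have "\<dots> = (\<Sum>r\<in>UNIV. \<Sum>s\<in>UNIV. \<Sum>i\<in>UNIV. \<Sum>j\<in>UNIV.
      Const ((g $ i $ r)\<^sup>2 * A $ i $ j * g $ j $ s) * ((Var r)\<^sup>2 * Var s))"
    by (intro sum.cong refl sum.swap)
  also have "\<dots> = cform (\<chi> r s. ff A (column r g) (column s g))"
    by (simp add: cform_def ff_def column_def Const_sum sum_distrib_right)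
  finally show ?thesis .
qed

lemma ff_columns: "ff (\<chi> r s. ff A (column r g) (column s g)) v w = ff A (g *v v) (g *v w)"
  for A g :: "'k^'n^'n"
proof -
  interpret frob_form "ff A" using char2 by (rule frob_form_ff)
  have "ff A (g *v v) (g *v w) = (\<Sum>r\<in>UNIV. \<Sum>s\<in>UNIV. (v $ r)\<^sup>2 * (w $ s * ff A (column r g) (column s g)))"
    unfolding matrix_mult_sum[of g] sum_l unfolding sum_r by (simp add: expand sum_distrib_left mult.left_commute)
  then show ?thesis
    unfolding ff_def[of "\<chi> r s. ff A (column r g) (column s g)"] by (simp add: mult_ac)
qed

text \<open>Completing a common kernel vector to a basis gives coordinates in which the variable
  along it does not occur.\<close>

lemma nondegenerate_cform:
  fixes A :: "'k^'n^'n"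
  assumes nd: "nondegenerate (cform A)" and v: "\<And>w. ff A v w = 0" "\<And>w. ff A w v = 0"
  shows "v = 0"
proof (rule ccontr)
  assume "v \<noteq> 0"
  then obtain g :: "'k^'n^'n" and s where inv: "invertible g" and col: "column s g = v"
    by (rule matrix_with_column)
  let ?B = "\<chi> r s. ff A (column r g) (column s g)"
  have "s \<notin> vars (lin_change g (cform A))"
  proof
    assume "s \<in> vars (lin_change g (cform A))"
    then obtain m where m: "cf (cform ?B) m \<noteq> 0" "Poly_Mapping.lookup m s \<noteq> 0"
      by (auto simp: vars_def lin_change_cform in_keys_iff)
    then obtain i j where ij: "m = sqm i j" "?B $ i $ j \<noteq> 0" using lookup_cform_neq_0 by blast
    then have "s = i \<or> s = j" using m(2) by (auto simp: sqm_def lookup_add lookup_single when_def split: if_splits)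
    then show False using ij(2) v col by auto
  qed
  then have "vars (lin_change g (cform A)) \<subseteq> UNIV - {s}" by blast
  then have "card (vars (lin_change g (cform A))) \<le> card (UNIV - {s})" by (rule card_mono[rotated]) simp
  also have "\<dots> < CARD('n)" by (simp add: card_gt_0_iff)
  finally show False using nd inv by (auto simp: nondegenerate_def)
qed

lemma cubics_pattern: "i < 5 \<Longrightarrow> cubics ! i = (cform (pat (patterns ! i)) :: (4, 'k) mpoly)"
proof -
  note unf = cubics_def patterns_def cform_def pat_def sum_4 power3_eq_cube power2_eq_square
  have "cubics ! 0 = cform (pat (patterns ! 0) :: 'k^4^4)" by (simp add: unf cubic1_def)
  moreover have "cubics ! 1 = cform (pat (patterns ! 1) :: 'k^4^4)" by (simp add: unf cubic2_def)
  moreover have "cubics ! 2 = cform (pat (patterns ! 2) :: 'k^4^4)" by (simp add: unf cubic3_def)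
  moreover have "cubics ! 3 = cform (pat (patterns ! 3) :: 'k^4^4)" by (simp add: unf cubic4_def)
  moreover have "cubics ! 4 = cform (pat (patterns ! 4) :: 'k^4^4)" by (simp add: unf cubic5_def)
  moreover assume "i < 5"
  then have "i = 0 \<or> i = 1 \<or> i = 2 \<or> i = 3 \<or> i = 4" by linarith
  ultimately show ?thesis by auto
qed

lemma ff_pattern: "ff (pat (patterns ! 0)) v w = (v$1)\<^sup>2 * w$1 + (v$2)\<^sup>2 * w$2 + (v$3)\<^sup>2 * w$3 + (v$4)\<^sup>2 * w$4"
  "ff (pat (patterns ! 1)) v w = (v$1)\<^sup>2 * w$4 + (v$2)\<^sup>2 * w$2 + (v$3)\<^sup>2 * w$1"
  "ff (pat (patterns ! 2)) v w = (v$1)\<^sup>2 * w$4 + (v$2)\<^sup>2 * w$3 + (v$3)\<^sup>2 * w$1"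
  "ff (pat (patterns ! 3)) v w = (v$1)\<^sup>2 * w$4 + (v$2)\<^sup>2 * w$2 + (v$3)\<^sup>2 * w$3"
  "ff (pat (patterns ! 4)) v w = (v$1)\<^sup>2 * w$3 + (v$2)\<^sup>2 * w$4"
  by (simp_all add: ff_def pat_def patterns_def sum_4)

lemma lin_equiv_of_gram:
  fixes A :: "'k^4^4"
  assumes S: "S \<in> set patterns" and e: "\<And>i j. ff A (e i) (e j) = (if (i, j) \<in> S then 1 else 0)"
  shows "\<exists>i<5. lin_equiv (cform A) (cubics ! i)"
proof -
  interpret frob_form "ff A" using char2 by (rule frob_form_ff)
  have nd: "x = (\<lambda>_. 0)" if "\<And>i. (\<Sum>j\<in>UNIV. x j * ff A (e i) (e j)) = 0" "\<And>j. (\<Sum>i\<in>UNIV. (x i)\<^sup>2 * ff A (e i) (e j)) = 0" for x :: "4 \<Rightarrow> 'k"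
  proof -
    have "\<forall>i. x i = 0"
      using S that(1)[of 1] that(1)[of 2] that(1)[of 3] that(1)[of 4] that(2)[of 1] that(2)[of 2] that(2)[of 3] that(2)[of 4]
      unfolding forall_4 e sum_4 patterns_def by auto
    then show ?thesis by blast
  qed
  define g :: "'k^4^4" where "g = (\<chi> i j. e j $ i)"
  have col: "column j g = e j" for j by (simp add: g_def column_def vec_eq_iff)
  have "invertible g"
  proof (rule invertibleI_ker)
    fix x assume "g *v x = 0"
    then have sum0: "(\<Sum>j\<in>UNIV. x $ j *s e j) = 0" by (simp add: matrix_mult_sum col)
    have "(\<lambda>j. x $ j) = (\<lambda>_. 0)"
    proof (rule invertible_of_gram[of e])
      fix y :: "4 \<Rightarrow> 'k"
      assume "\<And>i. (\<Sum>j\<in>UNIV. y j * ff A (e i) (e j)) = 0" "\<And>j. (\<Sum>i\<in>UNIV. (y i)\<^sup>2 * ff A (e i) (e j)) = 0"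
      then show "y = (\<lambda>_. 0)" by (rule nd)
    qed (rule sum0)
    then show "x = 0" by (simp add: vec_eq_iff fun_eq_iff)
  qed
  moreover have "length patterns = 5" by (simp add: patterns_def)
  then obtain i where i: "i < 5" "S = patterns ! i" using S by (auto simp: in_set_conv_nth)
  moreover have "lin_change g (cform A) = cubics ! i"
    unfolding cubics_pattern[OF i(1)] lin_change_cform col e by (simp add: pat_def i(2))
  ultimately show ?thesis unfolding lin_equiv_def by blast
qed

text \<open>The class is expressed by quantifiers over vectors and by vanishing of vectors and
  pairings, all of which a linear bijection preserves.\<close>

lemma form_class_transport:
  assumes "invertible (g :: 'k^4^4)"
  shows "form_class (\<lambda>v w. \<beta> (g *v v) (g *v w)) = form_class \<beta>"
proof -
  have bij: "bij ((*v) g)" using assms by (simp add: invertible_eq_bij)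
  have surj: "\<exists>y. v = g *v y" for v using bij_is_surj[OF bij] by (auto simp: surj_def)
  have all: "(\<forall>v. P (g *v v)) \<longleftrightarrow> (\<forall>v. P v)" for P using surj by metis
  have ex1: "(\<exists>v. P (g *v v)) \<longleftrightarrow> (\<exists>v. P v)" for P using surj by metis
  have ex2: "(\<exists>v w. P (g *v v) (g *v w)) \<longleftrightarrow> (\<exists>v w. P v w)" for P
    using ex1[of "\<lambda>v. \<exists>w. P v w"] ex1[of "P (g *v _)"] by simp
  have ex3: "(\<exists>v w u. P (g *v v) (g *v w) (g *v u)) \<longleftrightarrow> (\<exists>v w u. P v w u)" for P
    using ex1[of "\<lambda>v. \<exists>w u. P v w u"] ex2[of "P (g *v _)"] by simp
  have nz: "v = 0 \<longleftrightarrow> g *v v = 0" for v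
    using bij_is_inj[OF bij] by (metis injD matrix_vector_mult_0_right)
  define R L where "R w \<longleftrightarrow> w \<noteq> 0 \<and> (\<forall>v. \<beta> v w = 0)" and "L l \<longleftrightarrow> l \<noteq> 0 \<and> (\<forall>v. \<beta> l v = 0)" for w l
  then have R_eq: "R = (\<lambda>w. w \<noteq> 0 \<and> (\<forall>v. \<beta> v w = 0))" and L_eq: "L = (\<lambda>l. l \<noteq> 0 \<and> (\<forall>v. \<beta> l v = 0))"
    by auto
  have R: "(w \<noteq> 0 \<and> (\<forall>v. \<beta> (g *v v) (g *v w) = 0)) = R (g *v w)"
    and L: "(w \<noteq> 0 \<and> (\<forall>v. \<beta> (g *v w) (g *v v) = 0)) = L (g *v w)" for w
    unfolding R_def L_def nz[of w] using all[of "\<lambda>v. \<beta> v (g *v w) = 0"] all[of "\<lambda>v. \<beta> (g *v w) v = 0"] by simp_all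
  show ?thesis
    unfolding form_class_def Let_def R L
    unfolding ex1[of R] ex2[of "\<lambda>w l. R w \<and> L l \<and> \<beta> w l \<noteq> 0"] ex2[of "\<lambda>w l. R w \<and> L l \<and> \<beta> w l = 0"]
      ex3[of "\<lambda>w l v. R w \<and> L l \<and> \<beta> v l = 0 \<and> \<beta> w v \<noteq> 0"]
    unfolding R_eq L_eq by (rule refl)
qed

lemma right_kernel_iff: "(\<forall>v. ff A v w = 0) \<longleftrightarrow> (\<forall>i. (\<Sum>j\<in>UNIV. A $ i $ j * w $ j) = 0)" for A :: "'k^'n^'n"
proof (intro iffI allI)
  fix i assume "\<forall>v. ff A v w = 0"
  then have "ff A (axis i 1) w = 0" by blast
  then show "(\<Sum>j\<in>UNIV. A $ i $ j * w $ j) = 0" by (simp add: ff_axis_left matrix_vector_mult_def)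
qed (simp add: ff_mult_right matrix_vector_mult_def)

lemma left_kernel_iff: "(\<forall>v. ff A l v = 0) \<longleftrightarrow> (\<forall>j. (\<Sum>i\<in>UNIV. (l $ i)\<^sup>2 * A $ i $ j) = 0)" for A :: "'k^'n^'n"
  using ff_axis_right[of A l] by (auto simp: ff_mult_left)

lemma kernel_pattern:
  fixes w :: "'k^4"
  shows "(\<forall>v. ff (pat (patterns ! 0)) v w = 0) \<longleftrightarrow> w = 0"
    "(\<forall>v. ff (pat (patterns ! 1)) v w = 0) \<longleftrightarrow> w$1 = 0 \<and> w$2 = 0 \<and> w$4 = 0"
    "(\<forall>v. ff (pat (patterns ! 2)) v w = 0) \<longleftrightarrow> w$1 = 0 \<and> w$3 = 0 \<and> w$4 = 0"
    "(\<forall>v. ff (pat (patterns ! 3)) v w = 0) \<longleftrightarrow> w$2 = 0 \<and> w$3 = 0 \<and> w$4 = 0"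
    "(\<forall>v. ff (pat (patterns ! 4)) v w = 0) \<longleftrightarrow> w$3 = 0 \<and> w$4 = 0"
    "(\<forall>v. ff (pat (patterns ! 1)) w v = 0) \<longleftrightarrow> w$1 = 0 \<and> w$2 = 0 \<and> w$3 = 0"
    "(\<forall>v. ff (pat (patterns ! 2)) w v = 0) \<longleftrightarrow> w$1 = 0 \<and> w$2 = 0 \<and> w$3 = 0"
    "(\<forall>v. ff (pat (patterns ! 3)) w v = 0) \<longleftrightarrow> w$1 = 0 \<and> w$2 = 0 \<and> w$3 = 0"
    "(\<forall>v. ff (pat (patterns ! 4)) w v = 0) \<longleftrightarrow> w$1 = 0 \<and> w$2 = 0"
  unfolding right_kernel_iff left_kernel_iff vec_eq_iff forall_4 sum_4
  by (simp_all add: pat_def patterns_def conj_ac)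

lemma form_class_pattern: "i < 5 \<Longrightarrow> form_class (ff (pat (patterns ! i) :: 'k^4^4)) = i"
proof -
  have ax: "axis i (1::'k) \<noteq> (0 :: 'k^4)" "axis i (1::'k) $ i = 1" "i \<noteq> j \<Longrightarrow> axis i (1::'k) $ j = 0" for i j :: 4
    by (simp_all add: axis_def vec_eq_iff)
  have "form_class (ff (pat (patterns ! 0) :: 'k^4^4)) = 0"
    unfolding form_class_def Let_def kernel_pattern unfolding ff_pattern by simp
  moreover have "form_class (ff (pat (patterns ! 1) :: 'k^4^4)) = 1"
  proof -
    have "\<exists>w :: 'k^4. w \<noteq> 0 \<and> w$1 = 0 \<and> w$2 = 0 \<and> w$4 = 0"
      by (rule exI[of _ "axis 3 1"]) (simp add: ax)
    moreover have "x = 0" if "x \<noteq> 0" "x$1 = 0 \<and> x$2 = 0 \<and> x$3 = 0" "x$4 = 0" for x :: "'k^4"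
      using that by (simp add: vec_eq_iff forall_4)
    ultimately show ?thesis unfolding form_class_def Let_def kernel_pattern unfolding ff_pattern by (simp, metis)
  qed
  moreover have "form_class (ff (pat (patterns ! 2) :: 'k^4^4)) = 2"
  proof -
    have "\<exists>w :: 'k^4. w \<noteq> 0 \<and> w$1 = 0 \<and> w$3 = 0 \<and> w$4 = 0"
      by (rule exI[of _ "axis 2 1"]) (simp add: ax)
    moreover define R L b where "R w \<longleftrightarrow> w \<noteq> 0 \<and> w$1 = 0 \<and> w$3 = 0 \<and> w$4 = 0"
      and "L l \<longleftrightarrow> l \<noteq> 0 \<and> l$1 = 0 \<and> l$2 = 0 \<and> l$3 = 0"
      and "b v w = (v$1)\<^sup>2 * w$4 + (v$2)\<^sup>2 * w$3 + (v$3)\<^sup>2 * w$1" for v w l :: "'k^4"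
    have "R (axis 2 1)" "L (axis 4 1)" "b (axis 3 1) (axis 4 1) = 0" "b (axis 2 1) (axis 3 1) \<noteq> 0"
      by (simp_all add: R_def L_def b_def ax)
    then have "\<exists>w l v. R w \<and> L l \<and> b v l = 0 \<and> b w v \<noteq> 0" by blast
    moreover have "\<not> (\<exists>w l. R w \<and> L l \<and> b w l \<noteq> 0)" by (auto simp: R_def L_def b_def)
    ultimately show ?thesis
      unfolding form_class_def Let_def kernel_pattern unfolding ff_pattern R_def L_def b_def by simp
  qed
  moreover have "form_class (ff (pat (patterns ! 3) :: 'k^4^4)) = 3"
  proof -
    have "\<exists>w :: 'k^4. w \<noteq> 0 \<and> w$2 = 0 \<and> w$3 = 0 \<and> w$4 = 0"
      by (rule exI[of _ "axis 1 1"]) (simp add: ax)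
    moreover have "\<exists>(w :: 'k^4) (l :: 'k^4). (w \<noteq> 0 \<and> w$2 = 0 \<and> w$3 = 0 \<and> w$4 = 0) \<and> (l \<noteq> 0 \<and> l$1 = 0 \<and> l$2 = 0 \<and> l$3 = 0) \<and>
        (w$1)\<^sup>2 * l$4 + (w$2)\<^sup>2 * l$2 + (w$3)\<^sup>2 * l$3 \<noteq> 0"
      by (rule exI[of _ "axis 1 1"], rule exI[of _ "axis 4 1"]) (simp add: ax)
    moreover have "\<not> (\<exists>(w :: 'k^4) (l :: 'k^4). (w \<noteq> 0 \<and> w$2 = 0 \<and> w$3 = 0 \<and> w$4 = 0) \<and> (l \<noteq> 0 \<and> l$1 = 0 \<and> l$2 = 0 \<and> l$3 = 0) \<and>
        (w$1)\<^sup>2 * l$4 + (w$2)\<^sup>2 * l$2 + (w$3)\<^sup>2 * l$3 = 0)"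
      by (auto simp: vec_eq_iff forall_4)
    ultimately show ?thesis unfolding form_class_def Let_def kernel_pattern unfolding ff_pattern by simp
  qed
  moreover have "form_class (ff (pat (patterns ! 4) :: 'k^4^4)) = 4"
  proof -
    have "\<exists>w :: 'k^4. w \<noteq> 0 \<and> w$3 = 0 \<and> w$4 = 0"
      by (rule exI[of _ "axis 1 1"]) (simp add: ax)
    moreover have "\<exists>(w :: 'k^4) (l :: 'k^4). (w \<noteq> 0 \<and> w$3 = 0 \<and> w$4 = 0) \<and> (l \<noteq> 0 \<and> l$1 = 0 \<and> l$2 = 0) \<and>
        (w$1)\<^sup>2 * l$3 + (w$2)\<^sup>2 * l$4 \<noteq> 0"
      by (rule exI[of _ "axis 1 1"], rule exI[of _ "axis 3 1"]) (simp add: ax)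
    moreover have "\<exists>(w :: 'k^4) (l :: 'k^4). (w \<noteq> 0 \<and> w$3 = 0 \<and> w$4 = 0) \<and> (l \<noteq> 0 \<and> l$1 = 0 \<and> l$2 = 0) \<and>
        (w$1)\<^sup>2 * l$3 + (w$2)\<^sup>2 * l$4 = 0"
      by (rule exI[of _ "axis 1 1"], rule exI[of _ "axis 4 1"]) (simp add: ax)
    ultimately show ?thesis unfolding form_class_def Let_def kernel_pattern unfolding ff_pattern by simp
  qed
  moreover assume "i < 5"
  then have "i = 0 \<or> i = 1 \<or> i = 2 \<or> i = 3 \<or> i = 4" by linarith
  ultimately show ?thesis by auto
qed

lemma cubics_inequivalent:
  assumes "i < 5" "j < 5" "lin_equiv (cubics ! i) (cubics ! j :: (4, 'k) mpoly)"
  shows "i = j"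
proof -
  obtain g :: "'k^4^4" where g: "invertible g" "lin_change g (cubics ! i) = cubics ! j"
    using assms(3) by (auto simp: lin_equiv_def)
  let ?A = "pat (patterns ! i) :: 'k^4^4"
  have "(\<chi> r s. ff ?A (column r g) (column s g)) = pat (patterns ! j)"
    using g(2) by (intro cform_inject) (simp add: cubics_pattern assms lin_change_cform)
  then have "ff (pat (patterns ! j)) = (\<lambda>v w. ff ?A (g *v v) (g *v w))"
    using ff_columns[of ?A g] by auto
  then have "form_class (ff (pat (patterns ! j) :: 'k^4^4)) = form_class (ff ?A)"
    using form_class_transport[OF g(1)] by simp
  then show ?thesis using form_class_pattern assms by simp
qed

lemma unique_cubic:
  fixes h :: "(4, 'k) mpoly"
  assumes h: "homogeneous 3 h" "nondegenerate h" and sq: "\<And>m. cf h m \<noteq> 0 \<Longrightarrow> \<exists>i. Poly_Mapping.lookup m i \<ge> 2"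
  shows "\<exists>!i. i < 5 \<and> lin_equiv h (cubics ! i)"
proof -
  obtain A where A: "h = cform A" using no_squarefree_cform[OF h(1) sq] by blast
  have "\<exists>S\<in>set patterns. \<exists>e. \<forall>i j. ff A (e i) (e j) = (if (i, j) \<in> S then 1 else 0)"
    using nondegenerate_cform h(2) unfolding A by (intro classify_frobenius_forms char2) blast
  then obtain i where "i < 5" "lin_equiv h (cubics ! i)"
    using lin_equiv_of_gram unfolding A by blast
  moreover have "i = j" if "j < 5" "lin_equiv h (cubics ! j)" for j
    using cubics_inequivalent \<open>i < 5\<close> \<open>lin_equiv h (cubics ! i)\<close> that lin_equiv_sym lin_equiv_trans by blast
  ultimately show ?thesis by blast
qed

end

section \<open>Integrality of the five surfaces, and regular sequences on them\<close>

subsection \<open>Primality by elimination\<close>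

lemma dvd_subst_diff:
  fixes h :: "('w, 'k::field) mpoly"
  assumes "\<And>i. h dvd \<sigma> i - \<tau> i"
  shows "h dvd subst \<sigma> f - subst \<tau> f"
proof (induction f rule: mpoly_induct)
  case (add f g)
  have "subst \<sigma> (f + g) - subst \<tau> (f + g) = (subst \<sigma> f - subst \<tau> f) + (subst \<sigma> g - subst \<tau> g)"
    by (simp add: subst_simps)
  then show ?case using add by simp
next
  case (mult f g)
  have "subst \<sigma> (f * g) - subst \<tau> (f * g) = (subst \<sigma> f - subst \<tau> f) * subst \<sigma> g + subst \<tau> f * (subst \<sigma> g - subst \<tau> g)"
    by (simp add: subst_simps algebra_simps)
  then show ?case using mult by simp
qed (simp_all add: assms)

lemma subst_scale:
  fixes f :: "('v::finite, 'k::field) mpoly"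
  assumes "homogeneous d f"
  shows "subst (\<lambda>i. c * Var i) f = c ^ d * f"
proof -
  have "subst (\<lambda>i. c * Var i) (mon m a) = c ^ mdeg m * mon m a" for m a
  proof -
    have "subst (\<lambda>i. c * Var i) (mon m a) = Const a * (\<Prod>i\<in>UNIV. (c * Var i) ^ Poly_Mapping.lookup m i)"
      by (rule subst_mono)
    also have "\<dots> = c ^ mdeg m * (Const a * (\<Prod>i\<in>UNIV. Var i ^ Poly_Mapping.lookup m i))"
      by (simp add: power_mult_distrib prod.distrib mdeg_def power_sum mult_ac)
    finally show ?thesis by (simp only: mono_conv)
  qed
  then have "subst (\<lambda>i. c * Var i) (\<Sum>m\<in>Poly_Mapping.keys f. mon m (cf f m)) =
      (\<Sum>m\<in>Poly_Mapping.keys f. c ^ d * mon m (cf f m))"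
    unfolding subst_sum using assms by (intro sum.cong) (auto simp: homogeneous_def)
  then show ?thesis
    by (simp flip: sum_distrib_left mpoly_sum_monos)
qed

lemma mpoly_eq_sum_hom_parts: "\<exists>N. f = (\<Sum>d<N + k. hom_part d f)"
proof -
  from mpoly_hom_parts[of f] obtain N where N: "\<forall>n\<ge>N. f = (\<Sum>d<n. hom_part d f)" ..
  show ?thesis by (rule exI[of _ N], rule N[THEN spec, THEN mp]) simp
qed

text \<open>Degree n goes to degree n * e, and e > 0 keeps different degrees apart, so components
  cannot cancel each other.\<close>

lemma graded_subst_zero:
  fixes \<sigma> :: "'v::finite \<Rightarrow> ('w::finite, 'k::field) mpoly"
  assumes "\<And>i. homogeneous e (\<sigma> i)" "e > 0" "subst \<sigma> f = 0"
  shows "subst \<sigma> (hom_part d f) = 0"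
proof -
  from mpoly_eq_sum_hom_parts[of f "Suc d"] obtain N where N: "f = (\<Sum>n<N + Suc d. hom_part n f)" ..
  have hom: "homogeneous (n * e) (subst \<sigma> (hom_part n f))" for n
    by (intro homogeneous_subst assms homogeneous_hom_part)
  have "0 = hom_part (d * e) (subst \<sigma> (\<Sum>n<N + Suc d. hom_part n f))"
    unfolding N[symmetric] assms(3) by simp
  also have "\<dots> = (\<Sum>n<N + Suc d. if n = d then subst \<sigma> (hom_part d f) else 0)"
    unfolding subst_sum hom_part_sum
    by (intro sum.cong) (use assms(2) in \<open>auto simp: hom_part_homogeneous[OF hom]\<close>)
  also have "\<dots> = subst \<sigma> (hom_part d f)" by (subst sum.delta) auto
  finally show ?thesis by simp
qed

text \<open>Modulo h the substitution \<sigma> scales every variable by c, so it sends a form f of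
  degree d to c^d * f. As c can be cancelled modulo h, the kernel is exactly (h), and the quotient
  embeds into a polynomial ring, an integral domain.\<close>

theorem prime_by_elimination:
  fixes h c :: "('v::{finite,linorder}, 'k::field) mpoly"
  assumes \<sigma>: "\<And>i. homogeneous e (\<sigma> i)" "e > 0" and h0: "subst \<sigma> h = 0"
    and cong: "\<And>i. h dvd c * Var i - \<sigma> i" and reg: "\<And>f. h dvd c * f \<Longrightarrow> h dvd f"
  shows "subst \<sigma> f = 0 \<longleftrightarrow> h dvd f" "homogeneous d f \<Longrightarrow> h dvd c ^ d * f - subst \<sigma> f"
    "primeideal (hypersurface h) poly_ring"
proof -
  have cg: "h dvd c ^ d * f - subst \<sigma> f" if "homogeneous d f" for d f
    using dvd_subst_diff[of h "\<lambda>i. c * Var i" \<sigma> f, OF cong] subst_scale[OF that] by simp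
  have pow: "h dvd f" if "h dvd c ^ d * f" for d f
    using that
  proof (induction d)
    case (Suc d)
    have "h dvd c * (c ^ d * f)" using Suc.prems by (simp only: power_Suc mult.assoc)
    then show ?case using Suc.IH reg by blast
  qed simp
  have ker: "h dvd f" if "subst \<sigma> f = 0" for f
  proof -
    have "h dvd hom_part d f" for d
    proof (rule pow)
      show "h dvd c ^ d * hom_part d f"
        using cg[OF homogeneous_hom_part[of d f]] unfolding graded_subst_zero[OF \<sigma> that] by simp
    qed
    then have dv: "h dvd (\<Sum>n<N. hom_part n f)" for N by (intro dvd_sum)
    from mpoly_eq_sum_hom_parts[of f 0] obtain N where N: "f = (\<Sum>n<N + 0. hom_part n f)" ..
    show ?thesis using dv[of "N + 0"] unfolding N[symmetric] .
  qed
  show iff: "subst \<sigma> f = 0 \<longleftrightarrow> h dvd f" for f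
    using ker h0 by (auto elim!: dvdE simp: subst_mult)
  show "homogeneous d f \<Longrightarrow> h dvd c ^ d * f - subst \<sigma> f" by (rule cg)
  show "primeideal (hypersurface h) poly_ring"
    unfolding primeideal_poly_ring_iff hypersurface_iff
    by (auto simp: ideal_hypersurface subst_mult simp flip: iff)
qed

definition kill :: "'v \<Rightarrow> ('v::finite, 'k::field) mpoly \<Rightarrow> ('v, 'k) mpoly" where
  "kill a = subst (\<lambda>i. if i = a then 0 else Var i)"

lemma kill_simps [simp]: "kill a (f + g) = kill a f + kill a g" "kill a (f * g) = kill a f * kill a g"
    "kill a (f ^ n) = kill a f ^ n" "kill a (Var i) = (if i = a then 0 else Var i)" "kill a (Const c) = Const c"
    "kill a 0 = 0" "kill a 1 = 1"
  by (simp_all add: kill_def subst_simps)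

lemma kill_diff: "Var a dvd f - kill a f"
proof -
  have "Var a dvd subst Var f - subst (\<lambda>i. if i = a then 0 else Var i) f"
    by (rule dvd_subst_diff) simp
  then show ?thesis by (simp add: kill_def)
qed

lemma kill_eq_0: "kill a f = 0 \<longleftrightarrow> Var a dvd f"
  using kill_diff[of a f] by (auto elim!: dvdE)

text \<open>If x_a f = h e, setting x_a to zero shows that x_a divides e, and x_a cancels.\<close>

lemma regular_Var:
  fixes h :: "('v::{finite,linorder}, 'k::field) mpoly"
  assumes "kill a h \<noteq> 0" "h dvd Var a * f"
  shows "h dvd f"
proof -
  obtain e where e: "Var a * f = h * e" using assms(2) by (elim dvdE)
  have "kill a h * kill a e = 0" using arg_cong[OF e, of "kill a"] by simp
  then have "Var a dvd e" using assms(1) by (simp add: kill_eq_0)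
  then obtain e' where "e = Var a * e'" by (elim dvdE)
  then have "Var a * f = Var a * (h * e')" using e by (simp add: mult.left_commute)
  then have "f = h * e'" by (simp del: mult.assoc)
  then show ?thesis by simp
qed

text \<open>Eliminates \<open>x\<^sub>j\<close> from a form that is linear in it: modulo \<open>h\<close>, \<open>x\<^sub>a\<^sup>2 x\<^sub>j\<close> is \<open>q\<close>.\<close>

definition elim_map :: "'v \<Rightarrow> 'v \<Rightarrow> ('v, 'k::field) mpoly \<Rightarrow> 'v \<Rightarrow> ('v, 'k) mpoly" where
  "elim_map a j q i = (if i = j then q else (Var a)\<^sup>2 * Var i)"

text \<open>Solving h = 0 for x_j parametrizes the surface by x_j = q / x_a^2; scaling all
  coordinates by x_a^2 makes the parametrization polynomial.\<close>

lemma elimination: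
  fixes h q :: "('v::{finite,linorder}, 'k::field) mpoly"
  assumes char2: "CHAR('k) = 2" and h: "h = (Var a)\<^sup>2 * Var j + q" and "a \<noteq> j"
    and q: "homogeneous 3 q" "kill j q = q" "kill a q \<noteq> 0"
  shows "subst (elim_map a j q) f = 0 \<longleftrightarrow> h dvd f"
    "homogeneous d f \<Longrightarrow> h dvd (Var a) ^ (2 * d) * f - subst (elim_map a j q) f"
    "primeideal (hypersurface h) poly_ring"
proof -
  have hom2: "homogeneous 2 ((Var a)\<^sup>2 :: ('v, 'k) mpoly)" using homogeneous_power[OF homogeneous_Var, of 2 a] by simp
  have 1: "homogeneous 3 (elim_map a j q i)" for i
    using homogeneous_mult[OF hom2 homogeneous_Var[of i]] q(1) by (simp add: elim_map_def)
  have neg: "- x = x" for x :: "('v, 'k) mpoly" by (rule char2_mpoly(2)[OF char2])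
  have "subst (elim_map a j q) q = subst (elim_map a j q) (kill j q)" using q(2) by simp
  also have "\<dots> = subst (\<lambda>i. (Var a)\<^sup>2 * Var i) (kill j q)"
    unfolding kill_def subst_subst by (rule arg_cong[of _ _ "\<lambda>s. subst s q"]) (auto simp: elim_map_def)
  also have "\<dots> = ((Var a)\<^sup>2) ^ 3 * q" unfolding q(2) by (rule subst_scale[OF q(1)])
  finally have \<theta>q: "subst (elim_map a j q) q = ((Var a)\<^sup>2) ^ 3 * q" .
  \<comment> \<open>The cubic q does not involve x_j, so it is multiplied by x_a^6; x_a^2 x_j
    becomes x_a^6 q as well, and the two cancel in characteristic two.\<close>
  have "subst (elim_map a j q) h = ((Var a)\<^sup>2) ^ 3 * q + ((Var a)\<^sup>2) ^ 3 * q"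
    using \<open>a \<noteq> j\<close> by (simp add: h subst_simps \<theta>q) (simp add: elim_map_def power2_eq_square eval_nat_numeral mult_ac)
  then have 2: "subst (elim_map a j q) h = 0" by (simp only: char2_mpoly(1)[OF char2])
  have 3: "h dvd (Var a)\<^sup>2 * Var i - elim_map a j q i" for i
  proof -
    have "(Var a)\<^sup>2 * Var j - q = h" by (simp only: h diff_conv_add_uminus neg)
    then show ?thesis by (simp add: elim_map_def)
  qed
  have "kill a h \<noteq> 0" using q(3) \<open>a \<noteq> j\<close> by (simp add: h)
  then have 4: "h dvd f" if "h dvd (Var a)\<^sup>2 * f" for f
  proof -
    have "h dvd Var a * (Var a * f)" using that by (simp only: power2_eq_square mult.assoc)
    then have "h dvd Var a * f" by (rule regular_Var[OF \<open>kill a h \<noteq> 0\<close>])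
    then show ?thesis by (rule regular_Var[OF \<open>kill a h \<noteq> 0\<close>])
  qed
  note main = prime_by_elimination[of 3, OF 1 _ 2 3 4]
  show "subst (elim_map a j q) f = 0 \<longleftrightarrow> h dvd f" by (rule main) simp
  show "homogeneous d f \<Longrightarrow> h dvd (Var a) ^ (2 * d) * f - subst (elim_map a j q) f"
    unfolding power_mult by (rule main) simp_all
  show "primeideal (hypersurface h) poly_ring" by (rule main) simp
qed

lemma hom3: "homogeneous 3 ((Var i)\<^sup>2 * Var j :: ('v::finite, 'k::field) mpoly)" "homogeneous 3 (Var j * (Var i)\<^sup>2 :: ('v::finite, 'k::field) mpoly)"
    "homogeneous 3 ((Var i) ^ 3 :: ('v::finite, 'k::field) mpoly)"
proof -
  have hom2: "homogeneous 2 ((Var i)\<^sup>2 :: ('v, 'k) mpoly)" using homogeneous_power[OF homogeneous_Var, of 2 i] by simp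
  show "homogeneous 3 ((Var i)\<^sup>2 * Var j :: ('v, 'k) mpoly)" "homogeneous 3 (Var j * (Var i)\<^sup>2 :: ('v, 'k) mpoly)"
    using homogeneous_mult[OF hom2 homogeneous_Var[of j]] by (simp_all add: mult.commute)
  show "homogeneous 3 ((Var i) ^ 3 :: ('v, 'k) mpoly)" using homogeneous_power[OF homogeneous_Var, of 3 i] by simp
qed

context
  assumes char2: "CHAR('k::alg_closed_field) = 2"
begin

lemma Var_cube_ne: "x2 ^ 3 + x3 ^ 3 \<noteq> (0 :: (4, 'k) mpoly)"
proof
  assume "x2 ^ 3 + x3 ^ 3 = (0 :: (4, 'k) mpoly)"
  then have "kill 3 (x2 ^ 3 + x3 ^ 3) = (0 :: (4, 'k) mpoly)" by simp
  then show False by simp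
qed

lemma elimination_cubics:
  "h = cubic2 \<Longrightarrow> q = x2 ^ 3 + x1 * x3\<^sup>2 \<Longrightarrow> h = (Var 1)\<^sup>2 * Var 4 + q \<and> homogeneous 3 q \<and> kill 4 q = q \<and> kill 1 q \<noteq> (0 :: (4, 'k) mpoly)"
  "h = cubic3 \<Longrightarrow> q = x2\<^sup>2 * x3 + x1 * x3\<^sup>2 \<Longrightarrow> h = (Var 1)\<^sup>2 * Var 4 + q \<and> homogeneous 3 q \<and> kill 4 q = q \<and> kill 1 q \<noteq> (0 :: (4, 'k) mpoly)"
  "h = cubic4 \<Longrightarrow> q = x2 ^ 3 + x3 ^ 3 \<Longrightarrow> h = (Var 1)\<^sup>2 * Var 4 + q \<and> homogeneous 3 q \<and> kill 4 q = q \<and> kill 1 q \<noteq> (0 :: (4, 'k) mpoly)"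
  "h = cubic5 \<Longrightarrow> q = x2\<^sup>2 * x4 \<Longrightarrow> h = (Var 1)\<^sup>2 * Var 3 + q \<and> homogeneous 3 q \<and> kill 3 q = q \<and> kill 1 q \<noteq> (0 :: (4, 'k) mpoly)"
  using Var_cube_ne
  by (auto simp: cubic2_def cubic3_def cubic4_def cubic5_def add_ac intro!: homogeneous_add hom3)

lemma prime_Q: "primeideal (hypersurface (x1\<^sup>2 * x2 + x3\<^sup>2 * x4 :: (4, 'k) mpoly)) poly_ring"
  by (rule elimination[OF char2 refl]) (simp_all add: hom3)

text \<open>The forms \<open>Q\<close> and \<open>E\<close> agree modulo \<open>Q + E\<close>; the substitution below parametrizes the cubic
  surface \<open>Q + E = 0\<close> by projecting from the lines \<open>x\<^sub>1 = x\<^sub>3 = 0\<close> and \<open>x\<^sub>2 = x\<^sub>4 = 0\<close>.\<close>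

lemma prime_smooth_cubic:
  defines "Q \<equiv> x1\<^sup>2 * x2 + x3\<^sup>2 * x4 :: (4, 'k) mpoly" and "E \<equiv> x1 * x2\<^sup>2 + x3 * x4\<^sup>2 :: (4, 'k) mpoly"
  shows "primeideal (hypersurface (Q + E)) poly_ring"
proof -
  have QE: "homogeneous 3 Q" "homogeneous 3 E" unfolding Q_def E_def by (intro homogeneous_add hom3)+
  have ch: "x + x = 0" "- x = x" for x :: "(4, 'k) mpoly" using char2_mpoly[OF char2] by blast+
  define \<sigma> where "\<sigma> i = (if i = 1 \<or> i = 3 then E * Var i else Q * Var i)" for i :: 4
  have 1: "homogeneous 4 (\<sigma> i)" for i
    using homogeneous_mult[OF QE(1) homogeneous_Var[of i]] homogeneous_mult[OF QE(2) homogeneous_Var[of i]]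
    by (simp add: \<sigma>_def)
  \<comment> \<open>Q is quadratic in x1, x3 and linear in x2, x4, and E the other way round; so
    both become E^2 Q^2.\<close>
  have "subst \<sigma> (Q + E) = E * E * Q * Q + E * E * Q * Q"
    unfolding Q_def E_def subst_simps subst_Var unfolding \<sigma>_def
    by (simp add: power2_eq_square, fold Q_def[unfolded power2_eq_square] E_def[unfolded power2_eq_square])
      (simp add: Q_def E_def power2_eq_square algebra_simps)
  then have 2: "subst \<sigma> (Q + E) = 0" by (simp only: ch)
  have 3: "Q + E dvd Q * Var i - \<sigma> i" for i
  proof -
    have "Q * Var i - E * Var i = (Q + E) * Var i" using ch(2)[of "E * Var i"] by (simp add: algebra_simps)
    then show ?thesis by (simp add: \<sigma>_def)
  qed
  have "\<not> Q dvd E"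
  proof
    assume "Q dvd E"
    \<comment> \<open>Restriction to the curve (1, t^2, t, 1), on which Q vanishes while E becomes
      t^4 + t.\<close>
    define \<tau> :: "4 \<Rightarrow> (4, 'k) mpoly" where "\<tau> i = (if i = 2 then (Var 1)\<^sup>2 else if i = 3 then Var 1 else 1)" for i
    have "subst \<tau> Q = (Var 1)\<^sup>2 + (Var 1)\<^sup>2" by (simp add: Q_def subst_simps \<tau>_def)
    then have "subst \<tau> Q = 0" by (simp only: ch)
    then have "subst \<tau> E = 0" using \<open>Q dvd E\<close> by (auto elim!: dvdE simp: subst_simps)
    then have "(Var 1) ^ 4 + (Var 1 :: (4, 'k) mpoly) = 0" by (simp add: E_def subst_simps \<tau>_def flip: power_mult)
    then have "(Var 1) ^ 4 = - (Var 1 :: (4, 'k) mpoly)" by (subst eq_neg_iff_add_eq_0)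
    then have eq: "(Var 1) ^ 4 = (Var 1 :: (4, 'k) mpoly)" by (simp only: ch(2))
    have "homogeneous (4 * Suc 0) ((Var 1) ^ 4 :: (4, 'k) mpoly)" by (intro homogeneous_power homogeneous_Var)
    then have "homogeneous 4 (Var 1 :: (4, 'k) mpoly)" unfolding eq by simp
    then show False using homogeneous_unique[OF homogeneous_Var[of 1]] by force
  qed
  then have nd: "\<not> Q dvd Q + E" by simp
  have "Q \<noteq> 0"
  proof
    assume "Q = 0"
    then have "kill 3 Q = 0" by simp
    then show False by (simp add: Q_def)
  qed
  \<comment> \<open>Q generates a prime ideal and does not divide Q + E, so it divides the cofactor
    and cancels.\<close>
  have 4: "Q + E dvd f" if dv: "Q + E dvd Q * f" for f
  proof -
    obtain e where e: "Q * f = (Q + E) * e" using dv by (elim dvdE)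
    then have "Q dvd (Q + E) * e" by (metis dvd_triv_left)
    then have "Q dvd e" using prime_Q nd unfolding Q_def[symmetric] primeideal_poly_ring_iff hypersurface_iff by blast
    then obtain e' where "e = Q * e'" by (elim dvdE)
    then have "Q * f = Q * ((Q + E) * e')" using e by (simp add: mult.left_commute)
    then have "f = (Q + E) * e'" using \<open>Q \<noteq> 0\<close> by (simp del: mult.assoc)
    then show ?thesis by simp
  qed
  show ?thesis by (rule prime_by_elimination[OF 1 _ 2 3 4]) simp
qed

lemma prime_lin_change:
  fixes f :: "('v::finite, 'k) mpoly"
  assumes "lin_equiv f f'" "primeideal (hypersurface f') poly_ring"
  shows "primeideal (hypersurface f) poly_ring"
proof -
  obtain g where g: "invertible g" "lin_change g f = f'" using assms(1) by (auto simp: lin_equiv_def)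
  obtain g' where g': "\<And>f. lin_change g' (lin_change g f) = f" using lin_change_inverse[OF g(1)] by blast
  have mult: "lin_change g (u * v) = lin_change g u * lin_change g v" "lin_change g' (u * v) = lin_change g' u * lin_change g' v"
    "lin_change g 1 = 1" "lin_change g' 1 = 1" for u v :: "('v, 'k) mpoly"
    by (simp_all add: lin_change_def subst_simps)
  have dv: "f dvd u \<longleftrightarrow> f' dvd lin_change g u" for u
  proof
    assume "f' dvd lin_change g u"
    then obtain e where e: "lin_change g u = lin_change g f * e" using g by (auto elim: dvdE)
    have "u = f * lin_change g' e" using arg_cong[OF e, of "lin_change g'"] by (simp add: mult g')
    then show "f dvd u" by simp
  qed (auto elim!: dvdE simp: mult g(2))
  show ?thesis
    using assms(2) unfolding primeideal_poly_ring_iff hypersurface_iff dv mult by (simp add: ideal_hypersurface)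
qed

lemma invertible_matrix_lin_equiv:
  assumes "invertible (A :: 'k^4^4)"
  shows "lin_equiv (cform A) cubic1"
proof -
  from orthonormal_basis[OF char2 assms]
  obtain e :: "4 \<Rightarrow> 'k^4" where e: "\<And>i j. ff A (e i) (e j) = (if i = j then 1 else 0)" by auto
  define g :: "'k^4^4" where "g = (\<chi> i j. e j $ i)"
  have col: "column j g = e j" for j by (simp add: g_def column_def vec_eq_iff)
  interpret frob_form "ff A" using char2 by (rule frob_form_ff)
  have "invertible g"
  proof (rule invertibleI_ker)
    fix x assume "g *v x = 0"
    then have "ff A (e i) (\<Sum>j\<in>UNIV. x $ j *s e j) = 0" for i by (simp add: matrix_mult_sum col)
    then have "x $ i = 0" for i by (simp add: sum_r expand e if_distrib cong: if_cong)
    then show "x = 0" by (simp add: vec_eq_iff)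
  qed
  moreover have "lin_change g (cform A) = cubics ! 0"
    unfolding cubics_pattern[OF char2, of 0, simplified] lin_change_cform[OF char2] col e
    by (rule arg_cong[of _ _ cform]) (auto simp: pat_def patterns_def vec_eq_iff forall_4)
  ultimately show ?thesis by (auto simp: lin_equiv_def cubics_def)
qed

lemma prime_cubics: "i < 5 \<Longrightarrow> primeideal (hypersurface (cubics ! i :: (4, 'k) mpoly)) poly_ring"
proof -
  \<comment> \<open>The matrix of the cubic Q + E is an involutive permutation matrix, so this cubic
    is equivalent to the Fermat cubic and primality carries over.\<close>
  let ?S = "{(1,2), (2,1), (3,4), (4,3)} :: (4 \<times> 4) set"
  have "pat ?S ** pat ?S = (mat 1 :: 'k^4^4)"
    by (simp add: matrix_matrix_mult_def pat_def mat_def vec_eq_iff forall_4 sum_4)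
  then have "lin_equiv (cform (pat ?S)) (cubic1 :: (4, 'k) mpoly)"
    by (intro invertible_matrix_lin_equiv) (auto simp: invertible_def)
  moreover have "cform (pat ?S) = (x1\<^sup>2 * x2 + x3\<^sup>2 * x4) + (x1 * x2\<^sup>2 + x3 * x4\<^sup>2 :: (4, 'k) mpoly)"
    by (simp add: cform_def pat_def sum_4 mult_ac add_ac)
  ultimately have "primeideal (hypersurface (cubic1 :: (4, 'k) mpoly)) poly_ring"
    using prime_smooth_cubic prime_lin_change lin_equiv_sym by metis
  moreover have "primeideal (hypersurface (cubic2 :: (4, 'k) mpoly)) poly_ring"
    "primeideal (hypersurface (cubic3 :: (4, 'k) mpoly)) poly_ring"
    "primeideal (hypersurface (cubic4 :: (4, 'k) mpoly)) poly_ring"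
    "primeideal (hypersurface (cubic5 :: (4, 'k) mpoly)) poly_ring"
    using elimination_cubics[OF refl refl] by (auto intro: elimination(3)[OF char2, of _ 1 4] elimination(3)[OF char2, of _ 1 3])
  moreover assume "i < 5"
  then have "i = 0 \<or> i = 1 \<or> i = 2 \<or> i = 3 \<or> i = 4" by linarith
  ultimately show ?thesis by (auto simp: cubics_def)
qed

end

subsection \<open>Regular sequences\<close>

lemma Var_power_dvd_iff:
  fixes f :: "('v::{finite,linorder}, 'k::field) mpoly"
  shows "Var p ^ N dvd f \<longleftrightarrow> (\<forall>m. cf f m \<noteq> 0 \<longrightarrow> N \<le> Poly_Mapping.lookup m p)"
proof
  assume "Var p ^ N dvd f"
  then obtain e where e: "f = mon (Poly_Mapping.single p N) 1 * e" by (auto simp: Var_power elim: dvdE)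
  show "\<forall>m. cf f m \<noteq> 0 \<longrightarrow> N \<le> Poly_Mapping.lookup m p"
  proof (intro allI impI)
    fix m assume "cf f m \<noteq> 0"
    then obtain m' where "m = Poly_Mapping.single p N + m'"
      using lookup_mono_mult_eq_0[of m "Poly_Mapping.single p N" 1 e] unfolding e by blast
    then show "N \<le> Poly_Mapping.lookup m p" by (simp add: lookup_add)
  qed
next
  assume *: "\<forall>m. cf f m \<noteq> 0 \<longrightarrow> N \<le> Poly_Mapping.lookup m p"
  have "Var p ^ N dvd mon m (cf f m)" if "m \<in> Poly_Mapping.keys f" for m
  proof -
    have "m = (m - Poly_Mapping.single p N) + Poly_Mapping.single p N"
      using * that by (intro poly_mapping_eqI) (auto simp: lookup_add lookup_minus lookup_single when_def in_keys_iff)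
    then have "mon m (cf f m) = mon (m - Poly_Mapping.single p N) (cf f m) * Var p ^ N"
      by (simp add: Var_power mult_single)
    then show ?thesis by simp
  qed
  then have "Var p ^ N dvd (\<Sum>m\<in>Poly_Mapping.keys f. mon m (cf f m))" by (intro dvd_sum)
  then show "Var p ^ N dvd f" using mpoly_sum_monos[of f] by simp
qed

lemma Var_power_coprime:
  fixes f :: "('v::{finite,linorder}, 'k::field) mpoly"
  assumes "p \<noteq> q" "Var p ^ N dvd Var q ^ M * f"
  shows "Var p ^ N dvd f"
  unfolding Var_power_dvd_iff
proof (intro allI impI)
  fix m assume "cf f m \<noteq> 0"
  then have "cf (Var q ^ M * f) (Poly_Mapping.single q M + m) \<noteq> 0"
    using lookup_mono_mult[of "Poly_Mapping.single q M" 1 f m] by (simp add: Var_power)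
  then have "N \<le> Poly_Mapping.lookup (Poly_Mapping.single q M + m) p"
    using assms(2) unfolding Var_power_dvd_iff by blast
  then show "N \<le> Poly_Mapping.lookup m p" using assms(1) by (simp add: lookup_add lookup_single)
qed

lemma lookup_le_mdeg: "Poly_Mapping.lookup m i \<le> mdeg m" for m :: "'v::finite \<Rightarrow>\<^sub>0 nat"
  unfolding mdeg_def by (rule member_le_sum) auto

text \<open>Reduce a syzygy modulo the monomial ideal \<open>(x\<^sub>p\<^sup>N, x\<^sub>q\<^sup>M)\<close>, in which a form that is monic in a
  third variable is a nonzerodivisor.\<close>

lemma regular_monic:
  fixes h :: "('v::{finite,linorder}, 'k::field) mpoly"
  assumes h: "homogeneous d h" and monic: "cf h (Poly_Mapping.single j d) \<noteq> 0"
    and neq: "p \<noteq> j" "q \<noteq> j" "p \<noteq> q"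
    and rel: "h dvd Var p ^ N * c - Var q ^ M * a"
  shows "\<exists>b. h dvd a - Var p ^ N * b"
proof -
  obtain e where e: "Var p ^ N * c - Var q ^ M * a = h * e" using rel by (elim dvdE)
  let ?in = "\<lambda>m. N \<le> Poly_Mapping.lookup m p \<or> M \<le> Poly_Mapping.lookup m q"
  \<comment> \<open>Splits e into a multiple of x_p^N, a multiple of x_q^M and a remainder e0 with
    no monomial in the ideal; the first two parts are absorbed into c and a.\<close>
  define part where "part T = (\<Sum>m\<in>{m \<in> Poly_Mapping.keys e. T m}. mon m (cf e m))" for T
  have lookup_part: "cf (part T) m = (if T m then cf e m else 0)" for T m
    by (auto simp: part_def lookup_sum lookup_single when_def in_keys_iff)
  define e1 where "e1 = part (\<lambda>m. N \<le> Poly_Mapping.lookup m p)"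
  define e2 where "e2 = part (\<lambda>m. \<not> N \<le> Poly_Mapping.lookup m p \<and> M \<le> Poly_Mapping.lookup m q)"
  define e0 where "e0 = part (\<lambda>m. \<not> ?in m)"
  have split: "e = e0 + e1 + e2"
    by (rule poly_mapping_eqI) (auto simp: e0_def e1_def e2_def lookup_add lookup_part)
  have "Var p ^ N dvd e1" "Var q ^ M dvd e2"
    unfolding Var_power_dvd_iff e1_def e2_def lookup_part by auto
  then obtain u v where uv: "e1 = Var p ^ N * u" "e2 = Var q ^ M * v" by (elim dvdE)
  have he0: "h * e0 = Var p ^ N * (c - h * u) - Var q ^ M * (a + h * v)"
    using e unfolding split uv by (simp add: algebra_simps)
  have van: "cf (h * e0) m = 0" if "\<not> ?in m" for m
  proof -
    have "Var p ^ N dvd Var p ^ N * (c - h * u)" "Var q ^ M dvd Var q ^ M * (a + h * v)" by simp_all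
    then have "cf (Var p ^ N * (c - h * u)) m = 0" "cf (Var q ^ M * (a + h * v)) m = 0"
      using that unfolding Var_power_dvd_iff by blast+
    then show ?thesis by (simp add: he0 lookup_minus)
  qed
  have "e0 = 0"
  proof (rule ccontr)
    assume "e0 \<noteq> 0"
    then have ne: "Poly_Mapping.keys e0 \<noteq> {}" by auto
    let ?J = "(\<lambda>m. Poly_Mapping.lookup m j) ` Poly_Mapping.keys e0"
    have "Max ?J \<in> ?J" using ne by (intro Max_in) auto
    then obtain \<mu> where \<mu>: "\<mu> \<in> Poly_Mapping.keys e0" "Poly_Mapping.lookup \<mu> j = Max ?J" by auto
    have max: "Poly_Mapping.lookup m j \<le> Poly_Mapping.lookup \<mu> j" if "cf e0 m \<noteq> 0" for m
      unfolding \<mu>(2) using that by (intro Max_ge) (auto simp: in_keys_iff)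
    have \<mu>0: "cf e0 \<mu> \<noteq> 0" using \<mu> by (simp add: in_keys_iff)
    let ?t = "Poly_Mapping.single j d"
    \<comment> \<open>Among the monomials of e0, \<mu> has the largest exponent at j, and x_j^d is
      the only monomial of h with exponent d there; if another monomial of e0 attains that largest
      exponent, it still gives a different product. So this coefficient cannot cancel, although its
      exponent lies outside the monomial ideal.\<close>
    have "cf (h * e0) (?t + \<mu>) = (\<Sum>a\<in>Poly_Mapping.keys h. \<Sum>b\<in>Poly_Mapping.keys e0. (if a = ?t then (if b = \<mu> then cf h a * cf e0 b else 0) else 0))"
      unfolding lookup_mult_eq
    proof (intro sum.cong refl)
      fix a b assume a: "a \<in> Poly_Mapping.keys h" and b: "b \<in> Poly_Mapping.keys e0"
      have "a = ?t \<and> b = \<mu>" if eq: "a + b = ?t + \<mu>"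
      proof -
        have "Poly_Mapping.lookup (a + b) j = Poly_Mapping.lookup (?t + \<mu>) j" by (simp only: eq)
        then have "Poly_Mapping.lookup a j + Poly_Mapping.lookup b j = d + Poly_Mapping.lookup \<mu> j"
          by (simp add: lookup_add)
        moreover have "Poly_Mapping.lookup b j \<le> Poly_Mapping.lookup \<mu> j" using b by (intro max) (simp add: in_keys_iff)
        moreover have da: "mdeg a = d" using h a by (simp add: homogeneous_def)
        ultimately have aj: "Poly_Mapping.lookup a j = d" using lookup_le_mdeg[of a j] by linarith
        have a_eq: "a = ?t + (a - ?t)"
          using aj by (intro poly_mapping_eqI) (auto simp: lookup_add lookup_minus lookup_single when_def)
        have "mdeg a = d + mdeg (a - ?t)" using arg_cong[OF a_eq, of mdeg] by (simp only: mdeg_simps)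
        then have "a - ?t = 0" using da by (simp only: mdeg_eq_0[symmetric])
        then have "a = ?t" using a_eq by (simp only: add_0_right)
        then show ?thesis using eq by simp
      qed
      then show "(cf h a * cf e0 b when a + b = ?t + \<mu>) = (if a = ?t then (if b = \<mu> then cf h a * cf e0 b else 0) else 0)"
        by (auto simp: when_def)
    qed
    also have "\<dots> = cf h ?t * cf e0 \<mu>"
    proof -
      have "(\<Sum>b\<in>Poly_Mapping.keys e0. (if a = ?t then (if b = \<mu> then cf h a * cf e0 b else 0) else 0)) =
          (if a = ?t then cf h a * cf e0 \<mu> else 0)" for a
        using \<mu>(1) by simp
      then show ?thesis using monic by (simp add: in_keys_iff)
    qed
    finally have "cf (h * e0) (?t + \<mu>) \<noteq> 0" using monic \<mu>0 by simp
    moreover have "\<not> ?in (?t + \<mu>)"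
      using \<mu>0 neq by (auto simp: e0_def lookup_part lookup_add lookup_single split: if_splits)
    ultimately show False using van by blast
  qed
  then have "Var q ^ M * (a + h * v) = Var p ^ N * (c - h * u)" using he0 by simp
  then have "Var p ^ N dvd a + h * v" using Var_power_coprime[OF neq(3)] by (metis dvd_triv_left)
  then obtain b where "a + h * v = Var p ^ N * b" by (elim dvdE)
  then have "a - Var p ^ N * b = h * (- v)" by (simp add: algebra_simps)
  then show ?thesis by (metis dvd_triv_left)
qed

section \<open>Non-splitting of the normal forms and the resulting equivalence\<close>

subsection \<open>The criterion for cubic surfaces\<close>

context
  assumes char2: "CHAR('k::alg_closed_field) = 2"
begin

text \<open>If all \<beta>(v, v) vanished, then c^2 \<beta>(v, w) + c \<beta>(w, v) = 0 for every c,
  and c = 1, \<omega> give \<beta> = 0. The vector found serves to make the cubic monic in a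
  suitable coordinate.\<close>

lemma anisotropic_vector:
  fixes A :: "'k^'n^'n"
  assumes "A \<noteq> 0"
  obtains v where "v \<noteq> 0" "ff A v v \<noteq> 0"
proof -
  interpret frob_form "ff A" using char2 by (rule frob_form_ff)
  have "\<exists>v. ff A v v \<noteq> 0"
  proof (rule ccontr)
    assume "\<nexists>v. ff A v v \<noteq> 0"
    then have iso: "ff A v v = 0" for v by blast
    obtain \<omega> :: 'k where \<omega>: "\<omega>\<^sup>2 + \<omega> + 1 = 0" using cube_root_of_unity by blast
    have "ff A v w = 0" for v w
    proof -
      have "c\<^sup>2 * ff A v w + c * ff A w v = 0" for c
        using iso[of "c *s v + w"] iso[of v] iso[of w] by (simp add: expand add_ac)
      from this[of 1] this[of \<omega>] have "ff A w v = - ff A v w" "\<omega>\<^sup>2 * ff A v w + \<omega> * ff A w v = 0"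
        by (simp_all add: eq_neg_iff_add_eq_0 add.commute)
      then have "(\<omega>\<^sup>2 + \<omega>) * ff A v w = 0"
        using char2_add_self(2)[OF char2_one[OF char2], of "ff A v w"] by (simp add: distrib_right)
      moreover have "\<omega>\<^sup>2 + \<omega> \<noteq> 0" using \<omega> by (metis add_0 zero_neq_one)
      ultimately show ?thesis by simp
    qed
    then have "A $ i $ j = 0" for i j
      using ff_axis_left[of A i "axis j 1"] by (simp add: matrix_vector_mult_def axis_def if_distrib cong: if_cong)
    then show False using assms by (simp add: vec_eq_iff)
  qed
  then show ?thesis using that zero by metis
qed

text \<open>In coordinates adapted to an anisotropic vector the cubic is monic in x_s, so powers of
  two other variables form a regular sequence modulo it; carried back, these variables serve as y1
  and y2.\<close>

lemma not_split_cform: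
  fixes A :: "'k^4^4"
  assumes "A \<noteq> 0" and prime: "primeideal (hypersurface (cform A)) poly_ring"
  shows "\<not> frobenius_split (hypersurface (cform A))"
proof -
  obtain v where v: "v \<noteq> 0" "ff A v v \<noteq> 0" by (rule anisotropic_vector[OF assms(1)])
  obtain g :: "'k^4^4" and s where g: "invertible g" "column s g = v" by (rule matrix_with_column[OF v(1)])
  have hg: "homogeneous 3 (lin_change g (cform A))"
    by (intro homogeneous_lin_change homogeneous_cform)
  have "sqm s s = Poly_Mapping.single s 3" by (simp add: sqm_def flip: single_add)
  then have monic: "cf (lin_change g (cform A)) (Poly_Mapping.single s 3) \<noteq> 0"
    using lookup_cform[of "\<chi> r s. ff A (column r g) (column s g)" s s] v(2) g(2) by (simp add: lin_change_cform[OF char2])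
  obtain p q :: 4 where pq: "p \<noteq> s" "q \<noteq> s" "p \<noteq> q"
    using exhaust_4[of s] by (metis neq_4)
  obtain g' where gg: "g ** g' = mat 1" "g' ** g = mat 1" using g(1) by (auto simp: invertible_def)
  have g': "lin_change g' (lin_change g f) = f" "lin_change g (lin_change g' f) = f" for f
    by (simp_all add: lin_change_comp gg)
  have hom: "lin_change h (a * b) = lin_change h a * lin_change h b" "lin_change h (a - b) = lin_change h a - lin_change h b"
    "lin_change h (a ^ n) = lin_change h a ^ n" for h :: "'k^4^4" and a b n
    by (simp_all add: lin_change_def subst_simps)
  have dv: "lin_change g h dvd u \<longleftrightarrow> h dvd lin_change g' u" for h u
  proof
    assume "lin_change g h dvd u"
    then show "h dvd lin_change g' u" by (auto elim!: dvdE simp: hom g')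
  next
    assume "h dvd lin_change g' u"
    then obtain e where "lin_change g' u = h * e" by (elim dvdE)
    then have "u = lin_change g h * lin_change g e" using g'(2)[of u] by (simp add: hom)
    then show "lin_change g h dvd u" by simp
  qed
  have y0: "lin_change g' (Var i) \<noteq> 0" for i
    using g'(2)[of "Var i"] by (auto simp: lin_change_def)
  show ?thesis
  proof (rule not_frobenius_split_of_no_squarefree[OF char2 homogeneous_cform _ _ homogeneous_linv[of A] prime])
    show "cform A \<noteq> 0"
    proof
      assume "cform A = 0"
      then have "A = 0" by (intro cform_inject) (simp add: cform_def)
      then show False using assms(1) by simp
    qed
    show "cform A = (\<Sum>i\<in>UNIV. (Var i)\<^sup>2 * linv A i)"
      by (simp add: cform_def sum_distrib_left mult_ac)
    show "homogeneous (Suc 0) (lin_change g' (Var p))" "homogeneous (Suc 0) (lin_change g' (Var q))"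
      by (intro homogeneous_lin_change homogeneous_Var)+
    show "lin_change g' (Var p) \<noteq> 0" "lin_change g' (Var q) \<noteq> 0" by (rule y0)+
    fix N M a c
    assume "lin_change g' (Var p) ^ N * c - lin_change g' (Var q) ^ M * a \<in> hypersurface (cform A)"
    then have "cform A dvd lin_change g' (Var p ^ N * lin_change g c - Var q ^ M * lin_change g a)"
      by (simp add: hypersurface_iff hom g')
    then have "lin_change g (cform A) dvd Var p ^ N * lin_change g c - Var q ^ M * lin_change g a"
      unfolding dv .
    then obtain b where "lin_change g (cform A) dvd lin_change g a - Var p ^ N * b"
      using regular_monic[OF hg monic pq] by blast
    then have "cform A dvd lin_change g' (lin_change g a - Var p ^ N * b)" unfolding dv .
    then show "\<exists>b. a - lin_change g' (Var p) ^ N * b \<in> hypersurface (cform A)"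
      by (intro exI[of _ "lin_change g' b"]) (simp add: hypersurface_iff hom g')
  qed
qed

lemma squarefree_split:
  fixes h :: "(4, 'k) mpoly"
  assumes "homogeneous 3 h" "\<not> frobenius_split (hypersurface h)" "cf h m \<noteq> 0"
  shows "\<exists>i. Poly_Mapping.lookup m i \<ge> 2"
proof (rule ccontr)
  assume "\<nexists>i. Poly_Mapping.lookup m i \<ge> 2"
  then have "Poly_Mapping.lookup m i \<le> 1" for i
    by (metis One_nat_def Suc_1 not_less_eq_eq)
  then have "frobenius_split (hypersurface h)"
    using assms(1,3) by (intro frobenius_split_of_squarefree[OF char2, of 3 h m]) simp_all
  then show False using assms(2) by blast
qed

lemma cubics_nonzero: "i < 5 \<Longrightarrow> pat (patterns ! i) \<noteq> (0 :: 'k^4^4)"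
proof -
  assume i: "i < 5"
  \<comment> \<open>All nonzero vectors lie in both kernels and nothing pairs nontrivially. This
    separates the zero form from every pattern but the second, which is settled by one
    entry.\<close>
  have "form_class (\<lambda>v w. 0 :: 'k) = 1" by (simp add: form_class_def) (metis axis_eq_0_iff zero_neq_one)
  moreover have "ff (0 :: 'k^4^4) = (\<lambda>v w. 0)" by (simp add: ff_def fun_eq_iff)
  ultimately have "i \<noteq> 1 \<Longrightarrow> ?thesis" using form_class_pattern[OF char2 i] by metis
  moreover have "pat (patterns ! 1) $ 1 $ 4 \<noteq> (0 :: 'k)" by (simp add: pat_def patterns_def)
  then have "i = 1 \<Longrightarrow> ?thesis" by (metis zero_index)
  ultimately show ?thesis by blast
qed

lemma not_split_of_lin_equiv:
  fixes h :: "(4, 'k) mpoly"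
  assumes "i < 5" "lin_equiv h (cubics ! i)"
  shows "\<not> frobenius_split (hypersurface h)"
proof -
  let ?A = "pat (patterns ! i) :: 'k^4^4"
  obtain g where g: "invertible g" "lin_change g (cform ?A) = h"
    using lin_equiv_sym[OF assms(2)] unfolding cubics_pattern[OF char2 assms(1)] lin_equiv_def by blast
  define B where "B = (\<chi> r s. ff ?A (column r g) (column s g))"
  have h: "h = cform B" using g(2) by (simp add: lin_change_cform[OF char2] B_def)
  have "B \<noteq> 0"
  proof
    assume "B = 0"
    then have "lin_change g (cform ?A) = 0" using g(2) h by (simp add: cform_def)
    moreover obtain g' where "\<And>f. lin_change g' (lin_change g f) = f" using lin_change_inverse[OF g(1)] by blast
    ultimately have "cform ?A = lin_change g' 0" by metis
    then have "cform ?A = cform 0" by (simp add: lin_change_def cform_def)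
    then show False using cform_inject cubics_nonzero[OF assms(1)] by blast
  qed
  moreover have "primeideal (hypersurface (cform B)) poly_ring"
    using prime_lin_change[OF char2 assms(2) prime_cubics[OF char2 assms(1)]] unfolding h .
  ultimately show ?thesis unfolding h by (rule not_split_cform)
qed

theorem split_criterion:
  fixes h :: "(4, 'k) mpoly"
  assumes "homogeneous 3 h" "nondegenerate h"
  shows "\<not> frobenius_split (hypersurface h) \<longleftrightarrow> (\<exists>!i. i < 5 \<and> lin_equiv h (cubics ! i))"
  using unique_cubic[OF char2 assms] squarefree_split[OF assms(1)] not_split_of_lin_equiv by blast

end

section \<open>Explicit points and singularities\<close>

subsection \<open>Points of projective space\<close>

text \<open>Supplies explicit points: the target of the substitution is an integral domain, which
  gives primality, and linear images give homogeneity.\<close>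

lemma prime_kernel:
  fixes \<sigma> :: "'v::finite \<Rightarrow> ('w::{finite,linorder}, 'k::field) mpoly"
  assumes "\<And>i. homogeneous (Suc 0) (\<sigma> i)"
  shows "primeideal {f. subst \<sigma> f = 0} poly_ring" "homogeneous_ideal {f. subst \<sigma> f = 0}"
proof -
  have id: "ideal {f. subst \<sigma> f = 0} poly_ring" by (auto simp: ideal_poly_ring_iff subst_simps)
  then show "primeideal {f. subst \<sigma> f = 0} poly_ring" by (auto simp: primeideal_poly_ring_iff subst_simps)
  show "homogeneous_ideal {f. subst \<sigma> f = 0}"
    using graded_subst_zero[OF assms] id by (auto simp: homogeneous_ideal_def)
qed

lemma kernel_in_proj_points:
  fixes \<sigma> :: "'v::finite \<Rightarrow> ('w::{finite,linorder}, 'k::field) mpoly"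
  assumes "\<And>i. homogeneous (Suc 0) (\<sigma> i)" "subst \<sigma> h = 0" "\<sigma> i \<noteq> 0"
  shows "{f. subst \<sigma> f = 0} \<in> proj_points (hypersurface h)"
  using prime_kernel[OF assms(1)] assms(2,3)
  by (auto simp: proj_points_def hypersurface_eq subst_mult intro!: exI[of _ i])

lemma partial_deriv_add: "partial_deriv i (f + g) = partial_deriv i f + partial_deriv i g"
  unfolding partial_deriv_def
  by (rule setsum_keys_plus_distrib) (simp_all add: distrib_left single_add)

lemma partial_deriv_mon: "partial_deriv i (mon m c) = mon (m - Poly_Mapping.single i 1) (of_nat (Poly_Mapping.lookup m i) * c)"
  by (cases "c = 0") (simp_all add: partial_deriv_def)

lemma partial_deriv_sum: "partial_deriv i (sum f A) = (\<Sum>a\<in>A. partial_deriv i (f a))"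
proof (induction A rule: infinite_finite_induct)
  case (insert a A)
  then show ?case by (simp add: partial_deriv_add)
qed (simp_all add: partial_deriv_def)

text \<open>Squares have derivative zero, so only the linear factor is differentiated; for i = j
  this agrees with 3 x_j^2 = x_j^2.\<close>

lemma partial_deriv_cform:
  fixes A :: "'k::field^'n^'n"
  assumes "CHAR('k) = 2"
  shows "partial_deriv j (cform A) = (\<Sum>i\<in>UNIV. Const (A $ i $ j) * (Var i)\<^sup>2)"
proof -
  have 2: "of_nat 2 = (0::'k)" using of_nat_CHAR[where 'a='k] assms by simp
  have "partial_deriv j (mon (sqm i b) c) = (if b = j then Const c * (Var i)\<^sup>2 else 0)" for i b and c :: 'k
  proof (cases "b = j")
    case True
    have "sqm i j - Poly_Mapping.single j 1 = Poly_Mapping.single i 2"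
      by (simp add: sqm_def)
    moreover have "of_nat (Poly_Mapping.lookup (sqm i j) j) = (1::'k)"
      using 2 by (simp add: sqm_def lookup_add lookup_single when_def)
    ultimately show ?thesis using True
      by (simp add: partial_deriv_mon Var_power Const_def mult_single)
  next
    case False
    have "of_nat (Poly_Mapping.lookup (sqm i b) j) = (0::'k)"
      using 2 False by (simp add: sqm_def lookup_add lookup_single when_def)
    then show ?thesis using False by (simp add: partial_deriv_mon)
  qed
  then show ?thesis by (simp add: cform_mono partial_deriv_sum)
qed

text \<open>The partial derivatives are read off the columns of A, applied to squares, so their
  common zeros are the left kernel. The cubic vanishes there too, being the sum of x_j times its
  j-th derivative.\<close>

lemma singular_kernel_point:
  fixes A :: "(('k::field, 'n::{finite,linorder}) vec, 'n) vec" and v :: "('k, 'n) vec" and s :: 'n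
  assumes char2: "CHAR('k) = 2" and v: "v $ i0 \<noteq> 0" "\<And>j. (\<Sum>i\<in>UNIV. (v $ i)\<^sup>2 * A $ i $ j) = 0"
  shows "{f. subst (\<lambda>i. Const (v $ i) * Var s) f = 0} \<in> singular_locus (cform A)"
proof -
  let ?\<sigma> = "\<lambda>i. Const (v $ i) * Var s :: ('n, 'k) mpoly"
  have col: "(\<Sum>i\<in>UNIV. Const (A $ i $ j) * (?\<sigma> i)\<^sup>2) = 0" for j
  proof -
    have "(\<Sum>i\<in>UNIV. Const (A $ i $ j) * (?\<sigma> i)\<^sup>2) = Const (\<Sum>i\<in>UNIV. (v $ i)\<^sup>2 * A $ i $ j) * (Var s)\<^sup>2"
      by (simp add: Const_sum Const_mult Const_power sum_distrib_left sum_distrib_right power_mult_distrib mult_ac)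
    then show ?thesis by (simp add: v)
  qed
  have "subst ?\<sigma> (cform A) = (\<Sum>i\<in>UNIV. \<Sum>j\<in>UNIV. Const (A $ i $ j) * (?\<sigma> i)\<^sup>2 * ?\<sigma> j)"
    by (simp add: cform_def subst_simps mult.assoc)
  also have "\<dots> = (\<Sum>j\<in>UNIV. (\<Sum>i\<in>UNIV. Const (A $ i $ j) * (?\<sigma> i)\<^sup>2) * ?\<sigma> j)"
    by (subst sum.swap) (simp add: sum_distrib_right)
  finally have "subst ?\<sigma> (cform A) = 0" by (simp only: col) simp
  then have "{f. subst ?\<sigma> f = 0} \<in> proj_points (hypersurface (cform A))"
    using v(1) by (intro kernel_in_proj_points[of _ _ i0] homogeneous_Const_mult homogeneous_Var) auto
  moreover have "subst ?\<sigma> (partial_deriv j (cform A)) = 0" for j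
    using col[of j] by (simp add: partial_deriv_cform[OF char2] subst_simps)
  ultimately show ?thesis by (simp add: singular_locus_def smooth_at_def)
qed

section \<open>Normality: integral closedness of polynomial, coordinate and local rings\<close>

subsection \<open>Polynomial rings are integrally closed\<close>

definition lm :: "('v::{finite,linorder}, 'k::field) mpoly \<Rightarrow> ('v \<Rightarrow>\<^sub>0 nat)" where
  "lm f = Max (Poly_Mapping.keys f)"

lemma lm_in: "f \<noteq> 0 \<Longrightarrow> cf f (lm f) \<noteq> 0"
  using Max_in[of "Poly_Mapping.keys f"] by (auto simp: lm_def in_keys_iff)

lemma lm_ge: "cf f m \<noteq> 0 \<Longrightarrow> m \<le> lm f"
  unfolding lm_def by (intro Max_ge) (auto simp: in_keys_iff)

lemma lookup_lm_mult:
  assumes "f \<noteq> 0" "g \<noteq> 0"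
  shows "cf (f * g) (lm f + lm g) = cf f (lm f) * cf g (lm g)"
proof -
  have "cf (f * g) (lm f + lm g) = (\<Sum>a\<in>Poly_Mapping.keys f. \<Sum>b\<in>Poly_Mapping.keys g.
      (if b = lm g then (if a = lm f then cf f a * cf g (lm g) else 0) else 0))"
    unfolding lookup_mult_eq
  proof (intro sum.cong refl)
    fix a b assume "a \<in> Poly_Mapping.keys f" "b \<in> Poly_Mapping.keys g"
    then have le: "a \<le> lm f" "b \<le> lm g" by (auto intro: lm_ge simp: in_keys_iff)
    have "a = lm f \<and> b = lm g" if eq: "a + b = lm f + lm g"
    proof -
      have "\<not> a < lm f" using add_less_le_mono[of a "lm f" b "lm g"] le(2) eq by auto
      then have "a = lm f" using le(1) by simp
      then show ?thesis using eq by simp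
    qed
    then show "(cf f a * cf g b when a + b = lm f + lm g) =
        (if b = lm g then (if a = lm f then cf f a * cf g (lm g) else 0) else 0)"
      by (auto simp: when_def)
  qed
  also have "\<dots> = cf f (lm f) * cf g (lm g)"
    using lm_in[OF assms(1)] lm_in[OF assms(2)] by (simp add: in_keys_iff)
  finally show ?thesis .
qed

lemma lm_mult:
  assumes "f \<noteq> 0" "g \<noteq> 0"
  shows "lm (f * g) = lm f + lm g"
proof (rule antisym)
  show "lm f + lm g \<le> lm (f * g)"
    using lookup_lm_mult[OF assms] lm_in[OF assms(1)] lm_in[OF assms(2)] by (intro lm_ge) simp
  have "lm (f * g) \<in> Poly_Mapping.keys (f * g)"
    using assms lm_in[of "f * g"] by (simp add: in_keys_iff)
  then obtain a b where "lm (f * g) = a + b" "a \<in> Poly_Mapping.keys f" "b \<in> Poly_Mapping.keys g"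
    using keys_mult[of f g] by blast
  then show "lm (f * g) \<le> lm f + lm g"
    by (auto simp: in_keys_iff intro!: add_mono lm_ge)
qed

lemma lookup_lm_power: "f \<noteq> 0 \<Longrightarrow> Poly_Mapping.lookup (lm (f ^ k)) i = k * Poly_Mapping.lookup (lm f) i"
proof (induction k)
  case 0
  show ?case by (simp add: lm_def)
next
  case (Suc k)
  then show ?case by (simp add: lm_mult lookup_add)
qed

text \<open>Almost integral fractions \<open>a / b\<close> are stable under subtracting polynomials, so division
  with remainder by leading monomials cannot get stuck.\<close>

lemma almost_integral_shift:
  fixes a b c m :: "'a::comm_ring_1"
  assumes "\<And>k. b ^ k dvd c * a ^ k"
  shows "b ^ (j + k) dvd c * a ^ j * (a - m * b) ^ k"
proof (induction k arbitrary: j)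
  case 0
  then show ?case using assms by simp
next
  case (Suc k)
  have eq: "c * a ^ j * (a - m * b) ^ Suc k = c * a ^ Suc j * (a - m * b) ^ k - m * (b * (c * a ^ j * (a - m * b) ^ k))"
    by (simp add: algebra_simps)
  have "b ^ (j + Suc k) dvd c * a ^ Suc j * (a - m * b) ^ k" using Suc[of "Suc j"] by simp
  moreover have "b ^ (j + Suc k) dvd b * (c * a ^ j * (a - m * b) ^ k)" using Suc[of j] by (simp add: mult_dvd_mono)
  ultimately show ?case unfolding eq by (rule dvd_diff[OF _ dvd_mult])
qed

lemma almost_integral_dvd:
  fixes a b c :: "('v::{finite,linorder}, 'k::field) mpoly"
  assumes b: "b \<noteq> 0" "homogeneous e b" and c: "c \<noteq> 0"
    and a: "homogeneous d a" "\<And>k. b ^ k dvd c * a ^ k"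
  shows "b dvd a"
  using a
\<comment> \<open>Only finitely many exponents have degree d, so counting those up to
  \<open>lm a\<close> gives a terminating measure.\<close>
proof (induction "card {m. mdeg m = d \<and> m \<le> lm a}" arbitrary: a rule: less_induct)
  case less
  show ?case
  proof (cases "a = 0")
    case False
    have le: "Poly_Mapping.lookup (lm b) i \<le> Poly_Mapping.lookup (lm a) i" for i
    proof (rule ccontr)
      assume "\<not> Poly_Mapping.lookup (lm b) i \<le> Poly_Mapping.lookup (lm a) i"
      then have gt: "Suc (Poly_Mapping.lookup (lm a) i) \<le> Poly_Mapping.lookup (lm b) i" by simp
      \<comment> \<open>In c * a^k = b^k * e the right side exceeds k times the exponent of a at i
        by at least k, while c contributes only its own exponent at i; k is one more than
        that.\<close>
      define k where "k = Suc (Poly_Mapping.lookup (lm c) i)"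
      obtain e where e: "c * a ^ k = b ^ k * e" using less.prems(2)[of k] by (elim dvdE)
      have "e \<noteq> 0" using e False c by auto
      have "Poly_Mapping.lookup (lm (c * a ^ k)) i = Poly_Mapping.lookup (lm (b ^ k * e)) i" by (simp only: e)
      then have "Poly_Mapping.lookup (lm c) i + k * Poly_Mapping.lookup (lm a) i = k * Poly_Mapping.lookup (lm b) i + Poly_Mapping.lookup (lm e) i"
        using False c b(1) \<open>e \<noteq> 0\<close> by (simp add: lm_mult lookup_add lookup_lm_power)
      moreover have "k * Suc (Poly_Mapping.lookup (lm a) i) \<le> k * Poly_Mapping.lookup (lm b) i"
        using gt by (rule mult_le_mono2)
      ultimately show False by (simp add: k_def)
    qed
    define t where "t = lm a - lm b"
    have t: "lm a = t + lm b"
      using le by (intro poly_mapping_eqI) (simp add: t_def lookup_add lookup_minus)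
    define r where "r = cf a (lm a) / cf b (lm b)"
    define a' where "a' = a - mon t r * b"
    have "mdeg (lm a) = d" "mdeg (lm b) = e"
      using homogeneousD[OF less.prems(1) lm_in[OF False]] homogeneousD[OF b(2) lm_in[OF b(1)]] by auto
    then have "homogeneous d (mon t r * b)"
      using homogeneous_mult[OF homogeneous_mono[of r t "mdeg t"] b(2)] arg_cong[OF t, of mdeg] by simp
    then have a'_hom: "homogeneous d a'" unfolding a'_def using less.prems(1) by (intro homogeneous_diff)
    have a'_int: "b ^ k dvd c * a' ^ k" for k
      using almost_integral_shift[of b c a 0 k "mon t r"] less.prems(2) by (simp add: a'_def)
    have a'_lm: "cf a' (lm a) = 0"
      using lookup_mono_mult[of t r b "lm b"] lm_in[OF b(1)] by (simp add: a'_def lookup_minus t[symmetric] r_def)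
    have "b dvd a'"
    proof (cases "a' = 0")
      case False
      have "lm a' \<le> lm a"
      proof (cases "cf a (lm a') = 0")
        case True
        then have "cf (mon t r * b) (lm a') \<noteq> 0" using lm_in[OF False] by (simp add: a'_def lookup_minus)
        then obtain m where m: "lm a' = t + m" using lookup_mono_mult_eq_0[of "lm a'" t r b] by blast
        then have "cf b m \<noteq> 0" using \<open>cf (mon t r * b) (lm a') \<noteq> 0\<close> by (auto simp: lookup_mono_mult)
        then show ?thesis unfolding m t by (intro add_left_mono lm_ge)
      qed (rule lm_ge)
      moreover have "lm a' \<noteq> lm a" using lm_in[OF False] a'_lm by metis
      ultimately have lt: "lm a' < lm a" by simp
      have "lm a \<in> {m. mdeg m = d \<and> m \<le> lm a}" "lm a \<notin> {m. mdeg m = d \<and> m \<le> lm a'}"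
        using lt \<open>mdeg (lm a) = d\<close> by simp_all
      moreover have "{m. mdeg m = d \<and> m \<le> lm a'} \<subseteq> {m. mdeg m = d \<and> m \<le> lm a}"
        using lt by (auto intro: order.trans)
      ultimately have "{m. mdeg m = d \<and> m \<le> lm a'} \<subset> {m. mdeg m = d \<and> m \<le> lm a}" by blast
      then have "card {m. mdeg m = d \<and> m \<le> lm a'} < card {m. mdeg m = d \<and> m \<le> lm a}"
        by (rule psubset_card_mono[rotated]) (rule finite_subset[OF _ finite_mdeg[of d]], auto)
      then show ?thesis using a'_hom a'_int by (rule less.hyps)
    qed simp
    then have "b dvd a' + mon t r * b" by (intro dvd_add) simp_all
    then show ?thesis by (simp add: a'_def)
  qed simp
qed

text \<open>The equation replaces a^n by lower powers of a, each accompanied by the missing power of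
  b; so b^n is a common denominator for all powers of a / b.\<close>

lemma integral_imp_almost_integral:
  fixes a b :: "'a::comm_ring_1"
  assumes "a ^ n + (\<Sum>i<n. c i * a ^ i * b ^ (n - i)) = 0"
  shows "b ^ k dvd b ^ n * a ^ k"
proof (induction k rule: less_induct)
  case (less k)
  show ?case
  proof (cases "k \<le> n")
    case True
    then show ?thesis by (intro dvd_mult2 le_imp_power_dvd)
  next
    case False
    define l where "l = k - n"
    have k: "k = l + n" using False by (simp add: l_def)
    have "a ^ n = - (\<Sum>i<n. c i * a ^ i * b ^ (n - i))" using assms by (simp add: eq_neg_iff_add_eq_0)
    then have eq: "b ^ n * a ^ k = - (\<Sum>i<n. c i * (b ^ (n - i) * (b ^ n * a ^ (l + i))))"
      by (simp add: k power_add sum_distrib_left mult_ac)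
    have dv: "b ^ k dvd c i * (b ^ (n - i) * (b ^ n * a ^ (l + i)))" if "i < n" for i
    proof (rule dvd_mult)
      have "b ^ (n - i) * b ^ (l + i) dvd b ^ (n - i) * (b ^ n * a ^ (l + i))"
        using that by (intro mult_dvd_mono dvd_refl less.IH) (simp add: k)
      moreover have "b ^ (n - i) * b ^ (l + i) = b ^ k" using that by (simp add: k add.commute flip: power_add)
      ultimately show "b ^ k dvd b ^ (n - i) * (b ^ n * a ^ (l + i))" by simp
    qed
    show ?thesis unfolding eq dvd_minus_iff by (rule dvd_sum, rule dv) simp
  qed
qed

subsection \<open>Integral closedness of homogeneous coordinate rings\<close>

text \<open>The fraction \<open>y / d\<close> is integral over the quotient by \<open>h\<close>.\<close>

definition integral_mod :: "('v, 'k::field) mpoly \<Rightarrow> ('v, 'k) mpoly \<Rightarrow> ('v, 'k) mpoly \<Rightarrow> bool" where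
  "integral_mod h y d \<longleftrightarrow> (\<exists>n c. n > 0 \<and> h dvd y ^ n + (\<Sum>i<n. c i * y ^ i * d ^ (n - i)))"

text \<open>Where h and d vanish, the integral equation degenerates to y^n = 0 with n > 0.\<close>

lemma integral_mod_subst:
  fixes \<tau> :: "'v::finite \<Rightarrow> ('w::{finite,linorder}, 'k::field) mpoly"
  assumes "integral_mod h y d" "subst \<tau> h = 0" "subst \<tau> d = 0"
  shows "subst \<tau> y = 0"
proof -
  obtain n c where n: "n > 0" "h dvd y ^ n + (\<Sum>i<n. c i * y ^ i * d ^ (n - i))"
    using assms(1) by (auto simp: integral_mod_def)
  then obtain e where "y ^ n + (\<Sum>i<n. c i * y ^ i * d ^ (n - i)) = h * e" by (elim dvdE)
  then have "subst \<tau> (y ^ n + (\<Sum>i<n. c i * y ^ i * d ^ (n - i))) = 0" using assms(2) by (simp add: subst_mult)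
  moreover have "(\<Sum>i<n. subst \<tau> (c i) * subst \<tau> y ^ i * 0 ^ (n - i)) = 0"
    by (rule sum.neutral) simp
  ultimately show ?thesis using n(1) assms(3) by (simp add: subst_simps)
qed

lemma dvd_power_diff: "h dvd u - v \<Longrightarrow> h dvd u ^ i - v ^ i" for h u v :: "'a::comm_ring_1"
proof (induction i)
  case (Suc i)
  have "u ^ Suc i - v ^ Suc i = u * (u ^ i - v ^ i) + (u - v) * v ^ i" by (simp add: algebra_simps)
  then show ?case using Suc by simp
qed simp

text \<open>y / d and y' / d' are the same fraction. The equation is rewritten over the denominator
  d * d', where the numerators y * d' and y' * d are congruent.\<close>

lemma integral_mod_change:
  fixes h :: "('v::finite, 'k::field) mpoly"
  assumes int: "integral_mod h y d" and rel: "h dvd y * d' - y' * d"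
    and prime: "primeideal (hypersurface h) poly_ring" and d: "\<not> h dvd d"
  shows "integral_mod h y' d'"
proof -
  obtain n c where n: "n > 0" "h dvd y ^ n + (\<Sum>i<n. c i * y ^ i * d ^ (n - i))"
    using int by (auto simp: integral_mod_def)
  let ?Y = "\<lambda>u. u ^ n + (\<Sum>i<n. c i * u ^ i * (d * d') ^ (n - i))"
  have Y: "?Y (x * z) = z ^ n * (x ^ n + (\<Sum>i<n. c i * x ^ i * w ^ (n - i)))" if "z * w = d * d'" for x z w
  proof -
    have "c i * (x * z) ^ i * (d * d') ^ (n - i) = z ^ n * (c i * x ^ i * w ^ (n - i))" if "i < n" for i
    proof -
      have "z ^ n = z ^ i * z ^ (n - i)" using that by (simp flip: power_add)
      then show ?thesis by (simp add: power_mult_distrib mult_ac flip: \<open>z * w = d * d'\<close>)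
    qed
    then show ?thesis by (simp add: distrib_left sum_distrib_left power_mult_distrib mult.commute[of "x ^ n"])
  qed
  have "?Y (y * d') - ?Y (y' * d) = ((y * d') ^ n - (y' * d) ^ n) + (\<Sum>i<n. c i * (d * d') ^ (n - i) * ((y * d') ^ i - (y' * d) ^ i))"
    by (simp add: algebra_simps sum_subtractf)
  also have "h dvd \<dots>" by (intro dvd_add dvd_sum dvd_mult dvd_power_diff rel)
  finally have "h dvd ?Y (y * d') - ?Y (y' * d)" .
  moreover have "h dvd ?Y (y * d')" using n(2) Y[of d' d y] by (simp add: mult.commute[of d'])
  ultimately have "h dvd ?Y (y' * d)" using dvd_diff[of h "?Y (y * d')" "?Y (y * d') - ?Y (y' * d)"] by simp
  then have "h dvd d ^ n * (y' ^ n + (\<Sum>i<n. c i * y' ^ i * d' ^ (n - i)))" using Y[of d d' y'] by simp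
  then have "h dvd y' ^ n + (\<Sum>i<n. c i * y' ^ i * d' ^ (n - i))"
  proof -
    have "d ^ n \<notin> hypersurface h" using prime_power[OF prime, of d n] d by (auto simp: hypersurface_iff)
    with \<open>h dvd d ^ n * _\<close> show ?thesis
      using prime[unfolded primeideal_poly_ring_iff, THEN conjunct2, THEN conjunct2, rule_format, of "d ^ n"]
      unfolding hypersurface_iff by blast
  qed
  then show ?thesis using n(1) by (auto simp: integral_mod_def)
qed

text \<open>w / d is d^N times the integral fraction.\<close>

lemma integral_mod_power:
  assumes "integral_mod h w (d ^ Suc N)"
  shows "integral_mod h w d"
proof -
  obtain n c where n: "n > 0" "h dvd w ^ n + (\<Sum>i<n. c i * w ^ i * (d ^ Suc N) ^ (n - i))"
    using assms by (auto simp: integral_mod_def)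
  have "(\<Sum>i<n. c i * w ^ i * (d ^ Suc N) ^ (n - i)) = (\<Sum>i<n. (c i * d ^ (N * (n - i))) * w ^ i * d ^ (n - i))"
    by (intro sum.cong refl) (simp add: power_mult_distrib power_mult mult_ac)
  then show ?thesis using n unfolding integral_mod_def by (intro exI[of _ n] exI[of _ "\<lambda>i. c i * d ^ (N * (n - i))"]) simp
qed

lemma integrally_closed_mod:
  fixes h q :: "('v::{finite,linorder}, 'k::field) mpoly"
  assumes char2: "CHAR('k) = 2" and h: "h = (Var a)\<^sup>2 * Var j + q" "a \<noteq> j"
    and q: "homogeneous 3 q" "kill j q = q" "kill a q \<noteq> 0"
    and descent: "\<And>w. integral_mod h w (Var a) \<Longrightarrow> \<exists>u. h dvd w - Var a * u"
    and yb: "homogeneous d y" "homogeneous e b" "\<not> h dvd b" "integral_mod h y b"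
  shows "\<exists>w. h dvd y - b * w"
proof -
  note el = elimination[OF char2 h q]
  let ?\<theta> = "subst (elim_map a j q)"
  have hom2: "homogeneous 2 ((Var a)\<^sup>2 :: ('v, 'k) mpoly)" using homogeneous_power[OF homogeneous_Var, of 2 a] by simp
  have hom: "homogeneous 3 (elim_map a j q i)" for i
    using homogeneous_mult[OF hom2 homogeneous_Var[of i]] q(1) by (simp add: elim_map_def)
  obtain n c where n: "n > 0" "h dvd y ^ n + (\<Sum>i<n. c i * y ^ i * b ^ (n - i))"
    using yb(4) by (auto simp: integral_mod_def)
  then have "?\<theta> (y ^ n + (\<Sum>i<n. c i * y ^ i * b ^ (n - i))) = 0" unfolding el(1) by simp
  then have "?\<theta> y ^ n + (\<Sum>i<n. ?\<theta> (c i) * ?\<theta> y ^ i * ?\<theta> b ^ (n - i)) = 0" by (simp add: subst_simps)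
  note ai = integral_imp_almost_integral[OF this]
  have "?\<theta> b \<noteq> 0" using yb(3) by (simp add: el(1))
  \<comment> \<open>After elimination the quotient exists, because the polynomial ring is integrally
    closed; undoing the elimination costs a power of x_a.\<close>
  then have "?\<theta> b dvd ?\<theta> y"
    by (rule almost_integral_dvd[OF _ homogeneous_subst[OF yb(2) hom] _ homogeneous_subst[OF yb(1) hom] ai])
      (use \<open>?\<theta> b \<noteq> 0\<close> in simp_all)
  then obtain w0 where w0: "?\<theta> y = ?\<theta> b * w0" by (elim dvdE)
  have "Var a ^ (2 * d) * y - b * (Var a ^ (2 * e) * w0) =
      (Var a ^ (2 * d) * y - ?\<theta> y) - (Var a ^ (2 * e) * b - ?\<theta> b) * w0"
    by (simp add: w0 algebra_simps)
  also have "h dvd \<dots>" using el(2)[OF yb(1)] el(2)[OF yb(2)] by simp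
  finally have "h dvd Var a ^ (2 * d) * y - b * (Var a ^ (2 * e) * w0)" .
  moreover have "\<exists>w. h dvd y - b * w" if "h dvd Var a ^ N * y - b * w" for N w
    using that
  proof (induction N arbitrary: w)
    case (Suc N)
    \<comment> \<open>Now y / b = w / x_a^(N+1), so w / x_a is integral too; \<open>descent\<close>
      makes w a multiple of x_a modulo h, and one x_a cancels.\<close>
    have "h dvd y * Var a ^ Suc N - w * b" using Suc.prems by (simp add: mult.commute)
    from integral_mod_change[OF yb(4) this el(3) yb(3)] have "integral_mod h w (Var a)"
      by (rule integral_mod_power)
    then obtain u where u: "h dvd w - Var a * u" using descent by blast
    have "Var a * (Var a ^ N * y - b * u) = (Var a ^ Suc N * y - b * w) + b * (w - Var a * u)"
      by (simp add: algebra_simps)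
    also have "h dvd \<dots>" using Suc.prems u by simp
    finally have "h dvd Var a ^ N * y - b * u"
      by (rule regular_Var[rotated]) (use q(3) h(2) in \<open>simp add: h(1)\<close>)
    then show ?case by (rule Suc.IH)
  qed auto
  ultimately show ?thesis by blast
qed

text \<open>Modulo the ideal (p, r) the substitution is the identity, so its kernel lies in that
  ideal.\<close>

lemma subst_two_generators:
  fixes p r :: "('v::finite, 'k::field) mpoly"
  assumes "\<And>i. \<exists>u v. Var i - \<tau> i = p * u + r * v" and "subst \<tau> w = 0"
  obtains u v where "w = p * u + r * v"
proof -
  have "\<exists>u v. f - subst \<tau> f = p * u + r * v" for f
  proof (induction f rule: mpoly_induct)
    case (Const c)
    show ?case by (intro exI[of _ 0]) simp
  next
    case (Var i)
    then show ?case using assms(1) by simp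
  next
    case (add f g)
    then obtain u v u' v' where fg: "f - subst \<tau> f = p * u + r * v" "g - subst \<tau> g = p * u' + r * v'" by blast
    have "(f + g) - subst \<tau> (f + g) = (f - subst \<tau> f) + (g - subst \<tau> g)" by (simp add: subst_simps)
    also have "\<dots> = p * (u + u') + r * (v + v')" unfolding fg by (simp add: algebra_simps)
    finally show ?case by blast
  next
    case (mult f g)
    then obtain u v u' v' where fg: "f - subst \<tau> f = p * u + r * v" "g - subst \<tau> g = p * u' + r * v'" by blast
    have "(f * g) - subst \<tau> (f * g) = (f - subst \<tau> f) * g + subst \<tau> f * (g - subst \<tau> g)"
      by (simp add: subst_simps algebra_simps)
    also have "\<dots> = p * (u * g + subst \<tau> f * u') + r * (v * g + subst \<tau> f * v')"
      unfolding fg by (simp add: algebra_simps)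
    finally show ?case by blast
  qed
  then show ?thesis using that assms(2) by (metis diff_zero)
qed

context
  assumes char2: "CHAR('k::alg_closed_field) = 2"
begin

lemma char2_diff: "x - y = x + (y :: (4, 'k) mpoly)"
  using char2_mpoly(2)[OF char2, of y] by (simp only: diff_conv_add_uminus)

lemma kill_two:
  assumes "subst (\<lambda>i. if i = a \<or> i = b then 0 else Var i) w = (0 :: (4, 'k) mpoly)"
  obtains u v where "w = Var a * u + Var b * v"
proof (rule subst_two_generators[OF _ assms])
  fix i
  show "\<exists>u v. Var i - (if i = a \<or> i = b then 0 else Var i) = Var a * u + Var b * (v :: (4, 'k) mpoly)"
  proof (cases "i = a")
    case True
    then show ?thesis by (intro exI[of _ 1] exI[of _ 0]) simp
  next
    case False
    then show ?thesis by (intro exI[of _ 0] exI[of _ "if i = b then 1 else 0"]) simp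
  qed
qed

text \<open>Each step multiplies \<open>w / x\<^sub>1\<close> by a power of \<open>x\<^sub>2\<close>, rewrites the result with
  \<open>x\<^sub>2\<^sup>2 z = x\<^sub>1 s\<close> and reduces modulo \<open>(x\<^sub>1, x\<^sub>2)\<close>.\<close>

lemma descent_23:
  fixes h w :: "(4, 'k) mpoly"
  assumes h: "h = x1 * s + x2\<^sup>2 * Var z" and s: "s = x1 * x4 + x3\<^sup>2" and z: "z = 2 \<or> z = 3"
    and prime: "primeideal (hypersurface h) poly_ring" and x1: "\<not> h dvd x1" and int: "integral_mod h w x1"
  shows "\<exists>u. h dvd w - x1 * u"
proof -
  let ?\<tau> = "\<lambda>a i. if i = 1 \<or> i = a then 0 else (Var i :: (4, 'k) mpoly)"
  have "subst (?\<tau> z) h = 0" using z by (auto simp: h s subst_simps)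
  from integral_mod_subst[OF int this] have "subst (?\<tau> z) w = 0" by (simp add: subst_simps)
  then obtain u w1 where w1: "w = x1 * u + Var z * w1" by (rule kill_two)
  have \<tau>h: "subst (?\<tau> 2) h = 0" by (simp add: h subst_simps)
  \<comment> \<open>Replacing x2^2 x_z by x1 s gives w / x1 = (x2^(k+1) U + s v) / x2^(k+1). This is
    integral, so the numerator vanishes for x1 = x2 = 0; there s is x3^2, so v vanishes too.\<close>
  have step: "subst (?\<tau> 2) v = 0" if w: "w * x2 ^ Suc k = x1 * (x2 ^ Suc k * U) + x2\<^sup>2 * Var z * v" for U v k
  proof -
    have "w * x2 ^ Suc k - (x2 ^ Suc k * U + s * v) * x1 = x2\<^sup>2 * Var z * v - x1 * s * v"
      unfolding w by (simp add: algebra_simps)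
    also have "\<dots> = h * v" unfolding char2_diff by (simp add: h algebra_simps)
    finally have "h dvd w * x2 ^ Suc k - (x2 ^ Suc k * U + s * v) * x1" by simp
    from integral_mod_change[OF int this prime x1]
    have "subst (?\<tau> 2) (x2 ^ Suc k * U + s * v) = 0"
      by (rule integral_mod_subst[OF _ \<tau>h]) (simp add: subst_simps)
    then show ?thesis by (simp add: subst_simps s)
  qed
  have "subst (?\<tau> 2) w1 = 0"
    by (rule step[of 1 u]) (simp add: w1 algebra_simps power2_eq_square)
  then obtain u1 w2 where w2: "w1 = x1 * u1 + x2 * w2" by (rule kill_two)
  have "subst (?\<tau> 2) w2 = 0"
    by (rule step[of 0 "u + Var z * u1"]) (simp add: w1 w2 algebra_simps power2_eq_square)
  then obtain u2 w3 where w3: "w2 = x1 * u2 + x2 * w3" by (rule kill_two)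
  have "w - x1 * (u + Var z * u1 + Var z * x2 * u2 + s * w3) = x2\<^sup>2 * Var z * w3 - x1 * s * w3"
    by (simp add: w1 w2 w3 algebra_simps power2_eq_square)
  also have "\<dots> = h * w3" unfolding char2_diff by (simp add: h algebra_simps)
  finally show ?thesis by (intro exI) (rule dvdI)
qed

text \<open>On x1 = 0 the equation x2^3 + x3^3 = 0 splits into the lines x2 = \<zeta> x3 with
  \<zeta>^3 = 1. The numerator w vanishes on each, so modulo x1 it is a multiple of x2^3 + x3^3,
  which equals x1^2 x4 on the surface.\<close>

lemma descent_4:
  fixes w :: "(4, 'k) mpoly"
  assumes int: "integral_mod cubic4 w x1"
  shows "\<exists>u. cubic4 dvd w - x1 * u"
proof -
  obtain \<omega> :: 'k where \<omega>: "\<omega>\<^sup>2 + \<omega> + 1 = 0" using cube_root_of_unity by blast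
  note chk = char2_add_self[OF char2_one[OF char2]]
  have \<omega>2: "\<omega>\<^sup>2 = \<omega> + 1"
  proof -
    have "\<omega>\<^sup>2 = - (\<omega> + 1)" using \<omega> by (subst eq_neg_iff_add_eq_0) (simp only: add.assoc)
    then show ?thesis by (simp only: chk(2))
  qed
  have \<omega>3: "\<omega> ^ 3 = 1"
  proof -
    have "\<omega> ^ 3 = \<omega> * \<omega>\<^sup>2" by (simp add: power3_eq_cube power2_eq_square)
    also have "\<dots> = (\<omega> + \<omega>) + 1" unfolding \<omega>2 using \<omega>2 by (simp add: distrib_left power2_eq_square add_ac)
    finally show ?thesis by (simp only: chk(1)) simp
  qed
  have ne: "\<omega> \<noteq> 0" "\<omega> + 1 \<noteq> 0" using \<omega> \<omega>2 by auto
  let ?\<tau> = "\<lambda>\<zeta> i. if i = 1 then 0 else if i = 2 then Const \<zeta> * x3 else (Var i :: (4, 'k) mpoly)"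
  have kill: "subst (?\<tau> \<zeta>) w = 0" if "\<zeta> ^ 3 = 1" for \<zeta>
  proof (rule integral_mod_subst[OF int])
    have "subst (?\<tau> \<zeta>) cubic4 = Const (\<zeta> ^ 3) * x3 ^ 3 + x3 ^ 3"
      by (simp add: cubic4_def subst_simps power_mult_distrib Const_power)
    then show "subst (?\<tau> \<zeta>) cubic4 = 0" by (simp only: that Const_simps mult_1 char2_mpoly(1)[OF char2])
  qed simp
  have gen: "\<exists>u v. f = x1 * u + (x2 + Const \<zeta> * x3) * v" if "subst (?\<tau> \<zeta>) f = 0" for f \<zeta>
  proof -
    have "\<exists>u v. Var i - ?\<tau> \<zeta> i = x1 * u + (x2 + Const \<zeta> * x3) * v" for i
    proof (cases "i = 1")
      case True
      then show ?thesis by (intro exI[of _ 1] exI[of _ 0]) simp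
    next
      case False
      have "x2 - Const \<zeta> * x3 = (x2 + Const \<zeta> * x3) * 1" unfolding char2_diff by simp
      with False show ?thesis
        by (intro exI[of _ 0] exI[of _ "if i = 2 then 1 else 0"]) simp
    qed
    then show ?thesis using subst_two_generators[OF _ that] by metis
  qed
  obtain u w1 where w1: "w = x1 * u + (x2 + Const 1 * x3) * w1" using gen[OF kill[of 1]] by auto
  \<comment> \<open>On the line for \<omega> the factor x2 + x3 is (\<omega> + 1) x3, not zero, so
    w1 vanishes there.\<close>
  have "subst (?\<tau> \<omega>) w = Const (\<omega> + 1) * x3 * subst (?\<tau> \<omega>) w1"
    by (simp add: w1 subst_simps Const_add algebra_simps)
  then have "subst (?\<tau> \<omega>) w1 = 0" using kill[OF \<omega>3] ne by (simp del: Const_simps)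
  then obtain u1 w2 where w2: "w1 = x1 * u1 + (x2 + Const \<omega> * x3) * w2" using gen by blast
  have sq3: "(\<omega>\<^sup>2) ^ 3 = 1" using \<omega>3 by (metis power_commutes power_mult mult.commute power_one)
  have "\<omega>\<^sup>2 + 1 = \<omega>" "\<omega>\<^sup>2 + \<omega> = 1" unfolding \<omega>2 using chk(1)[of 1] chk(1)[of \<omega>] by (simp_all only: add.assoc add.left_commute, simp_all)
  have "subst (?\<tau> (\<omega>\<^sup>2)) w = Const (\<omega>\<^sup>2 + 1) * x3 * (Const (\<omega>\<^sup>2 + \<omega>) * x3 * subst (?\<tau> (\<omega>\<^sup>2)) w2)"
    by (simp add: w1 w2 subst_simps Const_add algebra_simps)
  then have "Const \<omega> * x3 * (x3 * subst (?\<tau> (\<omega>\<^sup>2)) w2) = 0"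
    unfolding \<open>\<omega>\<^sup>2 + 1 = \<omega>\<close> \<open>\<omega>\<^sup>2 + \<omega> = 1\<close> using kill[OF sq3] by simp
  then have "subst (?\<tau> (\<omega>\<^sup>2)) w2 = 0" using ne by simp
  then obtain u2 w3 where w3: "w2 = x1 * u2 + (x2 + Const (\<omega>\<^sup>2) * x3) * w3" using gen by blast
  define W :: "(4, 'k) mpoly" where "W = Const \<omega>"
  have W: "W * W = W + 1" using arg_cong[OF \<omega>2, of Const] by (simp add: W_def Const_add Const_mult power2_eq_square)
  have WW: "Const (\<omega>\<^sup>2) = W + 1" by (simp add: \<omega>2 W_def Const_add)
  note chm = char2_mpoly(1)[OF char2]
  have "W * W + W = (W + W) + 1" by (simp add: W)
  then have W1: "W * W + W = 1" by (simp only: chm add_0)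
  have "(x2 + W * x3) * (x2 + (W + 1) * x3) = x2 * x2 + (W * x2 * x3 + W * x2 * x3) + x2 * x3 + (W * W + W) * (x3 * x3)"
    by (simp add: algebra_simps)
  also have "\<dots> = x2 * x2 + x2 * x3 + x3 * x3" by (simp only: chm W1 mult_1 add_0_right)
  finally have f2: "(x2 + W * x3) * (x2 + (W + 1) * x3) = x2 * x2 + x2 * x3 + x3 * x3" .
  have "(x2 + x3) * ((x2 + W * x3) * (x2 + (W + 1) * x3)) =
      x2 ^ 3 + x3 ^ 3 + (x2 * x2 * x3 + x2 * x2 * x3) + (x2 * x3 * x3 + x2 * x3 * (x3 :: (4, 'k) mpoly))"
    unfolding f2 by (simp add: algebra_simps power3_eq_cube)
  then have prod: "(x2 + x3) * ((x2 + W * x3) * (x2 + (W + 1) * x3)) = x2 ^ 3 + (x3 ^ 3 :: (4, 'k) mpoly)"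
    unfolding chm by simp
  have "w = x1 * (u + (x2 + x3) * u1 + (x2 + x3) * (x2 + W * x3) * u2) + ((x2 + x3) * ((x2 + W * x3) * (x2 + (W + 1) * x3))) * w3"
    by (simp add: w1 w2 w3 WW W_def[symmetric] algebra_simps)
  then have "w - x1 * (u + (x2 + x3) * u1 + (x2 + x3) * (x2 + W * x3) * u2 + x1 * x4 * w3) = (x2 ^ 3 + x3 ^ 3) * w3 - x1 * (x1 * x4 * w3)"
    unfolding prod by (simp add: algebra_simps)
  also have "\<dots> = cubic4 * w3" unfolding char2_diff by (simp add: cubic4_def algebra_simps power2_eq_square)
  finally show ?thesis by (intro exI) (rule dvdI)
qed

lemma integrally_closed_cubics:
  assumes "h \<in> {cubic2, cubic3, cubic4 :: (4, 'k) mpoly}"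
    and "homogeneous d y" "homogeneous e b" "\<not> h dvd b" "integral_mod h y b"
  shows "\<exists>w. h dvd y - b * w"
proof -
  have hom: "homogeneous 3 h" using assms(1)
    by (auto simp: cubic2_def cubic3_def cubic4_def intro!: homogeneous_add hom3)
  have x1: "\<not> h dvd x1" using hypersurface_low_degree[OF hom _ homogeneous_Var[of 1]] by (auto simp: hypersurface_iff)
  have prime: "primeideal (hypersurface h) poly_ring"
    using assms(1) prime_cubics[OF char2, of 1] prime_cubics[OF char2, of 2] prime_cubics[OF char2, of 3]
    by (auto simp: cubics_def)
  from assms(1) consider "h = cubic2" | "h = cubic3" | "h = cubic4" by blast
  then have "\<exists>q. h = (Var 1)\<^sup>2 * Var 4 + q \<and> homogeneous 3 q \<and> kill 4 q = q \<and> kill 1 q \<noteq> 0"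
    using elimination_cubics(1-3)[OF char2 _ refl] by cases blast+
  then obtain q where q: "h = (Var 1)\<^sup>2 * Var 4 + q" "homogeneous 3 q" "kill 4 q = q" "kill 1 q \<noteq> 0" by blast
  have "\<exists>u. h dvd w - x1 * u" if int: "integral_mod h w x1" for w
  proof -
    from assms(1) consider "h = cubic2" | "h = cubic3" | "h = cubic4" by blast
    then show ?thesis
    proof cases
      case 1
      have "h = x1 * (x1 * x4 + x3\<^sup>2) + x2\<^sup>2 * Var 2"
        by (simp add: 1 cubic2_def algebra_simps power2_eq_square power3_eq_cube)
      then show ?thesis using descent_23[OF _ refl _ prime x1 int] by blast
    next
      case 2
      have "h = x1 * (x1 * x4 + x3\<^sup>2) + x2\<^sup>2 * Var 3"
        by (simp add: 2 cubic3_def algebra_simps power2_eq_square)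
      then show ?thesis using descent_23[OF _ refl _ prime x1 int] by blast
    next
      case 3
      then show ?thesis using descent_4 int by blast
    qed
  qed
  then show ?thesis using integrally_closed_mod[OF char2 q(1) _ q(2-4) _ assms(2-5)] by simp
qed

end

subsection \<open>Normality of the local rings\<close>

lemma integrally_closed_domainD:
  fixes R (structure)
  assumes "integrally_closed_domain R" "a \<in> carrier R" "b \<in> carrier R" "c \<in> {..<n} \<rightarrow> carrier R" "b \<noteq> \<zero>"
    "(a [^] (n::nat)) \<oplus> (\<Oplus>i\<in>{..<n}. c i \<otimes> (a [^] i) \<otimes> (b [^] (n - i))) = \<zero>"
  shows "\<exists>q\<in>carrier R. a = q \<otimes> b"
  using assms unfolding integrally_closed_domain_def by blast

lemma (in proj_point) common_denominator:
  fixes n :: nat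
  assumes "\<And>i. i < n \<Longrightarrow> c i \<in> carrier (local_ring I P)"
  shows "\<exists>K e C. K \<notin> P \<and> homogeneous e K \<and> (\<forall>i<n. homogeneous e (C i) \<and> c i = frac I P (C i) K)"
  using assms
proof (induction n)
  case 0
  then show ?case using P_1 by (intro exI[of _ 1] exI[of _ 0]) simp
next
  case (Suc n)
  then obtain K e C where K: "K \<notin> P" "homogeneous e K" "\<And>i. i < n \<Longrightarrow> homogeneous e (C i) \<and> c i = frac I P (C i) K"
    by (meson less_SucI)
  obtain a f where af: "(a, f) \<in> fractions P" "c n = frac I P a f"
    using Suc.prems[of n] by (auto elim: local_ring_carrierE)
  then obtain d where d: "f \<notin> P" "homogeneous d a" "homogeneous d f" by (auto elim: fractionsE)
  have hKf: "homogeneous (e + d) (K * f)" "K * f \<notin> P"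
    using K d by (simp_all add: homogeneous_mult P_mult)
  define C' where "C' i = (if i = n then K * a else C i * f)" for i
  have "homogeneous (e + d) (C' i) \<and> c i = frac I P (C' i) (K * f)" if "i < Suc n" for i
  proof (cases "i = n")
    case True
    have "homogeneous (e + d) (K * a)" using K d by (simp add: homogeneous_mult)
    moreover from this have "frac I P a f = frac I P (K * a) (K * f)"
      using hKf by (intro frac_eqI'[OF af(1) fractionsI]) (simp_all add: mult_ac)
    ultimately show ?thesis using True af by (simp add: C'_def)
  next
    case False
    then have i: "homogeneous e (C i)" "c i = frac I P (C i) K" using K(3)[of i] that by auto
    have "homogeneous (e + d) (C i * f)" using i d by (simp add: homogeneous_mult)
    moreover from this have "frac I P (C i) K = frac I P (C i * f) (K * f)"
      using hKf by (intro frac_eqI'[OF fractionsI[OF K(1) i(1) K(2)] fractionsI]) (simp_all add: mult_ac)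
    ultimately show ?thesis using False i by (simp add: C'_def)
  qed
  then show ?case using hKf by blast
qed

text \<open>Reduction to the coordinate ring: with a = x / F, b = y / F and a common denominator K
  of the coefficients, K x / y is integral, and K x = y w modulo I gives a = (w / K) b.\<close>

lemma local_ring_integrally_closed:
  fixes I P :: "('v::finite, 'k::field) mpoly set"
  assumes prime: "primeideal I poly_ring" and P: "P \<in> proj_points I"
    and closed: "\<And>y b d e n c. homogeneous d y \<Longrightarrow> homogeneous e b \<Longrightarrow> b \<notin> I \<Longrightarrow> n > 0 \<Longrightarrow>
      y ^ n + (\<Sum>i<n. c i * y ^ i * b ^ (n - i)) \<in> I \<Longrightarrow> \<exists>w. y - b * w \<in> I"
    and I_hom: "homogeneous_ideal I"
  shows "integrally_closed_domain (local_ring I P)"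
proof -
  have I_ideal: "ideal I poly_ring" using I_hom by (rule homogeneous_ideal_ideal)
  have IP: "I \<subseteq> P" using P by (auto simp: proj_points_def)
  interpret proj_point I P using I_ideal P by (rule proj_points_point)
  interpret R: cring "local_ring I P" by (rule cring_local_ring)
  have cancel: "f \<in> I" if "s * f \<in> I" "s \<notin> P" for s f
    using prime that IP by (auto simp: primeideal_poly_ring_iff)
  have eq_iff: "frac I P a f = frac I P b g \<longleftrightarrow> a * g - b * f \<in> I"
    if "(a, f) \<in> fractions P" "(b, g) \<in> fractions P" for a f b g
    using frac_eqI[OF that] cancel unfolding frac_eq_iff[OF that] by blast
  have zero_iff: "frac I P a f = frac I P 0 1 \<longleftrightarrow> a \<in> I" if "(a, f) \<in> fractions P" for a f
    using eq_iff[OF that fractions_01(1)] by simp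
  have dom: "domain (local_ring I P)"
  proof (intro domain.intro domain_axioms.intro R.cring_axioms)
    show "\<one>\<^bsub>local_ring I P\<^esub> \<noteq> \<zero>\<^bsub>local_ring I P\<^esub>"
      using zero_iff[OF fractions_01(2)] P_1 IP by auto
    fix a b assume ab: "a \<otimes>\<^bsub>local_ring I P\<^esub> b = \<zero>\<^bsub>local_ring I P\<^esub>" "a \<in> carrier (local_ring I P)" "b \<in> carrier (local_ring I P)"
    obtain a' f where a: "(a', f) \<in> fractions P" "a = frac I P a' f" using ab(2) by (rule local_ring_carrierE)
    obtain b' g where b: "(b', g) \<in> fractions P" "b = frac I P b' g" using ab(3) by (rule local_ring_carrierE)
    have "a' * b' \<in> I" using ab(1) zero_iff[OF fractions_mult[OF a(1) b(1)]] a b by simp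
    then have "a' \<in> I \<or> b' \<in> I" using prime by (auto simp: primeideal_poly_ring_iff)
    then show "a = \<zero>\<^bsub>local_ring I P\<^esub> \<or> b = \<zero>\<^bsub>local_ring I P\<^esub>"
      using zero_iff[OF a(1)] zero_iff[OF b(1)] a(2) b(2) by simp
  qed
  have "\<exists>q\<in>carrier (local_ring I P). a = q \<otimes>\<^bsub>local_ring I P\<^esub> b"
    if ab: "a \<in> carrier (local_ring I P)" "b \<in> carrier (local_ring I P)" and c: "c \<in> {..<n} \<rightarrow> carrier (local_ring I P)"
      and b0: "b \<noteq> \<zero>\<^bsub>local_ring I P\<^esub>"
      and rel: "(a [^]\<^bsub>local_ring I P\<^esub> n) \<oplus>\<^bsub>local_ring I P\<^esub>
          (\<Oplus>\<^bsub>local_ring I P\<^esub>i\<in>{..<n}. c i \<otimes>\<^bsub>local_ring I P\<^esub> (a [^]\<^bsub>local_ring I P\<^esub> i) \<otimes>\<^bsub>local_ring I P\<^esub> (b [^]\<^bsub>local_ring I P\<^esub> (n - i)))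
          = \<zero>\<^bsub>local_ring I P\<^esub>"
    for a b c and n :: nat
  proof -
    have "(if i = 0 then a else b) \<in> carrier (local_ring I P)" for i :: nat using ab by simp
    from common_denominator[of 2 "\<lambda>i. if i = 0 then a else b", OF this]
    obtain F d A where F: "F \<notin> P" "homogeneous d F"
        "\<And>i::nat. i < 2 \<Longrightarrow> homogeneous d (A i) \<and> (if i = 0 then a else b) = frac I P (A i) F"
      by blast
    define x y where "x = A 0" and "y = A 1"
    have x: "homogeneous d x" "a = frac I P x F" and y: "homogeneous d y" "b = frac I P y F"
      using F(3)[of 0] F(3)[of 1] by (simp_all add: x_def y_def)
    have fr: "(x, F) \<in> fractions P" "(y, F) \<in> fractions P" using x y F by (auto intro: fractionsI)
    obtain K e C where K: "K \<notin> P" "homogeneous e K" "\<And>i. i < n \<Longrightarrow> homogeneous e (C i) \<and> c i = frac I P (C i) K"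
      using common_denominator[of n c] c by blast
    define T where "T i = C i * x ^ i * y ^ (n - i)" for i
    define N where "N = K * F ^ n"
    have hF: "homogeneous (i * d) (F ^ i)" "homogeneous (i * d) (x ^ i)" "homogeneous (i * d) (y ^ i)" for i
      using F(2) x y by (auto intro: homogeneous_power)
    have NP: "N \<notin> P" "homogeneous (e + n * d) N"
      unfolding N_def using K F hF by (simp_all add: P_mult P_power homogeneous_mult)
    have hT: "homogeneous (e + n * d) (T i)" if "i < n" for i
    proof -
      have "homogeneous (e + i * d + (n - i) * d) (T i)"
        unfolding T_def using K(3)[OF that] hF by (intro homogeneous_mult) auto
      moreover have "e + i * d + (n - i) * d = e + n * d" using that by (simp add: add.assoc flip: distrib_right)
      ultimately show ?thesis by simp
    qed
    have summand: "c i \<otimes>\<^bsub>local_ring I P\<^esub> (a [^]\<^bsub>local_ring I P\<^esub> i) \<otimes>\<^bsub>local_ring I P\<^esub> (b [^]\<^bsub>local_ring I P\<^esub> (n - i)) = frac I P (T i) N"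
      if "i < n" for i
    proof -
      have "F ^ i * F ^ (n - i) = F ^ n" using that by (simp flip: power_add)
      moreover have "(C i, K) \<in> fractions P" using K(1,2) K(3)[OF that] by (auto intro: fractionsI)
      ultimately show ?thesis
        using K(3)[OF that] frac_pow[OF fr(1), of i] frac_pow[OF fr(2), of "n - i"]
        by (simp add: x(2) y(2) fractions_mult T_def N_def mult.assoc)
    qed
    have sum: "(\<Oplus>\<^bsub>local_ring I P\<^esub>i\<in>{..<m}. c i \<otimes>\<^bsub>local_ring I P\<^esub> (a [^]\<^bsub>local_ring I P\<^esub> i) \<otimes>\<^bsub>local_ring I P\<^esub> (b [^]\<^bsub>local_ring I P\<^esub> (n - i)))
        = frac I P (\<Sum>i<m. T i) N" if "m \<le> n" for m
      using that
    proof (induction m)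
      case 0
      have "frac I P 0 1 = frac I P 0 N"
        using NP by (intro frac_eqI' fractions_01 fractionsI[of N P "e + n * d"]) simp_all
      then show ?case by simp
    next
      case (Suc m)
      have h1: "homogeneous (e + n * d) (\<Sum>i<m. T i)" using Suc.prems by (intro homogeneous_sum hT) auto
      have "(\<lambda>i. c i \<otimes>\<^bsub>local_ring I P\<^esub> (a [^]\<^bsub>local_ring I P\<^esub> i) \<otimes>\<^bsub>local_ring I P\<^esub> (b [^]\<^bsub>local_ring I P\<^esub> (n - i))) \<in> {..<Suc m} \<rightarrow> carrier (local_ring I P)"
        using ab c Suc.prems by (auto intro!: R.m_closed R.nat_pow_closed)
      then have "(\<Oplus>\<^bsub>local_ring I P\<^esub>i\<in>{..<Suc m}. c i \<otimes>\<^bsub>local_ring I P\<^esub> (a [^]\<^bsub>local_ring I P\<^esub> i) \<otimes>\<^bsub>local_ring I P\<^esub> (b [^]\<^bsub>local_ring I P\<^esub> (n - i)))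
          = frac I P (T m) N \<oplus>\<^bsub>local_ring I P\<^esub> frac I P (\<Sum>i<m. T i) N"
        using Suc summand[of m] unfolding lessThan_Suc by (subst R.finsum_insert) (auto simp: Pi_iff)
      also have "\<dots> = frac I P (T m + (\<Sum>i<m. T i)) N"
        using NP hT[of m] h1 Suc.prems by (intro frac_add_same fractionsI) auto
      finally show ?case by (simp add: add.commute)
    qed
    define S where "S = (\<Sum>i<n. T i)"
    have hS: "homogeneous (e + n * d) S" unfolding S_def by (intro homogeneous_sum hT) auto
    have frS: "(S, N) \<in> fractions P" using NP hS by (intro fractionsI)
    have frx: "(x ^ n, F ^ n) \<in> fractions P" "a [^]\<^bsub>local_ring I P\<^esub> n = frac I P (x ^ n) (F ^ n)"
      using frac_pow[OF fr(1), of n] x(2) by simp_all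
    have "frac I P (x ^ n) (F ^ n) \<oplus>\<^bsub>local_ring I P\<^esub> frac I P S N = frac I P 0 1"
      using rel sum[of n] frx by (simp add: S_def)
    then have "x ^ n * N + S * F ^ n \<in> I"
      using zero_iff[OF fractions_add[OF frx(1) frS]] frx(1) frS by simp
    then have "F ^ n * (K * x ^ n + S) \<in> I" by (simp add: N_def algebra_simps)
    then have KS: "K * x ^ n + S \<in> I" using cancel P_power[OF F(1)] by blast
    \<comment> \<open>For n = 0 the equation reads 1 = 0 and would put K into I.\<close>
    have n0: "n > 0"
    proof (rule ccontr)
      assume "\<not> n > 0"
      then have "K \<in> I" using KS by (simp add: S_def)
      then show False using K(1) IP by blast
    qed
    have yI: "y \<notin> I" using b0 zero_iff[OF fr(2)] y(2) by simp
    \<comment> \<open>The factor K^(n-1) makes the equation monic in K x.\<close>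
    have "(K * x) ^ n + (\<Sum>i<n. (C i * K ^ (n - 1 - i)) * (K * x) ^ i * y ^ (n - i)) = K ^ (n - 1) * (K * x ^ n + S)"
    proof -
      have "(C i * K ^ (n - 1 - i)) * (K * x) ^ i * y ^ (n - i) = K ^ (n - 1) * T i" if "i < n" for i
      proof -
        have "K ^ (n - 1) = K ^ (n - 1 - i) * K ^ i" using that by (simp flip: power_add)
        then show ?thesis by (simp add: T_def power_mult_distrib mult_ac)
      qed
      moreover have "(K * x) ^ n = K ^ (n - 1) * (K * x ^ n)"
        using n0 by (cases n) (simp_all add: power_mult_distrib mult_ac)
      ultimately show ?thesis by (simp add: S_def distrib_left sum_distrib_left)
    qed
    then have rel': "(K * x) ^ n + (\<Sum>i<n. (C i * K ^ (n - 1 - i)) * (K * x) ^ i * y ^ (n - i)) \<in> I"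
      using ideal_mult[OF I_ideal KS] by simp
    have hKx: "homogeneous (e + d) (K * x)" using K x by (simp add: homogeneous_mult)
    obtain w where w: "K * x - y * w \<in> I"
      using closed[OF hKx y(1) yI n0 rel'] by blast
    \<comment> \<open>Degree e is needed for w' / K to be a fraction of degree zero.\<close>
    define w' where "w' = hom_part e w"
    have "hom_part (e + d) (K * x - y * w) = K * x - w' * y"
      using hom_part_homogeneous[OF hKx, of "e + d"] hom_part_mult_homogeneous[OF y(1), of "e + d" w]
      by (simp add: hom_part_diff w'_def mult.commute[of y])
    then have w': "K * x - w' * y \<in> I" using homogeneous_ideal_hom_part[OF I_hom w, of "e + d"] by simp
    have frw: "(w', K) \<in> fractions P" unfolding w'_def by (rule fractionsI[OF K(1) homogeneous_hom_part K(2)])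
    have "x * (K * F) - w' * y * F = F * (K * x - w' * y)" by (simp add: algebra_simps)
    then have "x * (K * F) - w' * y * F \<in> I" using ideal_mult[OF I_ideal w'] by simp
    then have "a = frac I P w' K \<otimes>\<^bsub>local_ring I P\<^esub> b"
      unfolding x(2) y(2) frac_mult[OF frw fr(2)] using eq_iff[OF fr(1) fractions_mult[OF frw fr(2)]] by simp
    then show ?thesis using frac_closed[OF frw] by blast
  qed
  then show ?thesis using dom unfolding integrally_closed_domain_def by blast
qed

section \<open>Singular loci, uniqueness of the smooth cubic, and failure of normality\<close>

subsection \<open>Geometry of the normal forms\<close>

lemma vector_4 [simp]:
  fixes a b c d :: "'a::zero"
  shows "(vector [a, b, c, d] :: 'a^4) $ 1 = a" "(vector [a, b, c, d] :: 'a^4) $ 2 = b"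
    "(vector [a, b, c, d] :: 'a^4) $ 3 = c" "(vector [a, b, c, d] :: 'a^4) $ 4 = d"
  unfolding vector_def by simp_all

lemma Const_prod: "Const (prod f A) = (\<Prod>i\<in>A. Const (f i :: 'k::comm_semiring_1))"
  by (induction A rule: infinite_finite_induct) (simp_all add: Const_mult)

text \<open>The constant c is the value of f at v.\<close>

lemma subst_linear_point:
  fixes f :: "('v::finite, 'k::field) mpoly" and v :: "'v \<Rightarrow> 'k"
  assumes "homogeneous d f"
  shows "\<exists>c. subst (\<lambda>i. Const (v i) * Var s) f = Const c * Var s ^ d"
proof -
  have mono: "subst (\<lambda>i. Const (v i) * Var s) (mon m a) = Const (a * (\<Prod>i\<in>UNIV. v i ^ Poly_Mapping.lookup m i)) * Var s ^ mdeg m" for m a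
    by (simp add: subst_mono power_mult_distrib prod.distrib Const_mult Const_prod Const_power mdeg_def power_sum mult_ac)
  have "subst (\<lambda>i. Const (v i) * Var s) (\<Sum>m\<in>Poly_Mapping.keys f. mon m (cf f m)) =
      (\<Sum>m\<in>Poly_Mapping.keys f. Const (cf f m * (\<Prod>i\<in>UNIV. v i ^ Poly_Mapping.lookup m i)) * Var s ^ d)"
    unfolding subst_sum mono using assms by (intro sum.cong) (auto simp: homogeneous_def)
  also have "\<dots> = Const (\<Sum>m\<in>Poly_Mapping.keys f. cf f m * (\<Prod>i\<in>UNIV. v i ^ Poly_Mapping.lookup m i)) * Var s ^ d"
    by (simp add: Const_sum sum_distrib_right)
  finally have "subst (\<lambda>i. Const (v i) * Var s) f = \<dots>" unfolding mpoly_sum_monos[of f, symmetric] .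
  then show ?thesis by (rule exI)
qed

lemma ideal_subst_diff:
  fixes f :: "('v::finite, 'k::field) mpoly"
  assumes J: "ideal J poly_ring" and gen: "\<And>i. Var i - \<tau> i \<in> J"
  shows "f - subst \<tau> f \<in> J"
proof (induction f rule: mpoly_induct)
  case (add f g)
  have eq: "(f + g) - subst \<tau> (f + g) = (f - subst \<tau> f) + (g - subst \<tau> g)" by (simp add: subst_simps)
  show ?case unfolding eq by (rule ideal_add[OF J add])
next
  case (mult f g)
  have eq: "(f * g) - subst \<tau> (f * g) = g * (f - subst \<tau> f) + subst \<tau> f * (g - subst \<tau> g)"
    by (simp add: subst_simps algebra_simps)
  show ?case unfolding eq by (rule ideal_add[OF J ideal_mult[OF J mult(1)] ideal_mult[OF J mult(2)]])
qed (simp_all add: gen ideal_0[OF J])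

text \<open>The point \<open>[0:0:0:1]\<close> as the kernel of the evaluation \<open>x\<^sub>i \<mapsto> v\<^sub>i x\<^sub>4\<close>.\<close>

lemma last_point:
  fixes J :: "(4, 'k::field) mpoly set"
  defines "v \<equiv> vector [0, 0, 0, 1] :: 'k^4"
  defines "K \<equiv> {f. subst (\<lambda>i. Const (v $ i) * Var 4) f = (0 :: (4, 'k) mpoly)}"
  shows "ideal J poly_ring \<Longrightarrow> x1 \<in> J \<Longrightarrow> x2 \<in> J \<Longrightarrow> x3 \<in> J \<Longrightarrow> K \<subseteq> J"
    "primeideal J poly_ring \<Longrightarrow> homogeneous_ideal J \<Longrightarrow> x1 \<in> J \<Longrightarrow> x2 \<in> J \<Longrightarrow> x3 \<in> J \<Longrightarrow> x4 \<notin> J \<Longrightarrow> J = K"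
    "rational_point v = K"
proof -
  let ?\<tau> = "\<lambda>i. Const (v $ i) * Var 4 :: (4, 'k) mpoly"
  have diff: "f - subst ?\<tau> f \<in> J" if J: "ideal J poly_ring" "x1 \<in> J" "x2 \<in> J" "x3 \<in> J" for J f
  proof (rule ideal_subst_diff[OF J(1)])
    fix i :: 4
    show "Var i - ?\<tau> i \<in> J" using exhaust_4[of i] J ideal_0[OF J(1)] by (auto simp: v_def)
  qed
  have sub: "K \<subseteq> J" if J: "ideal J poly_ring" "x1 \<in> J" "x2 \<in> J" "x3 \<in> J" for J
    using diff[OF J] by (auto simp: K_def) (metis diff_zero)
  then show "ideal J poly_ring \<Longrightarrow> x1 \<in> J \<Longrightarrow> x2 \<in> J \<Longrightarrow> x3 \<in> J \<Longrightarrow> K \<subseteq> J" .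
  have \<tau>_hom: "homogeneous (Suc 0) (?\<tau> i)" for i by (intro homogeneous_Const_mult homogeneous_Var)
  show "J = K" if J: "primeideal J poly_ring" "homogeneous_ideal J" "x1 \<in> J" "x2 \<in> J" "x3 \<in> J" "x4 \<notin> J"
  proof
    note id = homogeneous_ideal_ideal[OF J(2)]
    show "K \<subseteq> J" using id J by (intro sub)
    show "J \<subseteq> K"
    proof
      fix f assume f: "f \<in> J"
      have "subst ?\<tau> (hom_part d f) = 0" for d
      proof -
        from subst_linear_point[OF homogeneous_hom_part[of d f], where v="\<lambda>i. v $ i" and s=4]
        obtain c where c: "subst ?\<tau> (hom_part d f) = Const c * Var 4 ^ d" ..
        have "hom_part d f - (hom_part d f - subst ?\<tau> (hom_part d f)) \<in> J"
          by (intro ideal_diff[OF id] homogeneous_ideal_hom_part[OF J(2) f] diff[OF id] J)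
        then have mem: "Const c * Var 4 ^ d \<in> J" by (simp add: c)
        have "c = 0"
        proof (rule ccontr)
          assume "c \<noteq> 0"
          then have eq: "Const (inverse c) * (Const c * Var 4 ^ d) = (Var 4 ^ d :: (4, 'k) mpoly)"
            by (simp add: mult.assoc[symmetric] flip: Const_mult)
          have "Var 4 ^ d \<in> J" using ideal_mult[OF id mem, of "Const (inverse c)"] unfolding eq .
          then show False using prime_power[OF J(1)] J(6) by blast
        qed
        then show ?thesis by (simp add: c)
      qed
      moreover from mpoly_eq_sum_hom_parts[of f 0] obtain N where "f = (\<Sum>n<N + 0. hom_part n f)" ..
      then have "subst ?\<tau> f = (\<Sum>n<N + 0. subst ?\<tau> (hom_part n f))" unfolding subst_sum[symmetric] by (rule arg_cong)
      ultimately show "f \<in> K" by (simp add: K_def)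
    qed
  qed
  have K_ideal: "ideal K poly_ring"
    unfolding K_def using prime_kernel(1)[of ?\<tau>, OF \<tau>_hom] by (simp add: primeideal_poly_ring_iff)
  interpret R: cring "poly_ring :: (4, 'k) mpoly ring" by (rule poly_ring_cring)
  let ?G = "{Const (v $ i) * Var j - Const (v $ j) * Var i | i j. True} :: (4, 'k) mpoly set"
  show "rational_point v = K"
  proof
    show "rational_point v \<subseteq> K"
      unfolding rational_point_def by (rule R.genideal_minimal[OF K_ideal]) (auto simp: K_def subst_simps mult_ac)
    have gid: "ideal (rational_point v) poly_ring"
      unfolding rational_point_def by (rule R.genideal_ideal) simp
    have G: "g \<in> rational_point v" if "g \<in> ?G" for g
      unfolding rational_point_def using R.genideal_self[of ?G] that by auto
    have "Var j \<in> rational_point v" if "v $ j = 0" for j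
    proof -
      have "Const (v $ 4) * Var j - Const (v $ j) * Var 4 \<in> rational_point v" by (intro G) blast
      then show ?thesis using that by (simp add: v_def)
    qed
    then show "K \<subseteq> rational_point v" by (intro sub gid) (simp_all add: v_def)
  qed
qed

context
  assumes char2: "CHAR('k::alg_closed_field) = 2"
begin

lemma cubics_form: "cubic1 = (cform (pat (patterns ! 0)) :: (4, 'k) mpoly)" "cubic2 = (cform (pat (patterns ! 1)) :: (4, 'k) mpoly)"
  "cubic3 = (cform (pat (patterns ! 2)) :: (4, 'k) mpoly)" "cubic4 = (cform (pat (patterns ! 3)) :: (4, 'k) mpoly)"
  "cubic5 = (cform (pat (patterns ! 4)) :: (4, 'k) mpoly)"
  using cubics_pattern[OF char2, of 0] cubics_pattern[OF char2, of 1] cubics_pattern[OF char2, of 2]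
    cubics_pattern[OF char2, of 3] cubics_pattern[OF char2, of 4] by (simp_all add: cubics_def)

lemma prime_square: "primeideal P poly_ring \<Longrightarrow> f\<^sup>2 \<in> P \<longleftrightarrow> f \<in> P" for f :: "(4, 'k) mpoly"
  using prime_power[of P f 2] ideal_mult[of P f f] by (auto simp: primeideal_poly_ring_iff power2_eq_square)

text \<open>In each pattern a column has at most one entry, so every partial derivative is zero or
  the square of a variable, and a prime contains the square exactly when it contains the
  variable.\<close>

lemma smooth_at_cubics:
  fixes P :: "(4, 'k) mpoly set"
  assumes "primeideal P poly_ring"
  shows "smooth_at cubic1 P \<longleftrightarrow> \<not> (x1 \<in> P \<and> x2 \<in> P \<and> x3 \<in> P \<and> x4 \<in> P)"
    "h \<in> {cubic2, cubic3, cubic4} \<Longrightarrow> smooth_at h P \<longleftrightarrow> \<not> (x1 \<in> P \<and> x2 \<in> P \<and> x3 \<in> P)"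
    "smooth_at cubic5 P \<longleftrightarrow> \<not> (x1 \<in> P \<and> x2 \<in> P)"
proof -
  have ex: "(\<exists>i::4. Q i) \<longleftrightarrow> Q 1 \<or> Q 2 \<or> Q 3 \<or> Q 4" for Q by (metis exhaust_4)
  have 0: "0 \<in> P" using assms by (simp add: primeideal_poly_ring_iff ideal_0)
  note unf = smooth_at_def ex partial_deriv_cform[OF char2] cubics_form
  show "smooth_at cubic1 P \<longleftrightarrow> \<not> (x1 \<in> P \<and> x2 \<in> P \<and> x3 \<in> P \<and> x4 \<in> P)"
    unfolding unf by (simp add: pat_def patterns_def sum_4 prime_square[OF assms])
  show "smooth_at cubic5 P \<longleftrightarrow> \<not> (x1 \<in> P \<and> x2 \<in> P)"
    unfolding unf using 0 by (simp add: pat_def patterns_def sum_4 prime_square[OF assms])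
  have "smooth_at cubic2 P \<longleftrightarrow> \<not> (x1 \<in> P \<and> x2 \<in> P \<and> x3 \<in> P)"
    unfolding unf using 0 by (simp add: pat_def patterns_def sum_4 prime_square[OF assms]) blast
  moreover have "smooth_at cubic3 P \<longleftrightarrow> \<not> (x1 \<in> P \<and> x2 \<in> P \<and> x3 \<in> P)"
    unfolding unf using 0 by (simp add: pat_def patterns_def sum_4 prime_square[OF assms]) blast
  moreover have "smooth_at cubic4 P \<longleftrightarrow> \<not> (x1 \<in> P \<and> x2 \<in> P \<and> x3 \<in> P)"
    unfolding unf using 0 by (simp add: pat_def patterns_def sum_4 prime_square[OF assms]) blast
  ultimately show "h \<in> {cubic2, cubic3, cubic4} \<Longrightarrow> smooth_at h P \<longleftrightarrow> \<not> (x1 \<in> P \<and> x2 \<in> P \<and> x3 \<in> P)" by blast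
qed

lemma proj_pointsD:
  fixes P :: "(4, 'k) mpoly set"
  assumes "P \<in> proj_points I"
  shows "primeideal P poly_ring" "homogeneous_ideal P" "I \<subseteq> P" "\<not> (x1 \<in> P \<and> x2 \<in> P \<and> x3 \<in> P \<and> x4 \<in> P)"
proof -
  show "primeideal P poly_ring" "homogeneous_ideal P" "I \<subseteq> P" using assms by (auto simp: proj_points_def)
  obtain i where "Var i \<notin> P" using assms by (auto simp: proj_points_def)
  then show "\<not> (x1 \<in> P \<and> x2 \<in> P \<and> x3 \<in> P \<and> x4 \<in> P)" using exhaust_4[of i] by auto
qed

lemma smooth_cubic1: "smooth_hypersurface (cubic1 :: (4, 'k) mpoly)"
  unfolding smooth_hypersurface_def using smooth_at_cubics(1) proj_pointsD by blast

text \<open>A nonzero left kernel vector would be a singular point, so smoothness makes A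
  invertible, and the invertible case is the Fermat cubic.\<close>

lemma smooth_not_split:
  fixes h :: "(4, 'k) mpoly"
  assumes h: "homogeneous 3 h" "smooth_hypersurface h" "\<not> frobenius_split (hypersurface h)"
  shows "proj_equiv h cubic1"
proof -
  obtain A where A: "h = cform A" using no_squarefree_cform[OF h(1) squarefree_split[OF char2 h(1,3)]] by blast
  have "invertible (transpose A)"
  proof (rule invertibleI_ker, rule ccontr)
    fix x assume x: "transpose A *v x = 0" "x \<noteq> 0"
    then obtain i0 where i0: "x $ i0 \<noteq> 0" by (auto simp: vec_eq_iff)
    define v :: "'k^4" where "v = (\<chi> i. froot (x $ i))"
    have "v $ i0 \<noteq> 0" using i0 froot_square[of "x $ i0"] by (auto simp: v_def)
    moreover have "(\<Sum>i\<in>UNIV. (v $ i)\<^sup>2 * A $ i $ j) = 0" for j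
      using arg_cong[OF x(1), of "\<lambda>y. y $ j"]
      by (simp add: v_def froot_square matrix_vector_mult_def transpose_def mult.commute)
    ultimately have "{f. subst (\<lambda>i. Const (v $ i) * Var 1) f = (0 :: (4, 'k) mpoly)} \<in> singular_locus (cform A)"
      by (rule singular_kernel_point[OF char2])
    then show False using h(2) by (auto simp: A singular_locus_def smooth_hypersurface_def)
  qed
  then have "invertible A" by (simp add: invertible_det_nz)
  then obtain g where "invertible g" "lin_change g h = cubic1"
    using invertible_matrix_lin_equiv[OF char2] unfolding A lin_equiv_def by blast
  then show ?thesis unfolding proj_equiv_def by (intro exI[of _ g] exI[of _ 1]) simp
qed

lemma normal_cubics:
  assumes "h \<in> {cubic2, cubic3, cubic4 :: (4, 'k) mpoly}"
  shows "normal_scheme (hypersurface h)"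
  unfolding normal_scheme_def
proof
  fix P assume P: "P \<in> proj_points (hypersurface h)"
  have hom: "homogeneous 3 h" using assms
    by (auto simp: cubic2_def cubic3_def cubic4_def intro!: homogeneous_add hom3)
  have prime: "primeideal (hypersurface h) poly_ring"
    using assms prime_cubics[OF char2, of 1] prime_cubics[OF char2, of 2] prime_cubics[OF char2, of 3]
    by (auto simp: cubics_def)
  show "integrally_closed_domain (local_ring (hypersurface h) P)"
  proof (rule local_ring_integrally_closed[OF prime P _ homogeneous_ideal_hypersurface[OF hom]])
    fix y b :: "(4, 'k) mpoly" and d e n c
    assume "homogeneous d y" "homogeneous e b" "b \<notin> hypersurface h" "n > 0"
      "y ^ n + (\<Sum>i<n. c i * y ^ i * b ^ (n - i)) \<in> hypersurface h"
    then have "\<exists>w. h dvd y - b * w"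
      unfolding hypersurface_iff by (intro integrally_closed_cubics[OF char2 assms]) (auto simp: integral_mod_def)
    then show "\<exists>w. y - b * w \<in> hypersurface h" by (simp add: hypersurface_iff)
  qed
qed

lemma singular_normal_cubics:
  assumes "h \<in> {cubic2, cubic3, cubic4 :: (4, 'k) mpoly}"
  shows "singular_locus h = {rational_point (vector [0, 0, 0, 1])}"
proof -
  define v where "v = (vector [0, 0, 0, 1] :: 'k^4)"
  define K where "K = {f. subst (\<lambda>i. Const (v $ i) * Var 4) f = (0 :: (4, 'k) mpoly)}"
  note lp = last_point[where 'k='k, folded v_def, folded K_def]
  have "P = K" if P: "P \<in> singular_locus h" for P
  proof -
    have pp: "P \<in> proj_points (hypersurface h)" "\<not> smooth_at h P" using P by (auto simp: singular_locus_def)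
    note D = proj_pointsD[OF pp(1)]
    have "x1 \<in> P \<and> x2 \<in> P \<and> x3 \<in> P" using smooth_at_cubics(2)[OF D(1) assms] pp(2) by blast
    then show ?thesis using lp(2)[OF D(1,2)] D(4) by blast
  qed
  moreover have "K \<in> singular_locus h"
  proof -
    have "(\<Sum>i\<in>UNIV. (v $ i)\<^sup>2 * pat (patterns ! k) $ i $ j) = 0" if "k = 1 \<or> k = 2 \<or> k = 3" for k j
      using that by (auto simp: v_def sum_4 pat_def patterns_def)
    then have "K \<in> singular_locus (cform (pat (patterns ! k)))" if "k = 1 \<or> k = 2 \<or> k = 3" for k
      unfolding K_def using that by (intro singular_kernel_point[OF char2, of v 4]) (simp_all add: v_def)
    then show ?thesis using assms unfolding cubics_form by blast
  qed
  ultimately have "singular_locus h = {K}" by blast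
  then show ?thesis unfolding v_def[symmetric] lp(3) .
qed

text \<open>The right-hand side is the line in the whole projective space; it lies on the surface
  because \<open>cubic5\<close> belongs to the ideal of x1 and x2.\<close>

lemma singular_cubic5: "singular_locus (cubic5 :: (4, 'k) mpoly) = zero_locus {0} {x1, x2}"
proof -
  have "hypersurface cubic5 \<subseteq> P" if "ideal P poly_ring" "x1 \<in> P" "x2 \<in> P" for P :: "(4, 'k) mpoly set"
  proof -
    have "cubic5 = (x1 * x3) * x1 + (x2 * x4) * (x2 :: (4, 'k) mpoly)"
      by (simp add: cubic5_def power2_eq_square mult_ac)
    also have "\<dots> \<in> P" using that by (intro ideal_add ideal_mult)
    finally show ?thesis using that(1) by (auto simp: hypersurface_eq intro: ideal_mult)
  qed
  then have "P \<in> proj_points (hypersurface cubic5) \<longleftrightarrow> P \<in> proj_points {0}" if "x1 \<in> P" "x2 \<in> P" for P :: "(4, 'k) mpoly set"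
    using that by (auto simp: proj_points_def primeideal_poly_ring_iff ideal_0)
  then show ?thesis
    using smooth_at_cubics(3) proj_pointsD(1) by (auto simp: singular_locus_def zero_locus_def)
qed

text \<open>The fraction \<open>x\<^sub>2 / x\<^sub>1\<close>, whose square is \<open>x\<^sub>3 / x\<^sub>4\<close>, is integral but not regular along the
  line \<open>x\<^sub>1 = x\<^sub>2 = 0\<close>.\<close>

lemma not_normal_cubic5: "\<not> normal_scheme (hypersurface (cubic5 :: (4, 'k) mpoly))"
proof
  let ?I = "hypersurface (cubic5 :: (4, 'k) mpoly)"
  assume normal: "normal_scheme ?I"
  let ?\<tau> = "\<lambda>i. if i = 1 \<or> i = 2 then 0 else (Var i :: (4, 'k) mpoly)"
  \<comment> \<open>The generic point of the line x1 = x2 = 0.\<close>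
  define P where "P = {f. subst ?\<tau> f = 0}"
  have \<tau>_hom: "homogeneous (Suc 0) (?\<tau> i)" for i by simp
  have P_mem: "P \<in> proj_points ?I"
    unfolding P_def by (rule kernel_in_proj_points[of ?\<tau> cubic5 3, OF \<tau>_hom]) (simp_all add: cubic5_def subst_simps)
  interpret proj_point ?I P using ideal_hypersurface P_mem by (rule proj_points_point)
  interpret R: cring "local_ring ?I P" by (rule cring_local_ring)
  have "x4 \<notin> P" "x1 \<in> P" "x2 \<in> P" by (simp_all add: P_def)
  then have fr: "(x1, x4) \<in> fractions P" "(x2, x4) \<in> fractions P" "(x3, x4) \<in> fractions P" "(0, x4) \<in> fractions P"
    by (auto intro!: fractionsI[where d="Suc 0"])
  define a b where "a = frac ?I P x2 x4" and "b = frac ?I P x1 x4"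
  \<comment> \<open>The equation is (x2/x4)^2 + (x3/x4) (x1/x4)^2 = 0, with denominator x4 outside P
    and vanishing middle coefficient.\<close>
  define c where "c i = (if i = 0 then frac ?I P x3 x4 else frac ?I P 0 1)" for i :: nat
  have car: "a \<in> carrier (local_ring ?I P)" "b \<in> carrier (local_ring ?I P)" "c i \<in> carrier (local_ring ?I P)" for i
    unfolding a_def b_def c_def using fr frac_closed fractions_01 by auto
  have notdvd: "\<not> cubic5 dvd s * x1" if "s \<notin> P" for s :: "(4, 'k) mpoly"
  proof
    assume "cubic5 dvd s * x1"
    then obtain e where e: "s * x1 = cubic5 * e" by (elim dvdE)
    have "kill 1 (cubic5 * e) = 0" unfolding e[symmetric] by simp
    then have "kill 1 e = 0" by (simp add: cubic5_def)
    then obtain e' where "e = x1 * e'" by (auto simp: kill_eq_0 elim: dvdE)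
    then have "x1 * s = x1 * (cubic5 * e')" using e by (simp add: mult_ac)
    then have "s = cubic5 * e'" by simp
    then have "s \<in> ?I" by (simp add: hypersurface_iff)
    then show False using \<open>s \<notin> P\<close> proj_pointsD(3)[OF P_mem] by blast
  qed
  have b0: "b \<noteq> \<zero>\<^bsub>local_ring ?I P\<^esub>"
    unfolding b_def local_ring_zero frac_eq_iff[OF fr(1) fractions_01(1)]
    using notdvd by (auto simp: hypersurface_iff)
  have rel: "(a [^]\<^bsub>local_ring ?I P\<^esub> (2::nat)) \<oplus>\<^bsub>local_ring ?I P\<^esub>
      (\<Oplus>\<^bsub>local_ring ?I P\<^esub>i\<in>{..<2}. c i \<otimes>\<^bsub>local_ring ?I P\<^esub> (a [^]\<^bsub>local_ring ?I P\<^esub> i) \<otimes>\<^bsub>local_ring ?I P\<^esub> (b [^]\<^bsub>local_ring ?I P\<^esub> (2 - i)))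
      = \<zero>\<^bsub>local_ring ?I P\<^esub>"
  proof -
    have pw: "a [^]\<^bsub>local_ring ?I P\<^esub> (2::nat) = frac ?I P (x2\<^sup>2) (x4\<^sup>2)" "b [^]\<^bsub>local_ring ?I P\<^esub> (2::nat) = frac ?I P (x1\<^sup>2) (x4\<^sup>2)"
      "(x2\<^sup>2, x4\<^sup>2) \<in> fractions P" "(x1\<^sup>2, x4\<^sup>2) \<in> fractions P"
      using frac_pow[OF fr(2), of 2] frac_pow[OF fr(1), of 2] by (simp_all add: a_def b_def)
    have c1: "c 1 = \<zero>\<^bsub>local_ring ?I P\<^esub>" by (simp add: c_def)
    have set: "{..<2::nat} = {0, 1}" by auto
    have "(\<Oplus>\<^bsub>local_ring ?I P\<^esub>i\<in>{..<2}. c i \<otimes>\<^bsub>local_ring ?I P\<^esub> (a [^]\<^bsub>local_ring ?I P\<^esub> i) \<otimes>\<^bsub>local_ring ?I P\<^esub> (b [^]\<^bsub>local_ring ?I P\<^esub> (2 - i)))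
        = c 0 \<otimes>\<^bsub>local_ring ?I P\<^esub> (b [^]\<^bsub>local_ring ?I P\<^esub> (2::nat))"
      unfolding set using car c1 by (subst R.finsum_insert) (auto simp del: local_ring_zero local_ring_one)
    also have "\<dots> = frac ?I P (x3 * x1\<^sup>2) (x4 * x4\<^sup>2)"
      unfolding pw(2) using fr pw by (simp add: c_def)
    finally have "(a [^]\<^bsub>local_ring ?I P\<^esub> (2::nat)) \<oplus>\<^bsub>local_ring ?I P\<^esub>
      (\<Oplus>\<^bsub>local_ring ?I P\<^esub>i\<in>{..<2}. c i \<otimes>\<^bsub>local_ring ?I P\<^esub> (a [^]\<^bsub>local_ring ?I P\<^esub> i) \<otimes>\<^bsub>local_ring ?I P\<^esub> (b [^]\<^bsub>local_ring ?I P\<^esub> (2 - i)))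
      = frac ?I P (x2\<^sup>2) (x4\<^sup>2) \<oplus>\<^bsub>local_ring ?I P\<^esub> frac ?I P (x3 * x1\<^sup>2) (x4 * x4\<^sup>2)" using pw(1) by simp
    also have "\<dots> = frac ?I P (x2\<^sup>2 * (x4 * x4\<^sup>2) + x3 * x1\<^sup>2 * x4\<^sup>2) (x4\<^sup>2 * (x4 * x4\<^sup>2))"
      using fr pw by (intro frac_add fractions_mult)
    also have "\<dots> = frac ?I P 0 1"
    proof (rule frac_eqI)
      show "(x2\<^sup>2 * (x4 * x4\<^sup>2) + x3 * x1\<^sup>2 * x4\<^sup>2, x4\<^sup>2 * (x4 * x4\<^sup>2)) \<in> fractions P"
        using fr pw by (intro fractions_add fractions_mult)
      have "x2\<^sup>2 * (x4 * x4\<^sup>2) + x3 * x1\<^sup>2 * x4\<^sup>2 = x4\<^sup>2 * (cubic5 :: (4, 'k) mpoly)"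
        by (simp add: cubic5_def algebra_simps)
      then show "(x2\<^sup>2 * (x4 * x4\<^sup>2) + x3 * x1\<^sup>2 * x4\<^sup>2) * 1 - 0 * (x4\<^sup>2 * (x4 * x4\<^sup>2)) \<in> ?I"
        by (simp add: hypersurface_iff)
    qed (rule fractions_01)
    finally show ?thesis by simp
  qed
  have "integrally_closed_domain (local_ring ?I P)" using normal P_mem by (simp add: normal_scheme_def)
  from integrally_closed_domainD[OF this car(1,2) _ b0 rel] car(3)
  obtain q where q: "q \<in> carrier (local_ring ?I P)" "a = q \<otimes>\<^bsub>local_ring ?I P\<^esub> b" by auto
  obtain u f where uf: "(u, f) \<in> fractions P" "q = frac ?I P u f" using q(1) by (rule local_ring_carrierE)
  have "frac ?I P x2 x4 = frac ?I P (u * x1) (f * x4)"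
    using q(2) uf fr by (simp add: a_def b_def)
  then obtain s where s: "s \<notin> P" "s * (x2 * (f * x4) - (u * x1) * x4) \<in> ?I"
    unfolding frac_eq_iff[OF fr(2) fractions_mult[OF uf(1) fr(1)]] by blast
  then obtain e where e: "s * (x2 * (f * x4) - (u * x1) * x4) = cubic5 * e" by (auto simp: hypersurface_iff elim: dvdE)
  \<comment> \<open>Setting x1 to zero and cancelling one x2 leaves s f x4 divisible by x2, which
    would put it into P.\<close>
  have "kill 1 (s * f * x4) * x2 = kill 1 (s * (x2 * (f * x4) - (u * x1) * x4))"
    by (simp add: kill_def subst_simps mult_ac)
  also have "\<dots> = (x2 * x4 * kill 1 e) * x2" unfolding e by (simp add: cubic5_def power2_eq_square mult_ac)
  finally have "kill 1 (s * f * x4) = x2 * x4 * kill 1 e" by simp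
  then have 0: "subst ?\<tau> (kill 1 (s * f * x4)) = 0" by (simp add: subst_simps)
  have "subst ?\<tau> (kill 1 g) = subst ?\<tau> g" for g
    unfolding kill_def subst_subst by (rule arg_cong[of _ _ "\<lambda>t. subst t g"]) auto
  then have "s * f * x4 \<in> P" unfolding P_def mem_Collect_eq using 0 by (simp only:)
  moreover have "s * f * x4 \<notin> P"
    using uf(1) by (intro P_mult s(1) \<open>x4 \<notin> P\<close>) (simp add: fractions_def)
  ultimately show False by blast
qed

end

theorem theorem4p1:
  assumes "CHAR('k::alg_closed_field) = 2"
  shows
    "(\<forall>h :: (4, 'k) mpoly. homogeneous 3 h \<and> nondegenerate h \<longrightarrow>
        (\<not> frobenius_split (hypersurface h) \<longleftrightarrow>
           (\<exists>!i. i < 5 \<and> lin_equiv h ([cubic1, cubic2, cubic3, cubic4, cubic5] ! i)))) \<and>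
     (smooth_hypersurface (cubic1 :: (4, 'k) mpoly) \<and>
      \<not> frobenius_split (hypersurface (cubic1 :: (4, 'k) mpoly)) \<and>
      (\<forall>h :: (4, 'k) mpoly. homogeneous 3 h \<and> h \<noteq> 0 \<and> smooth_hypersurface h \<and>
         \<not> frobenius_split (hypersurface h) \<longrightarrow> proj_equiv h cubic1)) \<and>
     (\<forall>h \<in> {cubic2, cubic3, cubic4 :: (4, 'k) mpoly}.
        normal_scheme (hypersurface h) \<and>
        singular_locus h = {rational_point (vector [0, 0, 0, 1])}) \<and>
     (\<not> normal_scheme (hypersurface (cubic5 :: (4, 'k) mpoly)) \<and>
      singular_locus (cubic5 :: (4, 'k) mpoly) = zero_locus {0} {x1, x2})"
proof -
  have "lin_equiv (cubic1 :: (4, 'k) mpoly) (cubics ! 0)"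
    unfolding lin_equiv_def by (intro exI[of _ "mat 1"]) (simp add: cubics_def invertible_det_nz)
  then have not_split: "\<not> frobenius_split (hypersurface (cubic1 :: (4, 'k) mpoly))"
    by (intro not_split_of_lin_equiv[OF assms, of 0]) simp_all
  show ?thesis
  proof (intro conjI allI ballI impI; (elim conjE)?)
    fix h :: "(4, 'k) mpoly" assume "homogeneous 3 h" "nondegenerate h"
    then show "\<not> frobenius_split (hypersurface h) \<longleftrightarrow>
        (\<exists>!i. i < 5 \<and> lin_equiv h ([cubic1, cubic2, cubic3, cubic4, cubic5] ! i))"
      by (rule split_criterion[OF assms, unfolded cubics_def])
  next
    fix h :: "(4, 'k) mpoly"
    assume "homogeneous 3 h" "smooth_hypersurface h" "\<not> frobenius_split (hypersurface h)"
    then show "proj_equiv h cubic1" by (rule smooth_not_split[OF assms])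
  next
    fix h :: "(4, 'k) mpoly" assume "h \<in> {cubic2, cubic3, cubic4}"
    then show "normal_scheme (hypersurface h)" "singular_locus h = {rational_point (vector [0, 0, 0, 1])}"
      by (rule normal_cubics[OF assms], rule singular_normal_cubics[OF assms])
  qed (rule not_split smooth_cubic1[OF assms] not_normal_cubic5[OF assms] singular_cubic5[OF assms])+
qed

end
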